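(* Let $k$ be an arbitrary field and let $G$ be an infinite finitely presented group that has no nontrivial finite quotients. Let $n\in\mathbb N$ and let $\Gamma$ be an elementary grading on the full matrix algebra $M_n(k)$ such that the universal group of $\Gamma$ is isomorphic to $G$; regard $\Gamma$ as a grading by its universal group $G$. Denote by $\rho\colon M_n(k)\to M_n(k)\otimes kG$ the corresponding coaction, i.e. $\rho(a)=a\otimes g$ for $a\in M_n(k)^{(g)}$, $g\in G$, and let $V:=\mathrm{cosupp}\,\rho$. Let $\psi^{\mathbf{Hopf}}_{M_n(k),V}$ be the action of the $V$-universal acting Hopf algebra on $M_n(k)$. Then $$\mathrm{cosupp}\,\psi^{\mathbf{Hopf}}_{M_n(k),V}=k\,\mathrm{id}_{M_n(k)}\subsetneqq V=\mathrm{cosupp}\,\rho.$$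
   Context: Gradings. A grading by a group $G$ on an algebra $A$ is a decomposition $\Gamma\colon A=\bigoplus_{g\in G}A^{(g)}$ into subspaces with $A^{(g)}A^{(h)}\subseteq A^{(gh)}$; $\mathrm{supp}\,\Gamma=\{g\mid A^{(g)}\neq0\}$. An elementary grading on $M_n(k)$ defined by $(g_1,\dots,g_n)\in G^n$ is the grading with matrix units $e_{ij}\in M_n(k)^{(g_ig_j^{-1})}$. A realization of $\Gamma$ as a $G'$-grading is a grading of $A$ by a group $G'$ with the same set of nonzero homogeneous components; it gives an injection $\mathrm{supp}\,\Gamma\hookrightarrow G'$. The universal group of $\Gamma$ is a group $G_\Gamma$ with a realization of $\Gamma$ as a $G_\Gamma$-grading and corresponding injection $\varkappa_\Gamma\colon\mathrm{supp}\,\Gamma\hookrightarrow G_\Gamma$, such that for every realization of $\Gamma$ by a group $G'$ with injection $\psi\colon\mathrm{supp}\,\Gamma\hookrightarrow G'$ there is a unique group homomorphism $\varphi\colon G_\Gamma\to G'$ with $\varphi\varkappa_\Gamma=\psi$. Cosupports. For a Hopf algebra $H$, an $H$-coaction on $A$ is an algebra homomorphism $\rho\colon A\to A\otimes H$ making $A$ a right $H$-comodule, and $\mathrm{cosupp}\,\rho=\{a\mapsto\lambda(a_{(1)})a_{(0)}\mid\lambda\in H^*\}\subseteq\mathrm{End}_k(A)$, where $\rho(a)=a_{(0)}\otimes a_{(1)}$. An $H$-action on $A$ is a linear map $\psi\colon H\otimes A\to A$ making $A$ a left $H$-module with $h(ab)=(h_{(1)}a)(h_{(2)}b)$, and $\mathrm{cosupp}\,\psi=\{\psi(h\otimes(-))\mid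 h\in H\}\subseteq\mathrm{End}_k(A)$. Convention: (co)actions on unital associative algebras are assumed unital, i.e. $\rho(1_A)=1_A\otimes1_H$, respectively $h1_A=\varepsilon(h)1_A$. $V$-universal acting Hopf algebra. For a unital subalgebra $V\subseteq\mathrm{End}_k(A)$ it is a Hopf algebra ${}_\square\mathcal H(A,V)$ with an action $\psi^{\mathbf{Hopf}}_{A,V}\colon{}_\square\mathcal H(A,V)\otimes A\to A$, $\mathrm{cosupp}\,\psi^{\mathbf{Hopf}}_{A,V}\subseteq V$, such that for every Hopf algebra $H$ and every $H$-action $\psi$ on $A$ with $\mathrm{cosupp}\,\psi\subseteq V$ there is a unique Hopf algebra homomorphism $\varphi\colon H\to{}_\square\mathcal H(A,V)$ with $\psi=\psi^{\mathbf{Hopf}}_{A,V}(\varphi\otimes\mathrm{id}_A)$. It is known to exist for every $V$. *)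

theory Defs
  imports
    "HOL-Algebra.Coset"
    "HOL-Algebra.Module"
    "HOL-Library.Poly_Mapping"
    "Jordan_Normal_Form.VS_Connect"
begin

section \<open>Algebras over a field\<close>

text \<open>
  The ground field is a type \<^typ>\<open>'k\<close> of class \<^class>\<open>field\<close>; \<^term>\<open>class_ring\<close> is that
  field as a ring record. The locale \<^locale>\<open>algebra\<close> of \<^theory>\<open>HOL-Algebra.Module\<close>
  only covers commutative algebras, hence the next definition.
\<close>

definition unital_algebra :: "('k::field, 'a, 'm) module_scheme \<Rightarrow> bool" where
  "unital_algebra A \<longleftrightarrow>
     Module.module class_ring A \<and> ring A \<and>
     (\<forall>c. \<forall>x\<in>carrier A. \<forall>y\<in>carrier A.
        (c \<odot>\<^bsub>A\<^esub> x) \<otimes>\<^bsub>A\<^esub> y = c \<odot>\<^bsub>A\<^esub> (x \<otimes>\<^bsub>A\<^esub> y) \<and>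
        x \<otimes>\<^bsub>A\<^esub> (c \<odot>\<^bsub>A\<^esub> y) = c \<odot>\<^bsub>A\<^esub> (x \<otimes>\<^bsub>A\<^esub> y))"

definition alg_hom ::
    "('k::field, 'a, 'm) module_scheme \<Rightarrow> ('k, 'b, 'l) module_scheme \<Rightarrow> ('a \<Rightarrow> 'b) set" where
  "alg_hom A B = LinearCombinations.module_hom class_ring A B \<inter> Ring.ring_hom A B"

definition base_algebra :: "('k::field, 'k) module" where
  "base_algebra =
     \<lparr>carrier = UNIV, monoid.mult = (*), one = 1, zero = 0, add = (+), smult = (*)\<rparr>"


section \<open>Tensor products\<close>

text \<open>
  The tensor product of \<open>A\<close> and \<open>B\<close> is the quotient of the free vector space on
  \<open>carrier A \<times> carrier B\<close> by the subspace generated by the bilinearity relations.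
  Its elements are cosets.
\<close>

type_synonym ('k, 'a, 'b) tensor = "(('a \<times> 'b) \<Rightarrow>\<^sub>0 'k) set"

definition formal_sums ::
    "('k::field, 'a, 'm) module_scheme \<Rightarrow> ('k, 'b, 'l) module_scheme \<Rightarrow> (('a \<times> 'b) \<Rightarrow>\<^sub>0 'k) set" where
  "formal_sums A B = {x. Poly_Mapping.keys x \<subseteq> carrier A \<times> carrier B}"

definition scale_sum :: "'k::field \<Rightarrow> ('x \<Rightarrow>\<^sub>0 'k) \<Rightarrow> ('x \<Rightarrow>\<^sub>0 'k)" where
  "scale_sum c = Poly_Mapping.map ((*) c)"

inductive_set tensor_relations ::
    "('k::field, 'a, 'm) module_scheme \<Rightarrow> ('k, 'b, 'l) module_scheme \<Rightarrow> (('a \<times> 'b) \<Rightarrow>\<^sub>0 'k) set"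
  for A B where
    zero: "0 \<in> tensor_relations A B"
  | add: "x \<in> tensor_relations A B \<Longrightarrow> y \<in> tensor_relations A B \<Longrightarrow> x + y \<in> tensor_relations A B"
  | scale: "x \<in> tensor_relations A B \<Longrightarrow> scale_sum c x \<in> tensor_relations A B"
  | add_left: "a \<in> carrier A \<Longrightarrow> a' \<in> carrier A \<Longrightarrow> b \<in> carrier B \<Longrightarrow>
      Poly_Mapping.single (a \<oplus>\<^bsub>A\<^esub> a', b) 1 - Poly_Mapping.single (a, b) 1
        - Poly_Mapping.single (a', b) 1 \<in> tensor_relations A B"
  | add_right: "a \<in> carrier A \<Longrightarrow> b \<in> carrier B \<Longrightarrow> b' \<in> carrier B \<Longrightarrow>
      Poly_Mapping.single (a, b \<oplus>\<^bsub>B\<^esub> b') 1 - Poly_Mapping.single (a, b) 1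
        - Poly_Mapping.single (a, b') 1 \<in> tensor_relations A B"
  | scale_left: "a \<in> carrier A \<Longrightarrow> b \<in> carrier B \<Longrightarrow>
      Poly_Mapping.single (c \<odot>\<^bsub>A\<^esub> a, b) 1 - Poly_Mapping.single (a, b) c \<in> tensor_relations A B"
  | scale_right: "a \<in> carrier A \<Longrightarrow> b \<in> carrier B \<Longrightarrow>
      Poly_Mapping.single (a, c \<odot>\<^bsub>B\<^esub> b) 1 - Poly_Mapping.single (a, b) c \<in> tensor_relations A B"

definition tensor_class ::
    "('k::field, 'a, 'm) module_scheme \<Rightarrow> ('k, 'b, 'l) module_scheme \<Rightarrow>
     (('a \<times> 'b) \<Rightarrow>\<^sub>0 'k) \<Rightarrow> ('k, 'a, 'b) tensor" where
  "tensor_class A B x = {y. y - x \<in> tensor_relations A B}"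

definition pure_tensor ::
    "('k::field, 'a, 'm) module_scheme \<Rightarrow> ('k, 'b, 'l) module_scheme \<Rightarrow>
     'a \<Rightarrow> 'b \<Rightarrow> ('k, 'a, 'b) tensor" where
  "pure_tensor A B a b = tensor_class A B (Poly_Mapping.single (a, b) 1)"

text \<open>
  The operations are computed on representatives; as the result does not depend on the
  representatives, the unions below are unions of equal cosets. The multiplication is \<open>(a \<otimes> b)(a' \<otimes> b') = aa' \<otimes> bb'\<close>;
  it is only meaningful when \<open>A\<close> and \<open>B\<close> are algebras.
\<close>

definition tensor_product ::
    "('k::field, 'a, 'm) module_scheme \<Rightarrow> ('k, 'b, 'l) module_scheme \<Rightarrow>
     ('k, ('k, 'a, 'b) tensor) module" where
  "tensor_product A B =
     \<lparr>carrier = tensor_class A B ` formal_sums A B,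
      monoid.mult = (\<lambda>X Y. \<Union>x\<in>X. \<Union>y\<in>Y. tensor_class A B
        (\<Sum>p\<in>Poly_Mapping.keys x. \<Sum>q\<in>Poly_Mapping.keys y.
           Poly_Mapping.single (fst p \<otimes>\<^bsub>A\<^esub> fst q, snd p \<otimes>\<^bsub>B\<^esub> snd q)
             (Poly_Mapping.lookup x p * Poly_Mapping.lookup y q))),
      one = pure_tensor A B \<one>\<^bsub>A\<^esub> \<one>\<^bsub>B\<^esub>,
      zero = tensor_class A B 0,
      add = (\<lambda>X Y. \<Union>x\<in>X. \<Union>y\<in>Y. tensor_class A B (x + y)),
      smult = (\<lambda>c X. \<Union>x\<in>X. tensor_class A B (scale_sum c x))\<rparr>"

text \<open>
  \<open>tensor_lift C f\<close> is the linear map out of the tensor product induced by the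
  bilinear map \<open>f\<close> into \<open>C\<close>: the image \<open>\<Sum> c f(a, b)\<close> of a
  representative \<open>\<Sum> c (a, b)\<close> of a coset is the same for all representatives.
\<close>

definition tensor_lift ::
    "('k::field, 'c, 'm) module_scheme \<Rightarrow> ('a \<Rightarrow> 'b \<Rightarrow> 'c) \<Rightarrow> ('k, 'a, 'b) tensor \<Rightarrow> 'c" where
  "tensor_lift C f X =
     the_elem ((\<lambda>x. \<Oplus>\<^bsub>C\<^esub>p\<in>Poly_Mapping.keys x. Poly_Mapping.lookup x p \<odot>\<^bsub>C\<^esub> f (fst p) (snd p)) ` X)"

text \<open>\<open>tensor_map A' B' f g\<close> is \<open>f \<otimes> g\<close> with values in \<open>A' \<otimes> B'\<close>.\<close>

definition tensor_map ::
    "('k::field, 'c, 'm) module_scheme \<Rightarrow> ('k, 'd, 'l) module_scheme \<Rightarrow>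
     ('a \<Rightarrow> 'c) \<Rightarrow> ('b \<Rightarrow> 'd) \<Rightarrow> ('k, 'a, 'b) tensor \<Rightarrow> ('k, 'c, 'd) tensor" where
  "tensor_map A' B' f g =
     tensor_lift (tensor_product A' B') (\<lambda>a b. pure_tensor A' B' (f a) (g b))"

text \<open>The canonical isomorphism from \<open>A \<otimes> (B \<otimes> C)\<close> to \<open>(A \<otimes> B) \<otimes> C\<close>.\<close>

definition tensor_assoc ::
    "('k::field, 'a, 'm) module_scheme \<Rightarrow> ('k, 'b, 'l) module_scheme \<Rightarrow> ('k, 'c, 'j) module_scheme \<Rightarrow>
     ('k, 'a, ('k, 'b, 'c) tensor) tensor \<Rightarrow> ('k, ('k, 'a, 'b) tensor, 'c) tensor" where
  "tensor_assoc A B C =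
     (let T = tensor_product (tensor_product A B) C in
      tensor_lift T (\<lambda>a. tensor_lift T (\<lambda>b c.
        pure_tensor (tensor_product A B) C (pure_tensor A B a b) c)))"


section \<open>Hopf algebras\<close>

record (overloaded) ('k::zero, 'h) hopf = "('k, 'h) module" +
  comult :: "'h \<Rightarrow> ('k, 'h, 'h) tensor"
  counit :: "'h \<Rightarrow> 'k"
  antipode :: "'h \<Rightarrow> 'h"

definition hopf_algebra :: "('k::field, 'h) hopf \<Rightarrow> bool" where
  "hopf_algebra H \<longleftrightarrow>
     unital_algebra H \<and>
     comult H \<in> alg_hom H (tensor_product H H) \<and>
     counit H \<in> alg_hom H base_algebra \<and>
     antipode H \<in> LinearCombinations.module_hom class_ring H H \<and>
     (\<forall>h\<in>carrier H.
        tensor_map (tensor_product H H) H (comult H) (\<lambda>x. x) (comult H h) =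
          tensor_assoc H H H (tensor_map H (tensor_product H H) (\<lambda>x. x) (comult H) (comult H h)) \<and>
        tensor_lift H (\<lambda>x y. counit H x \<odot>\<^bsub>H\<^esub> y) (comult H h) = h \<and>
        tensor_lift H (\<lambda>x y. counit H y \<odot>\<^bsub>H\<^esub> x) (comult H h) = h \<and>
        tensor_lift H (\<lambda>x y. antipode H x \<otimes>\<^bsub>H\<^esub> y) (comult H h) = counit H h \<odot>\<^bsub>H\<^esub> \<one>\<^bsub>H\<^esub> \<and>
        tensor_lift H (\<lambda>x y. x \<otimes>\<^bsub>H\<^esub> antipode H y) (comult H h) = counit H h \<odot>\<^bsub>H\<^esub> \<one>\<^bsub>H\<^esub>)"

text \<open>Bialgebra homomorphisms; these automatically commute with the antipodes.\<close>

definition hopf_hom :: "('k::field, 'h) hopf \<Rightarrow> ('k, 'l) hopf \<Rightarrow> ('h \<Rightarrow> 'l) set" where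
  "hopf_hom H K =
     {f \<in> alg_hom H K. \<forall>h\<in>carrier H.
        comult K (f h) = tensor_map K K f f (comult H h) \<and> counit K (f h) = counit H h}"

text \<open>\<open>h a\<close> is \<open>\<psi> (h \<otimes> a)\<close>; the last condition is the convention that actions are unital.\<close>

definition hopf_action ::
    "('k::field, 'h) hopf \<Rightarrow> ('k, 'a, 'm) module_scheme \<Rightarrow> (('k, 'h, 'a) tensor \<Rightarrow> 'a) \<Rightarrow> bool" where
  "hopf_action H A \<psi> \<longleftrightarrow>
     \<psi> \<in> LinearCombinations.module_hom class_ring (tensor_product H A) A \<and>
     (\<forall>a\<in>carrier A.
        \<psi> (pure_tensor H A \<one>\<^bsub>H\<^esub> a) = a \<and>
        (\<forall>g\<in>carrier H. \<forall>h\<in>carrier H.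
           \<psi> (pure_tensor H A (g \<otimes>\<^bsub>H\<^esub> h) a) = \<psi> (pure_tensor H A g (\<psi> (pure_tensor H A h a))))) \<and>
     (\<forall>h\<in>carrier H. \<forall>a\<in>carrier A. \<forall>b\<in>carrier A.
        \<psi> (pure_tensor H A h (a \<otimes>\<^bsub>A\<^esub> b)) =
          tensor_lift A (\<lambda>x y. \<psi> (pure_tensor H A x a) \<otimes>\<^bsub>A\<^esub> \<psi> (pure_tensor H A y b)) (comult H h)) \<and>
     (\<forall>h\<in>carrier H. \<psi> (pure_tensor H A h \<one>\<^bsub>A\<^esub>) = counit H h \<odot>\<^bsub>A\<^esub> \<one>\<^bsub>A\<^esub>)"

definition hopf_coaction ::
    "('k::field, 'h) hopf \<Rightarrow> ('k, 'a, 'm) module_scheme \<Rightarrow> ('a \<Rightarrow> ('k, 'a, 'h) tensor) \<Rightarrow> bool" where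
  "hopf_coaction H A \<rho> \<longleftrightarrow>
     \<rho> \<in> alg_hom A (tensor_product A H) \<and>
     (\<forall>a\<in>carrier A.
        tensor_map (tensor_product A H) H \<rho> (\<lambda>x. x) (\<rho> a) =
          tensor_assoc A H H (tensor_map A (tensor_product H H) (\<lambda>x. x) (comult H) (\<rho> a)) \<and>
        tensor_lift A (\<lambda>x h. counit H h \<odot>\<^bsub>A\<^esub> x) (\<rho> a) = a)"

text \<open>Elements of \<open>End\<^sub>k(A)\<close> are represented as extensional functions on \<open>carrier A\<close>.\<close>

definition cosupp_action ::
    "('k::field, 'h) hopf \<Rightarrow> ('k, 'a, 'm) module_scheme \<Rightarrow> (('k, 'h, 'a) tensor \<Rightarrow> 'a) \<Rightarrow> ('a \<Rightarrow> 'a) set"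
  where
  "cosupp_action H A \<psi> = {(\<lambda>a\<in>carrier A. \<psi> (pure_tensor H A h a)) |h. h \<in> carrier H}"

definition cosupp_coaction ::
    "('k::field, 'h) hopf \<Rightarrow> ('k, 'a, 'm) module_scheme \<Rightarrow> ('a \<Rightarrow> ('k, 'a, 'h) tensor) \<Rightarrow> ('a \<Rightarrow> 'a) set"
  where
  "cosupp_coaction H A \<rho> =
     {(\<lambda>a\<in>carrier A. tensor_lift A (\<lambda>x h. l h \<odot>\<^bsub>A\<^esub> x) (\<rho> a)) |l.
        l \<in> LinearCombinations.module_hom class_ring H base_algebra}"

definition scalar_maps :: "('k::field, 'a, 'm) module_scheme \<Rightarrow> ('a \<Rightarrow> 'a) set" where
  "scalar_maps A = {(\<lambda>a\<in>carrier A. c \<odot>\<^bsub>A\<^esub> a) |c. True}"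

text \<open>
  A formula cannot quantify over types, so \<open>H\<close> ranges over the Hopf algebras whose
  carrier is a subset of the type \<^typ>\<open>'h\<close>. A universal acting Hopf algebra in the usual sense
  satisfies this for every \<^typ>\<open>'h\<close>. Conversely, since every element of a Hopf algebra lies
  in a Hopf subalgebra of countable dimension, and homomorphisms on these glue by uniqueness,
  the case of \<open>nat \<Rightarrow>\<^sub>0 'k\<close> in place of \<^typ>\<open>'h\<close> gives the universal property for all Hopf algebras.
\<close>

definition universal_acting_hopf_algebra ::
    "'h itself \<Rightarrow> ('k::field, 'a, 'm) module_scheme \<Rightarrow> ('a \<Rightarrow> 'a) set \<Rightarrow>
     ('k, 'u) hopf \<Rightarrow> (('k, 'u, 'a) tensor \<Rightarrow> 'a) \<Rightarrow> bool" where
  "universal_acting_hopf_algebra _ A V U \<psi>U \<longleftrightarrow>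
     hopf_algebra U \<and> hopf_action U A \<psi>U \<and> cosupp_action U A \<psi>U \<subseteq> V \<and>
     (\<forall>(H :: ('k, 'h) hopf) \<psi>.
        hopf_algebra H \<and> hopf_action H A \<psi> \<and> cosupp_action H A \<psi> \<subseteq> V \<longrightarrow>
        (\<exists>!\<phi>. \<phi> \<in> extensional (carrier H) \<and> \<phi> \<in> hopf_hom H U \<and>
           (\<forall>t\<in>carrier (tensor_product H A). \<psi> t = \<psi>U (tensor_map U A \<phi> (\<lambda>x. x) t))))"


section \<open>Group algebras\<close>

definition group_algebra :: "('g, 'm) monoid_scheme \<Rightarrow> ('k::field, 'g \<Rightarrow>\<^sub>0 'k) module" where
  "group_algebra G =
     \<lparr>carrier = {x. Poly_Mapping.keys x \<subseteq> carrier G},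
      monoid.mult = (\<lambda>x y. \<Sum>g\<in>Poly_Mapping.keys x. \<Sum>h\<in>Poly_Mapping.keys y.
        Poly_Mapping.single (g \<otimes>\<^bsub>G\<^esub> h) (Poly_Mapping.lookup x g * Poly_Mapping.lookup y h)),
      one = Poly_Mapping.single \<one>\<^bsub>G\<^esub> 1,
      zero = 0,
      add = (+),
      smult = scale_sum\<rparr>"

definition group_hopf_algebra :: "('g, 'm) monoid_scheme \<Rightarrow> ('k::field, 'g \<Rightarrow>\<^sub>0 'k) hopf" where
  "group_hopf_algebra G =
     module.extend (group_algebra G)
       (hopf.fields
         (\<lambda>x. tensor_class (group_algebra G) (group_algebra G)
            (\<Sum>g\<in>Poly_Mapping.keys x. Poly_Mapping.single (Poly_Mapping.single g 1, Poly_Mapping.single g 1) (Poly_Mapping.lookup x g)))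
         (\<lambda>x. \<Sum>g\<in>Poly_Mapping.keys x. Poly_Mapping.lookup x g)
         (\<lambda>x. \<Sum>g\<in>Poly_Mapping.keys x. Poly_Mapping.single (inv\<^bsub>G\<^esub> g) (Poly_Mapping.lookup x g)))"


section \<open>Gradings and universal groups\<close>

definition grading ::
    "('k::field, 'a, 'm) module_scheme \<Rightarrow> ('g, 'l) monoid_scheme \<Rightarrow> ('g \<Rightarrow> 'a set) \<Rightarrow> bool" where
  "grading A G \<Gamma> \<longleftrightarrow>
     group G \<and>
     (\<forall>g\<in>carrier G. Module.submodule (\<Gamma> g) class_ring A) \<and>
     (\<forall>a\<in>carrier A. \<exists>!d. (\<forall>g\<in>carrier G. d g \<in> \<Gamma> g) \<and> (\<forall>g. g \<notin> carrier G \<longrightarrow> d g = \<zero>\<^bsub>A\<^esub>) \<and>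
        finite {g. d g \<noteq> \<zero>\<^bsub>A\<^esub>} \<and> a = (\<Oplus>\<^bsub>A\<^esub>g\<in>{g. d g \<noteq> \<zero>\<^bsub>A\<^esub>}. d g)) \<and>
     (\<forall>g\<in>carrier G. \<forall>h\<in>carrier G. \<forall>a\<in>\<Gamma> g. \<forall>b\<in>\<Gamma> h. a \<otimes>\<^bsub>A\<^esub> b \<in> \<Gamma> (g \<otimes>\<^bsub>G\<^esub> h))"

definition grading_supp ::
    "('k::field, 'a, 'm) module_scheme \<Rightarrow> ('g, 'l) monoid_scheme \<Rightarrow> ('g \<Rightarrow> 'a set) \<Rightarrow> 'g set" where
  "grading_supp A G \<Gamma> = {g \<in> carrier G. \<Gamma> g \<noteq> {\<zero>\<^bsub>A\<^esub>}}"

definition grading_realization ::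
    "('k::field, 'a, 'm) module_scheme \<Rightarrow> ('g, 'l) monoid_scheme \<Rightarrow> ('g \<Rightarrow> 'a set) \<Rightarrow>
     ('h, 'j) monoid_scheme \<Rightarrow> ('h \<Rightarrow> 'a set) \<Rightarrow> bool" where
  "grading_realization A G \<Gamma> G' \<Gamma>' \<longleftrightarrow>
     grading A G' \<Gamma>' \<and> \<Gamma>' ` grading_supp A G' \<Gamma>' = \<Gamma> ` grading_supp A G \<Gamma>"

text \<open>The injection of the support of \<open>\<Gamma>\<close> into \<open>G'\<close> given by a realization \<open>\<Gamma>'\<close>.\<close>

definition realization_map ::
    "('g \<Rightarrow> 'a set) \<Rightarrow> ('h, 'j) monoid_scheme \<Rightarrow> ('h \<Rightarrow> 'a set) \<Rightarrow> 'g \<Rightarrow> 'h" where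
  "realization_map \<Gamma> G' \<Gamma>' g = (THE g'. g' \<in> carrier G' \<and> \<Gamma>' g' = \<Gamma> g)"

text \<open>
  \<open>universal_group A G\<^sub>0 \<Gamma>\<^sub>0 G \<Gamma>\<close>: the group \<open>G\<close>, with the realization \<open>\<Gamma>\<close>, is
  the universal group of \<open>\<Gamma>\<^sub>0\<close>. The test groups \<open>G'\<close> have their carriers in
  the type \<^typ>\<open>'g\<close> of \<open>G\<close>. If \<^typ>\<open>'g\<close> is infinite and the support of \<open>\<Gamma>\<^sub>0\<close> is
  countable, this is the universal property for all groups: every realization takes place
  in the countable subgroup generated by the image of the support, which has a copy in \<^typ>\<open>'g\<close>;
  and taking \<open>G' = G\<close> shows that the image of the support generates \<open>G\<close>.
\<close>

definition universal_group ::
    "('k::field, 'a, 'm) module_scheme \<Rightarrow> ('g0, 'l) monoid_scheme \<Rightarrow> ('g0 \<Rightarrow> 'a set) \<Rightarrow>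
     'g monoid \<Rightarrow> ('g \<Rightarrow> 'a set) \<Rightarrow> bool" where
  "universal_group A G\<^sub>0 \<Gamma>\<^sub>0 G \<Gamma> \<longleftrightarrow>
     grading_realization A G\<^sub>0 \<Gamma>\<^sub>0 G \<Gamma> \<and>
     (\<forall>(G' :: 'g monoid) \<Gamma>'. grading_realization A G\<^sub>0 \<Gamma>\<^sub>0 G' \<Gamma>' \<longrightarrow>
        (\<exists>!\<phi>. \<phi> \<in> extensional (carrier G) \<and> \<phi> \<in> hom G G' \<and>
           (\<forall>g\<in>grading_supp A G\<^sub>0 \<Gamma>\<^sub>0.
              \<phi> (realization_map \<Gamma>\<^sub>0 G \<Gamma> g) = realization_map \<Gamma>\<^sub>0 G' \<Gamma>' g)))"

definition matrix_unit :: "nat \<Rightarrow> nat \<Rightarrow> nat \<Rightarrow> 'k::field mat" where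
  "matrix_unit n i j = mat n n (\<lambda>p. if p = (i, j) then 1 else 0)"

abbreviation matrix_algebra :: "nat \<Rightarrow> ('k::field, 'k mat) module" where
  "matrix_algebra n \<equiv> module_mat TYPE('k) n n"

definition elementary_grading ::
    "nat \<Rightarrow> ('g, 'l) monoid_scheme \<Rightarrow> ('g \<Rightarrow> 'k::field mat set) \<Rightarrow> bool" where
  "elementary_grading n G \<Gamma> \<longleftrightarrow>
     grading (matrix_algebra n) G \<Gamma> \<and>
     (\<exists>\<gamma>\<in>{..<n} \<rightarrow> carrier G. \<forall>i<n. \<forall>j<n. matrix_unit n i j \<in> \<Gamma> (\<gamma> i \<otimes>\<^bsub>G\<^esub> inv\<^bsub>G\<^esub> \<gamma> j))"


section \<open>Finitely presented groups\<close>

text \<open>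
  The free group on \<open>m\<close> generators: words in letters \<open>(i, b)\<close>, which stand for the
  generator \<open>i\<close> if \<open>b\<close> holds and for its inverse otherwise, modulo insertion and
  deletion of adjacent mutually inverse letters.
\<close>

definition free_words :: "nat \<Rightarrow> (nat \<times> bool) list set" where
  "free_words m = lists ({..<m} \<times> UNIV)"

definition free_cancel :: "nat \<Rightarrow> ((nat \<times> bool) list \<times> (nat \<times> bool) list) set" where
  "free_cancel m = {(u @ [(i, b), (i, \<not> b)] @ v, u @ v) |u v i b.
     u \<in> free_words m \<and> v \<in> free_words m \<and> i < m}"

definition free_equiv :: "nat \<Rightarrow> ((nat \<times> bool) list \<times> (nat \<times> bool) list) set" where
  "free_equiv m = (free_cancel m \<union> (free_cancel m)\<inverse>)\<^sup>*"

definition free_group :: "nat \<Rightarrow> (nat \<times> bool) list set monoid" where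
  "free_group m =
     \<lparr>carrier = free_words m // free_equiv m,
      monoid.mult = (\<lambda>X Y. \<Union>x\<in>X. \<Union>y\<in>Y. free_equiv m `` {x @ y}),
      one = free_equiv m `` {[]}\<rparr>"

definition normal_closure :: "('g, 'l) monoid_scheme \<Rightarrow> 'g set \<Rightarrow> 'g set" where
  "normal_closure G R = \<Inter>{N. N \<lhd> G \<and> R \<subseteq> N}"

definition finitely_presented :: "('g, 'l) monoid_scheme \<Rightarrow> bool" where
  "finitely_presented G \<longleftrightarrow>
     (\<exists>m R. finite R \<and> R \<subseteq> carrier (free_group m) \<and>
        free_group m Mod normal_closure (free_group m) R \<cong> G)"

definition no_nontrivial_finite_quotient :: "('g, 'l) monoid_scheme \<Rightarrow> bool" where
  "no_nontrivial_finite_quotient G \<longleftrightarrow>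
     (\<forall>N. N \<lhd> G \<and> finite (carrier (G Mod N)) \<longrightarrow> N = carrier G)"

end

theory Submission
  imports Defs
    "HOL-Computational_Algebra.Polynomial"
    "HOL-Computational_Algebra.Primes"
    "HOL-Library.Function_Algebras"
    "HOL-Library.Countable_Set"
    "HOL-Algebra.Generated_Groups"
    "HOL-Algebra.Weak_Morphisms"
begin

text \<open>
  Let \<open>U\<close> act on \<open>A = M\<^sub>n(k)\<close> with cosupport in \<open>V\<close>. The members of \<open>V\<close> are scalar on each
  homogeneous component, so \<open>u \<in> U\<close> multiplies \<open>\<Gamma> g\<close> by a scalar \<open>\<lambda>\<^sub>g(u)\<close>, the weight of \<open>g\<close>. The law
  \<open>u(ab) = (u\<^sub>1 a)(u\<^sub>2 b)\<close> says that \<open>\<lambda>\<^sub>g\<^sub>h\<close> is the convolution product of \<open>\<lambda>\<^sub>g\<close> and \<open>\<lambda>\<^sub>h\<close> as soon as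
  \<open>\<Gamma> g \<cdot> \<Gamma> h \<noteq> 0\<close> (\<open>weight_mult\<close>). Since \<open>e\<^sub>i\<^sub>j e\<^sub>j\<^sub>i = e\<^sub>i\<^sub>i\<close> has degree \<open>1\<close>, and \<open>\<lambda>\<^sub>1\<close> is the counit, the weights
  are units of the convolution monoid of functionals on \<open>U\<close>, and the universal property of \<open>G\<close> extends
  them to a homomorphism \<open>\<Phi>\<close> from \<open>G\<close> to the group of units (\<open>universal_hom\<close>).

  For fixed \<open>u\<close> the function \<open>f(x) = \<Phi>(x)(u)\<close> satisfies \<open>f(xy) = \<Sum> \<Phi>(x)(u\<^sub>1) \<Phi>(y)(u\<^sub>2)\<close>, a finite sum of products
  of a function of \<open>x\<close> and a function of \<open>y\<close>. Hence its translates span a finite-dimensional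
  representation of \<open>G\<close>. The group \<open>G\<close> is generated by the finite support of the grading, and by
  Malcev's theorem a finitely generated matrix group is residually finite; as \<open>G\<close> has no nontrivial
  finite quotient, the representation is trivial and \<open>f\<close> is constant
  (\<open>representative_function_constant\<close>). So \<open>\<lambda>\<^sub>g(u) = \<lambda>\<^sub>1(u) = \<epsilon>(u)\<close> for every \<open>g\<close> in the support: each \<open>u\<close> acts as the scalar
  \<open>\<epsilon>(u)\<close>. On the other hand \<open>V\<close> contains the projection onto a component of degree \<open>g \<noteq> 1\<close>, which is
  not scalar because it kills the diagonal matrix units.

  Malcev's theorem rests on commutative algebra: a finitely generated subring of a field has, for
  each nonzero element \<open>x\<close>, a proper ideal of finite index modulo which \<open>x\<close> is invertible
  (\<open>separating_subring_containing_finite_set\<close>). Applied to the ring of the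
  entries of the generators and to a nonzero entry of \<open>g - 1\<close>, for a matrix \<open>g \<noteq> 1\<close> of the group, this
  gives a finite quotient of the group in which \<open>g\<close> survives.
\<close>

section \<open>Finite quotients of finitely generated subrings of a field\<close>

definition subring_of_ring :: "'a::comm_ring_1 set \<Rightarrow> bool" where
  "subring_of_ring R \<longleftrightarrow> 1 \<in> R \<and> (\<forall>x\<in>R. \<forall>y\<in>R. x - y \<in> R \<and> x * y \<in> R)"

definition ideal_of_subring :: "'a::comm_ring_1 set \<Rightarrow> 'a set \<Rightarrow> bool" where
  "ideal_of_subring R I \<longleftrightarrow> I \<subseteq> R \<and> 0 \<in> I \<and> (\<forall>x\<in>I. \<forall>y\<in>I. x + y \<in> I) \<and> (\<forall>r\<in>R. \<forall>x\<in>I. r * x \<in> I)"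

text \<open>
  A finite set of representatives modulo \<open>I\<close>; the index of \<open>I\<close> in \<open>R\<close> as an additive group is then
  finite, without forming the quotient.
\<close>

definition finite_index :: "'a::comm_ring_1 set \<Rightarrow> 'a set \<Rightarrow> bool" where
  "finite_index R I \<longleftrightarrow> (\<exists>T. finite T \<and> T \<subseteq> R \<and> (\<forall>x\<in>R. \<exists>t\<in>T. x - t \<in> I))"

definition polys_over :: "'a::comm_ring_1 set \<Rightarrow> 'a poly set" where
  "polys_over R = {p. \<forall>i. coeff p i \<in> R}"

definition adjoin :: "'a::comm_ring_1 set \<Rightarrow> 'a \<Rightarrow> 'a set" where
  "adjoin R a = (\<lambda>p. poly p a) ` polys_over R"

text \<open>
  Every nonzero element becomes a unit in some nonzero finite quotient ring. Asking for a unit, rather than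
  for a nonzero image, is what makes the property pass to \<open>R[a]\<close>: there one has to invert, in the
  finite quotient of \<open>R\<close>, the leading coefficient of a polynomial in \<open>a\<close>.
\<close>

definition separating :: "'a::comm_ring_1 set \<Rightarrow> bool" where
  "separating R \<longleftrightarrow> (\<forall>x\<in>R. x \<noteq> 0 \<longrightarrow>
     (\<exists>I. ideal_of_subring R I \<and> 1 \<notin> I \<and> finite_index R I \<and> (\<exists>s\<in>R. x * s - 1 \<in> I)))"

lemma subring_of_ringD:
  assumes "subring_of_ring R"
  shows "1 \<in> R" "0 \<in> R" "x \<in> R \<Longrightarrow> y \<in> R \<Longrightarrow> x - y \<in> R" "x \<in> R \<Longrightarrow> y \<in> R \<Longrightarrow> x * y \<in> R"
    "x \<in> R \<Longrightarrow> - x \<in> R" "x \<in> R \<Longrightarrow> y \<in> R \<Longrightarrow> x + y \<in> R" "x \<in> R \<Longrightarrow> x ^ N \<in> R"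
    "(\<And>i. i \<in> A \<Longrightarrow> f i \<in> R) \<Longrightarrow> sum f A \<in> R"
proof -
  show 1: "1 \<in> R" and diff: "x \<in> R \<Longrightarrow> y \<in> R \<Longrightarrow> x - y \<in> R"
    and mult: "x \<in> R \<Longrightarrow> y \<in> R \<Longrightarrow> x * y \<in> R" for x y
    using assms unfolding subring_of_ring_def by auto
  show 0: "0 \<in> R" using diff[OF 1 1] by simp
  show minus: "x \<in> R \<Longrightarrow> - x \<in> R" for x using diff[OF 0] by fastforce
  show plus: "x \<in> R \<Longrightarrow> y \<in> R \<Longrightarrow> x + y \<in> R" for x y using diff[of x "- y"] minus by simp
  show "x \<in> R \<Longrightarrow> x ^ N \<in> R" by (induction N) (auto intro: 1 mult)
  show "(\<And>i. i \<in> A \<Longrightarrow> f i \<in> R) \<Longrightarrow> sum f A \<in> R"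
    by (induction A rule: infinite_finite_induct) (auto intro: 0 plus)
qed

lemma ideal_of_subringD:
  assumes "subring_of_ring R" "ideal_of_subring R I"
  shows "x \<in> I \<Longrightarrow> x \<in> R" "0 \<in> I" "x \<in> I \<Longrightarrow> y \<in> I \<Longrightarrow> x + y \<in> I" "r \<in> R \<Longrightarrow> x \<in> I \<Longrightarrow> r * x \<in> I"
    "r \<in> R \<Longrightarrow> x \<in> I \<Longrightarrow> x * r \<in> I"
    "x \<in> I \<Longrightarrow> - x \<in> I" "x \<in> I \<Longrightarrow> y \<in> I \<Longrightarrow> x - y \<in> I"
    "(\<And>i. i \<in> A \<Longrightarrow> f i \<in> I) \<Longrightarrow> sum f A \<in> I"
proof -
  show "x \<in> I \<Longrightarrow> x \<in> R" and 0: "0 \<in> I" and plus: "x \<in> I \<Longrightarrow> y \<in> I \<Longrightarrow> x + y \<in> I"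
    and mult: "r \<in> R \<Longrightarrow> x \<in> I \<Longrightarrow> r * x \<in> I" for x y r
    using assms(2) unfolding ideal_of_subring_def by auto
  show "r \<in> R \<Longrightarrow> x \<in> I \<Longrightarrow> x * r \<in> I" using mult by (simp add: mult.commute)
  show minus: "x \<in> I \<Longrightarrow> - x \<in> I" for x
    using mult[of "-1" x] subring_of_ringD(1,5)[OF assms(1)] by auto
  show "x \<in> I \<Longrightarrow> y \<in> I \<Longrightarrow> x - y \<in> I" using plus[of x "- y"] minus by simp
  show "(\<And>i. i \<in> A \<Longrightarrow> f i \<in> I) \<Longrightarrow> sum f A \<in> I"
    by (induction A rule: infinite_finite_induct) (auto intro: 0 plus)
qed

lemma subring_polys_over: "subring_of_ring R \<Longrightarrow> subring_of_ring (polys_over R)"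
  unfolding subring_of_ring_def[of "polys_over R"]
  by (auto simp: polys_over_def coeff_mult subring_of_ringD intro!: subring_of_ringD(8))

lemma ideal_polys_over:
  "subring_of_ring R \<Longrightarrow> ideal_of_subring R I \<Longrightarrow> ideal_of_subring (polys_over R) (polys_over I)"
  unfolding ideal_of_subring_def[of "polys_over R"]
  by (auto simp: polys_over_def coeff_mult ideal_of_subringD intro!: ideal_of_subringD(8))

lemma subring_adjoin:
  assumes R: "subring_of_ring R"
  shows "subring_of_ring (adjoin R a)"
  unfolding subring_of_ring_def
proof (intro conjI ballI)
  note P = subring_of_ringD[OF subring_polys_over[OF R]]
  show "1 \<in> adjoin R a"
    unfolding adjoin_def using imageI[OF P(1), of "\<lambda>p. poly p a"] by simp
  fix x y assume "x \<in> adjoin R a" "y \<in> adjoin R a"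
  then obtain p q where *: "p \<in> polys_over R" "q \<in> polys_over R" "x = poly p a" "y = poly q a"
    unfolding adjoin_def by blast
  show "x - y \<in> adjoin R a" "x * y \<in> adjoin R a"
    unfolding adjoin_def using imageI[OF P(3)[OF *(1,2)], of "\<lambda>p. poly p a"]
      imageI[OF P(4)[OF *(1,2)], of "\<lambda>p. poly p a"] *(3,4) by simp_all
qed

lemma monom_polys_over: "subring_of_ring R \<Longrightarrow> r \<in> R \<Longrightarrow> monom r i \<in> polys_over R"
  by (auto simp: polys_over_def coeff_monom subring_of_ringD)

lemma smult_polys_over: "subring_of_ring R \<Longrightarrow> r \<in> R \<Longrightarrow> p \<in> polys_over R \<Longrightarrow> Polynomial.smult r p \<in> polys_over R"
  by (auto simp: polys_over_def subring_of_ringD)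

lemma adjoin_superset: "subring_of_ring R \<Longrightarrow> R \<subseteq> adjoin R a"
proof
  fix r assume "subring_of_ring R" "r \<in> R"
  then have "poly (monom r 0) a \<in> adjoin R a" unfolding adjoin_def by (intro imageI monom_polys_over)
  then show "r \<in> adjoin R a" by (simp add: poly_monom)
qed

lemma adjoin_generator: "subring_of_ring R \<Longrightarrow> a \<in> adjoin R a"
proof -
  assume "subring_of_ring R"
  then have "poly (monom 1 1) a \<in> adjoin R a" unfolding adjoin_def
    by (intro imageI monom_polys_over subring_of_ringD(1))
  then show ?thesis by (simp add: poly_monom)
qed

text \<open>
  Division with remainder keeps the coefficients in the subring once the dividend is multiplied by
  a power of the leading coefficient of the divisor.
\<close>

lemma pseudo_division_over_subring:
  fixes g :: "'a::idom poly"
  assumes R: "subring_of_ring R" and g: "g \<in> polys_over R" "g \<noteq> 0" and f: "f \<in> polys_over R"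
  obtains N t r where "t \<in> polys_over R" "r \<in> polys_over R"
    "Polynomial.smult (lead_coeff g ^ N) f = g * t + r" "r = 0 \<or> degree r < degree g"
proof -
  note P = subring_of_ringD[OF subring_polys_over[OF R]]
  have c: "lead_coeff g \<in> R" using g by (auto simp: polys_over_def)
  have "\<exists>N t r. t \<in> polys_over R \<and> r \<in> polys_over R \<and>
      Polynomial.smult (lead_coeff g ^ N) f = g * t + r \<and> (r = 0 \<or> degree r < degree g)"
    if "f = 0 \<or> degree f < n" "f \<in> polys_over R" for n f
    using that
  proof (induction n arbitrary: f)
    case 0
    then show ?case using P(2) by (intro exI[of _ 0]) auto
  next
    case (Suc n)
    show ?case
    proof (cases "f = 0 \<or> degree f < degree g")
      case True
      then show ?thesis using P(2) Suc.prems by (intro exI[of _ 0] exI[of _ f]) auto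
    next
      case False
      define q where "q = monom (lead_coeff f) (degree f - degree g)"
      define f' where "f' = Polynomial.smult (lead_coeff g) f - g * q"
      have q: "q \<in> polys_over R"
        unfolding q_def using Suc.prems by (intro monom_polys_over R) (auto simp: polys_over_def)
      have f': "f' \<in> polys_over R"
        unfolding f'_def by (intro P q g smult_polys_over R c Suc.prems)
      have d: "degree f' \<le> degree f"
        unfolding f'_def q_def using False degree_mult_le[of g "monom (lead_coeff f) (degree f - degree g)"]
        by (intro degree_diff_le) (auto simp: degree_monom_eq)
      have "coeff (q * g) (degree f) = lead_coeff f * lead_coeff g"
        unfolding q_def using False by (simp add: coeff_monom_mult)
      then have "coeff f' (degree f) = 0"
        unfolding f'_def by (simp add: mult.commute)
      then have "f' = 0 \<or> degree f' < degree f"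
        using d by (metis le_neq_implies_less leading_coeff_0_iff)
      then have "f' = 0 \<or> degree f' < n" using Suc.prems(1) False by auto
      from Suc.IH[OF this f'] obtain N t r where IH: "t \<in> polys_over R" "r \<in> polys_over R"
          "Polynomial.smult (lead_coeff g ^ N) f' = g * t + r" "r = 0 \<or> degree r < degree g" by blast
      have "Polynomial.smult (lead_coeff g ^ Suc N) f = Polynomial.smult (lead_coeff g ^ N) (f' + g * q)"
        unfolding f'_def by (simp add: mult.commute)
      also have "\<dots> = g * (t + Polynomial.smult (lead_coeff g ^ N) q) + r"
        using IH(3) by (simp add: smult_add_right algebra_simps)
      finally have "Polynomial.smult (lead_coeff g ^ Suc N) f = g * (t + Polynomial.smult (lead_coeff g ^ N) q) + r" .
      moreover have "t + Polynomial.smult (lead_coeff g ^ N) q \<in> polys_over R"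
        by (intro P IH(1) smult_polys_over R subring_of_ringD(7)[OF R] c q)
      ultimately show ?thesis using IH(2,4) by blast
    qed
  qed
  from this[of f "Suc (degree f)"] f that show ?thesis by auto
qed

text \<open>
  Modulo \<open>I\<close> the polynomial \<open>m\<close> has an invertible leading coefficient, so a product \<open>m t\<close> which is
  congruent to a polynomial of degree below that of \<open>m\<close> is congruent to \<open>0\<close>.
\<close>

lemma cancel_multiple_modulo_ideal:
  fixes m :: "'a::idom poly"
  assumes R: "subring_of_ring R" and I: "ideal_of_subring R I"
    and m: "m \<in> polys_over R" and s: "s \<in> R" "lead_coeff m * s - 1 \<in> I"
    and t: "t \<in> polys_over R" and u: "u = 0 \<or> degree u < degree m"
    and eq: "u - m * t \<in> polys_over I"
  shows "u \<in> polys_over I"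
proof -
  note IP = ideal_of_subringD[OF subring_polys_over[OF R] ideal_polys_over[OF R I]]
  note ID = ideal_of_subringD[OF R I]
  have coeffs: "coeff t i \<in> R" "coeff m i \<in> R" for i using t m by (auto simp: polys_over_def)
  have "coeff t j \<in> I" for j
  proof (rule ccontr)
    assume nj: "coeff t j \<notin> I"
    \<comment> \<open>Compare the coefficients at \<open>degree m + M\<close>, where \<open>M\<close> is the largest index of a coefficient of \<open>t\<close> outside \<open>I\<close>.\<close>
    define S where "S = {i. coeff t i \<notin> I}"
    have "S \<subseteq> {..degree t}" using ID(2) by (auto simp: S_def) (metis coeff_eq_0 linorder_not_le)
    then have fin: "finite S" by (rule finite_subset) simp
    define M where "M = Max S"
    have M: "coeff t M \<notin> I" using Max_in[OF fin] nj unfolding M_def S_def by blast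
    have M': "coeff t i \<in> I" if "i > M" for i
      using Max_ge[OF fin, of i] that unfolding M_def S_def by fastforce
    have "coeff (m * t) (degree m + M) = (\<Sum>i\<le>degree m + M. coeff m i * coeff t (degree m + M - i))"
      by (rule coeff_mult)
    also have "\<dots> = lead_coeff m * coeff t M + (\<Sum>i\<in>{..degree m + M} - {degree m}. coeff m i * coeff t (degree m + M - i))"
      by (subst sum.remove[of _ "degree m"]) auto
    finally have 1: "coeff (m * t) (degree m + M) - lead_coeff m * coeff t M =
      (\<Sum>i\<in>{..degree m + M} - {degree m}. coeff m i * coeff t (degree m + M - i))" by simp
    have 2: "\<dots> \<in> I"
    proof (rule ID(8))
      fix i assume i: "i \<in> {..degree m + M} - {degree m}"
      show "coeff m i * coeff t (degree m + M - i) \<in> I"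
      proof (cases "i < degree m")
        case True then show ?thesis by (intro ID(4) coeffs M') auto
      next
        case False then show ?thesis using i ID(2) by (simp add: coeff_eq_0)
      qed
    qed
    have "coeff u (degree m + M) = 0" using u by (auto simp: coeff_eq_0)
    then have "- coeff (m * t) (degree m + M) \<in> I"
      using eq unfolding polys_over_def by (metis (mono_tags) coeff_diff diff_0 mem_Collect_eq)
    from ID(3)[OF this 2[folded 1]] ID(6) have "lead_coeff m * coeff t M \<in> I" by fastforce
    from ID(4)[OF s(1) this] ID(4)[OF coeffs(1)[of M] s(2)]
    have "s * (lead_coeff m * coeff t M) - coeff t M * (lead_coeff m * s - 1) \<in> I" by (rule ID(7))
    then show False using M by (simp add: algebra_simps)
  qed
  then have "t \<in> polys_over I" by (simp add: polys_over_def)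
  from IP(3)[OF eq IP(4)[OF m this]] show ?thesis by simp
qed

text \<open>
  The ideal \<open>J\<close> consists of the values at \<open>a\<close> of the polynomials in \<open>I[X] + m R[X]\<close>. The quotient of
  \<open>R[X]\<close> by that ideal is \<open>(R/I)[X]/(m)\<close>, which is finite and nonzero since \<open>m\<close> has positive degree and
  an invertible leading coefficient modulo \<open>I\<close>. The last hypothesis says that \<open>m\<close> divides every
  relation of \<open>a\<close>, up to a power of the leading coefficient; hence the quotient does not collapse
  when \<open>X\<close> is specialized to \<open>a\<close>.
\<close>

lemma ideal_adjoin:
  fixes m :: "'a::idom poly"
  assumes R: "subring_of_ring R" and I: "ideal_of_subring R I" "1 \<notin> I" "finite_index R I"
    and m: "m \<in> polys_over R" "degree m > 0" and s: "s \<in> R" "lead_coeff m * s - 1 \<in> I"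
    and ker: "\<And>p. p \<in> polys_over R \<Longrightarrow> poly p a = 0 \<Longrightarrow>
      \<exists>N. \<exists>t\<in>polys_over R. Polynomial.smult (lead_coeff m ^ N) p = m * t"
  obtains J where "ideal_of_subring (adjoin R a) J" "1 \<notin> J" "finite_index (adjoin R a) J"
    "I \<subseteq> J" "poly m a \<in> J"
proof -
  note RD = subring_of_ringD[OF R]
  note RP = subring_of_ringD[OF subring_polys_over[OF R]]
  note IP = ideal_of_subringD[OF subring_polys_over[OF R] ideal_polys_over[OF R I(1)]]
  note ID = ideal_of_subringD[OF R I(1)]
  define c where "c = lead_coeff m"
  have c: "c \<in> R" using m by (auto simp: polys_over_def c_def)
  have inv: "(s * c) ^ N - 1 \<in> I" for N
  proof (induction N)
    case 0 then show ?case using ID(2) by simp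
  next
    case (Suc N)
    have "(s * c) ^ Suc N - 1 = (s * c) * ((s * c) ^ N - 1) + (c * s - 1)" by (simp add: algebra_simps)
    also have "\<dots> \<in> I" by (intro ID RD s c Suc s(2)[folded c_def])
    finally show ?case .
  qed
  define K where "K = {p \<in> polys_over R. \<exists>t\<in>polys_over R. p - m * t \<in> polys_over I}"
  define J where "J = (\<lambda>p. poly p a) ` K"
  have K: "ideal_of_subring (polys_over R) K"
    unfolding ideal_of_subring_def
  proof (intro conjI ballI)
    show "K \<subseteq> polys_over R" by (auto simp: K_def)
    show "0 \<in> K" using RP(2) IP(2) by (auto simp: K_def intro!: bexI[of _ 0])
    fix p q assume "p \<in> K" "q \<in> K"
    then obtain t t' where *: "p \<in> polys_over R" "q \<in> polys_over R" "t \<in> polys_over R" "t' \<in> polys_over R"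
       "p - m * t \<in> polys_over I" "q - m * t' \<in> polys_over I" by (auto simp: K_def)
    have "p + q - m * (t + t') \<in> polys_over I" using IP(3)[OF *(5,6)] by (simp add: algebra_simps)
    then show "p + q \<in> K" using * RP by (auto simp: K_def)
  next
    fix p q assume "p \<in> polys_over R" "q \<in> K"
    then obtain t' where *: "p \<in> polys_over R" "q \<in> polys_over R" "t' \<in> polys_over R"
       "q - m * t' \<in> polys_over I" by (auto simp: K_def)
    have "p * q - m * (p * t') \<in> polys_over I" using IP(4)[OF *(1,4)] by (simp add: algebra_simps)
    then show "p * q \<in> K" using * RP by (auto simp: K_def)
  qed
  note KD = ideal_of_subringD[OF subring_polys_over[OF R] K]
  have J: "ideal_of_subring (adjoin R a) J"
    unfolding ideal_of_subring_def
  proof (intro conjI ballI)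
    show "J \<subseteq> adjoin R a" unfolding J_def adjoin_def using KD(1) by blast
    show "0 \<in> J" unfolding J_def using imageI[OF KD(2), of "\<lambda>p. poly p a"] by simp
    show "x + y \<in> J" if "x \<in> J" "y \<in> J" for x y
    proof -
      from that obtain p q where pq: "p \<in> K" "q \<in> K" "x = poly p a" "y = poly q a" unfolding J_def by blast
      show ?thesis unfolding J_def using imageI[OF KD(3)[OF pq(1,2)], of "\<lambda>p. poly p a"] pq(3,4) by simp
    qed
    show "r * x \<in> J" if "r \<in> adjoin R a" "x \<in> J" for r x
    proof -
      from that obtain p q where pq: "p \<in> polys_over R" "q \<in> K" "r = poly p a" "x = poly q a"
        unfolding J_def adjoin_def by blast
      show ?thesis unfolding J_def using imageI[OF KD(4)[OF pq(1,2)], of "\<lambda>p. poly p a"] pq(3,4) by simp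
    qed
  qed
  have "1 \<notin> J"
  proof
    assume "1 \<in> J"
    then obtain p t where p: "p \<in> polys_over R" "poly p a = 1" "t \<in> polys_over R" "p - m * t \<in> polys_over I"
      by (auto simp: J_def K_def)
    have "\<exists>N. \<exists>t\<in>polys_over R. Polynomial.smult (lead_coeff m ^ N) (p - 1) = m * t"
      using p RP by (intro ker) auto
    then obtain N t' where t': "t' \<in> polys_over R" "Polynomial.smult (c ^ N) (p - 1) = m * t'" by (auto simp: c_def)
    have cN: "c ^ N \<in> R" using c RD by auto
    have "monom (c ^ N) 0 * (p - m * t) \<in> polys_over I"
      by (intro IP(4) monom_polys_over R cN p)
    also have "monom (c ^ N) 0 * (p - m * t) = monom (c ^ N) 0 - m * (Polynomial.smult (c ^ N) t - t')"
      using t'(2) by (simp add: monom_0 algebra_simps smult_diff_right)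
    finally have *: "monom (c ^ N) 0 - m * (Polynomial.smult (c ^ N) t - t') \<in> polys_over I" .
    have "Polynomial.smult (c ^ N) t - t' \<in> polys_over R"
      by (intro RP smult_polys_over R cN p t')
    from cancel_multiple_modulo_ideal[OF R I(1) m(1) s this _ *] m(2)
    have "monom (c ^ N) 0 \<in> polys_over I" by (simp add: monom_0)
    then have "c ^ N \<in> I" by (auto simp: polys_over_def coeff_monom split: if_splits)
    then have "s ^ N * c ^ N \<in> I" using s RD by (intro ID(4)) auto
    from ID(7)[OF this inv[of N, unfolded power_mult_distrib]] I(2) show False by simp
  qed
  moreover have "finite_index (adjoin R a) J"
  proof -
    obtain T where T: "finite T" "T \<subseteq> R" "\<And>x. x \<in> R \<Longrightarrow> \<exists>t\<in>T. x - t \<in> I"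
      using I(3) by (auto simp: finite_index_def)
    obtain \<tau> where \<tau>: "\<And>x. x \<in> R \<Longrightarrow> \<tau> x \<in> T" "\<And>x. x \<in> R \<Longrightarrow> x - \<tau> x \<in> I" using T(3) by metis
    \<comment> \<open>Representatives: polynomials in \<open>a\<close> of degree below \<open>degree m\<close> with coefficients in \<open>T\<close>.\<close>
    define F where "F = ({..<degree m} \<rightarrow>\<^sub>E T)"
    define T' where "T' = (\<lambda>f. \<Sum>i<degree m. f i * a ^ i) ` F"
    have "finite T'" unfolding T'_def F_def using T(1) by (intro finite_imageI finite_PiE) auto
    moreover have sum_monom: "(\<Sum>i<degree m. f i * a ^ i) = poly (\<Sum>i<degree m. monom (f i) i) a" for f
      by (simp add: poly_sum poly_monom)
    have monoms: "(\<Sum>i<degree m. monom (f i) i) \<in> polys_over R" if "f \<in> F" for f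
      using that T(2) by (intro RP(8) monom_polys_over R) (auto simp: F_def)
    have "T' \<subseteq> adjoin R a"
      unfolding T'_def adjoin_def sum_monom using monoms by blast
    moreover have "\<exists>t\<in>T'. x - t \<in> J" if "x \<in> adjoin R a" for x
    proof -
      from that obtain p where p: "p \<in> polys_over R" "x = poly p a" by (auto simp: adjoin_def)
      have "m \<noteq> 0" using m(2) by auto
      from pseudo_division_over_subring[OF R m(1) this p(1)]
      obtain N t r where tr: "t \<in> polys_over R" "r \<in> polys_over R"
        "Polynomial.smult (c ^ N) p = m * t + r" "r = 0 \<or> degree r < degree m" unfolding c_def .
      have sN: "s ^ N \<in> R" using s RD by auto
      have cN: "c ^ N \<in> R" using c RD by auto
      define r' where "r' = Polynomial.smult (s ^ N) r"
      have r': "coeff r' i \<in> R" for i using tr sN RD by (auto simp: r'_def polys_over_def)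
      have deg: "degree r' < degree m" using tr(4) m(2) degree_smult_le[of "s ^ N" r]
         by (auto simp: r'_def)
      define f where "f = (\<lambda>i\<in>{..<degree m}. \<tau> (coeff r' i))"
      define w where "w = (\<Sum>i<degree m. monom (f i) i)"
      have f: "f \<in> F" using \<tau> r' by (auto simp: F_def f_def)
      have w: "w \<in> polys_over R" unfolding w_def using monoms[OF f] .
      have cw: "coeff w i = (if i < degree m then \<tau> (coeff r' i) else 0)" for i
        by (simp add: w_def coeff_sum coeff_monom f_def if_distrib cong: if_cong)
      have rw: "r' - w \<in> polys_over I"
        using \<tau> r' ID(2) deg by (auto simp: polys_over_def cw coeff_eq_0)
      \<comment> \<open>As \<open>s c\<close> is congruent to \<open>1\<close>, multiplying \<open>c\<^sup>N p = m t + r\<close> by \<open>s\<^sup>N\<close> recovers \<open>p\<close> modulo \<open>I[X]\<close>.\<close>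
      have "monom ((s * c) ^ N - 1) 0 * p \<in> polys_over I"
        using inv[of N] ID(2) by (intro IP(5) p) (auto simp: polys_over_def coeff_monom)
      moreover have "p - w - m * (Polynomial.smult (s ^ N) t) = (r' - w) - monom ((s * c) ^ N - 1) 0 * p"
      proof -
        have "Polynomial.smult ((s * c) ^ N) p = Polynomial.smult (s ^ N) (m * t + r)"
          by (simp add: power_mult_distrib flip: tr(3))
        then show ?thesis by (simp add: r'_def monom_0 smult_add_right smult_diff_left algebra_simps)
      qed
      ultimately have "p - w - m * (Polynomial.smult (s ^ N) t) \<in> polys_over I" using IP(7)[OF rw] by metis
      then have "p - w \<in> K" unfolding K_def using RP(3)[OF p(1) w] smult_polys_over[OF R sN tr(1)] by blast
      then have "poly (p - w) a \<in> J" unfolding J_def by blast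
      moreover have "poly w a \<in> T'" using f unfolding w_def T'_def by (auto simp flip: sum_monom)
      ultimately show ?thesis using p by auto
    qed
    ultimately show ?thesis unfolding finite_index_def by blast
  qed
  moreover have "I \<subseteq> J"
  proof
    fix x assume x: "x \<in> I"
    have "monom x 0 \<in> polys_over I" using x ID(2) by (auto simp: polys_over_def coeff_monom)
    then have "monom x 0 \<in> K" using RP(2) IP(1) by (auto simp: K_def intro!: bexI[of _ 0])
    then have "poly (monom x 0) a \<in> J" unfolding J_def by blast
    then show "x \<in> J" by (simp add: poly_monom)
  qed
  moreover have "poly m a \<in> J"
    unfolding J_def K_def using m RP(1) IP(2) by (auto intro!: imageI bexI[of _ 1])
  ultimately show ?thesis using J that by blast
qed

text \<open>
  Let \<open>x = q(a)\<close> be nonzero. If \<open>a\<close> is transcendental over \<open>R\<close>, the relation \<open>X q(X) = 1\<close> is imposed,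
  so that \<open>a\<close> itself becomes the inverse of \<open>x\<close>. If \<open>a\<close> is algebraic, \<open>m\<close> is a relation of \<open>a\<close> of least
  degree, and a nonzero multiple \<open>x'\<close> of \<open>x\<close> lies in \<open>R\<close>; it suffices to invert \<open>x'\<close> and the leading
  coefficient of \<open>m\<close> modulo an ideal of \<open>R\<close>.
\<close>

lemma separating_adjoin:
  fixes R :: "'k::field set"
  assumes R: "subring_of_ring R" and sep: "separating R"
  shows "separating (adjoin R a)"
  unfolding separating_def
proof (intro ballI impI)
  note RD = subring_of_ringD[OF R]
  note RP = subring_of_ringD[OF subring_polys_over[OF R]]
  note RA = subring_of_ringD[OF subring_adjoin[OF R]]
  note pdiv = pseudo_division_over_subring[OF R]
  fix x assume "x \<in> adjoin R a" and x0: "x \<noteq> 0"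
  then obtain q where q: "q \<in> polys_over R" "x = poly q a" by (auto simp: adjoin_def)
  then have q0: "q \<noteq> 0" using x0 by auto
  show "\<exists>J. ideal_of_subring (adjoin R a) J \<and> 1 \<notin> J \<and> finite_index (adjoin R a) J \<and>
     (\<exists>s\<in>adjoin R a. x * s - 1 \<in> J)"
  proof (cases "\<exists>p\<in>polys_over R. p \<noteq> 0 \<and> poly p a = 0")
    case False
    define m where "m = monom 1 1 * q - 1"
    have degm: "degree m = Suc (degree q)" "lead_coeff m = lead_coeff q"
    proof -
      have "degree (monom 1 1 * q) = Suc (degree q)"
        using q0 by (simp add: degree_mult_eq degree_monom_eq)
      then show "degree m = Suc (degree q)" unfolding m_def
        by (metis degree_1 degree_add_eq_left degree_minus diff_conv_add_uminus zero_less_Suc)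
      then show "lead_coeff m = lead_coeff q" by (simp add: m_def coeff_monom_mult)
    qed
    have m: "m \<in> polys_over R" unfolding m_def
      by (intro RP monom_polys_over R RD q)
    have "lead_coeff q \<in> R" "lead_coeff q \<noteq> 0" using q q0 by (auto simp: polys_over_def)
    with sep obtain I s where I: "ideal_of_subring R I" "1 \<notin> I" "finite_index R I" "s \<in> R"
      "lead_coeff q * s - 1 \<in> I" unfolding separating_def by blast
    have "\<exists>N. \<exists>t\<in>polys_over R. Polynomial.smult (lead_coeff m ^ N) p = m * t"
      if "p \<in> polys_over R" "poly p a = 0" for p
      using that False RP(2) by (auto intro!: bexI[of _ 0])
    then obtain J where J: "ideal_of_subring (adjoin R a) J" "1 \<notin> J" "finite_index (adjoin R a) J"
      "poly m a \<in> J"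
      using ideal_adjoin[OF R I(1-3) m _ I(4) I(5)[folded degm(2)], of a] degm(1) by (metis zero_less_Suc)
    have "x * a - 1 \<in> J" using J(4) by (simp add: m_def q poly_monom mult.commute)
    then have "\<exists>s\<in>adjoin R a. x * s - 1 \<in> J" by (rule bexI) (rule adjoin_generator[OF R])
    with J(1-3) show ?thesis by metis
  next
    case True
    then obtain p0 where "p0 \<in> polys_over R \<and> p0 \<noteq> 0 \<and> poly p0 a = 0" by auto
    from ex_has_least_nat[where P = "\<lambda>p. p \<in> polys_over R \<and> p \<noteq> 0 \<and> poly p a = 0", OF this, of degree]
    obtain m where m: "m \<in> polys_over R" "m \<noteq> 0" "poly m a = 0"
      and min: "\<And>p. p \<in> polys_over R \<Longrightarrow> p \<noteq> 0 \<Longrightarrow> poly p a = 0 \<Longrightarrow> degree m \<le> degree p"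
      by auto
    have dpos: "degree m > 0"
    proof (rule gr0I)
      assume "degree m = 0"
      then obtain b where "m = [:b:]" by (rule degree_eq_zeroE)
      then show False using m(2,3) by simp
    qed
    \<comment> \<open>An element \<open>u\<close> of least degree in the ideal \<open>(q, m)\<close> divides \<open>q\<close> and \<open>m\<close> up to constants. It cannot
      vanish at \<open>a\<close>, since \<open>q\<close> does not, so the cofactor of \<open>u\<close> in \<open>m\<close> does; by minimality of \<open>m\<close> this
      forces \<open>u\<close> to be a constant \<open>x'\<close>.\<close>
    define K where "K = {s * q + t * m | s t. s \<in> polys_over R \<and> t \<in> polys_over R}"
    have K: "u \<in> polys_over R" if "u \<in> K" for u using that q m RP by (auto simp: K_def)
    have Kmult: "u * v \<in> K" "v * u \<in> K" if "u \<in> K" "v \<in> polys_over R" for u v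
    proof -
      from that(1) obtain s t where "s \<in> polys_over R" "t \<in> polys_over R" "u = s * q + t * m" by (auto simp: K_def)
      then have "u * v = (s * v) * q + (t * v) * m" "s * v \<in> polys_over R" "t * v \<in> polys_over R"
        using that(2) RP by (auto simp: algebra_simps)
      then show "u * v \<in> K" unfolding K_def by blast
      then show "v * u \<in> K" by (simp add: mult.commute)
    qed
    have Kdiff: "u - v \<in> K" if "u \<in> K" "v \<in> K" for u v
    proof -
      from that obtain s t s' t' where "s \<in> polys_over R" "t \<in> polys_over R" "u = s * q + t * m"
        "s' \<in> polys_over R" "t' \<in> polys_over R" "v = s' * q + t' * m" unfolding K_def by blast
      then have "u - v = (s - s') * q + (t - t') * m" "s - s' \<in> polys_over R" "t - t' \<in> polys_over R"
        using RP by (auto simp: algebra_simps)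
      then show ?thesis unfolding K_def by blast
    qed
    have "1 * q + 0 * m \<in> K" "0 * q + 1 * m \<in> K" using RP(1,2) unfolding K_def by blast+
    then have qK: "q \<in> K" and mK: "m \<in> K" by simp_all
    obtain u where u: "u \<in> K" "u \<noteq> 0" and umin: "\<And>v. v \<in> K \<Longrightarrow> v \<noteq> 0 \<Longrightarrow> degree u \<le> degree v"
      using ex_has_least_nat[of "\<lambda>v. v \<in> K \<and> v \<noteq> 0" m degree] mK m(2) by auto
    have udvd: "\<exists>N. \<exists>t\<in>polys_over R. Polynomial.smult (lead_coeff u ^ N) v = u * t" if v: "v \<in> K" for v
    proof -
      obtain N t r where tr: "t \<in> polys_over R" "r \<in> polys_over R"
        "Polynomial.smult (lead_coeff u ^ N) v = u * t + r" "r = 0 \<or> degree r < degree u"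
        using pdiv[OF K[OF u(1)] u(2) K[OF v]] .
      have "lead_coeff u ^ N \<in> R" using K[OF u(1)] RD by (auto simp: polys_over_def)
      from Kmult(2)[OF v monom_polys_over[OF R this, of 0]]
      have "Polynomial.smult (lead_coeff u ^ N) v \<in> K" by (simp add: monom_0)
      from Kdiff[OF this Kmult(1)[OF u(1) tr(1)]] have "r \<in> K" using tr(3) by simp
      then show ?thesis using umin[of r] tr by force
    qed
    from udvd[OF mK] obtain N t where t: "t \<in> polys_over R" "Polynomial.smult (lead_coeff u ^ N) m = u * t" by blast
    have t0: "t \<noteq> 0" using t(2) u(2) m(2) by auto
    have "poly u a \<noteq> 0"
    proof
      assume ua: "poly u a = 0"
      from udvd[OF qK] obtain N t where "t \<in> polys_over R" "Polynomial.smult (lead_coeff u ^ N) q = u * t" by blast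
      then have "lead_coeff u ^ N * poly q a = 0" using ua by (metis mult_zero_left poly_mult poly_smult)
      then show False using u(2) q x0 by simp
    qed
    moreover have "poly u a * poly t a = 0" using t(2) m(3) by (metis mult_zero_right poly_mult poly_smult)
    ultimately have "poly t a = 0" by simp
    from min[OF t(1) t0 this] have "degree m \<le> degree t" .
    moreover have "degree m = degree u + degree t"
      using t(2) u(2) t0 by (metis degree_mult_eq degree_smult_eq leading_coeff_0_iff power_not_zero)
    ultimately have "degree u = 0" by simp
    then obtain x' where x': "u = [:x':]" by (metis degree_eq_zeroE)
    have x'R: "x' \<in> R" using K[OF u(1)] x' by (auto simp: polys_over_def dest: spec[of _ 0])
    from u(1) obtain s0 t0 where st: "s0 \<in> polys_over R" "u = s0 * q + t0 * m" by (auto simp: K_def)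
    have sx: "poly s0 a * x = x'" using arg_cong[OF st(2), of "\<lambda>p. poly p a"] x' m(3) q(2) by simp
    define c where "c = lead_coeff m"
    have c: "c \<in> R" "c \<noteq> 0" using m by (auto simp: polys_over_def c_def)
    have "c * x' \<in> R" "c * x' \<noteq> 0" using c x'R x' u(2) RD by auto
    with sep obtain I s where I: "ideal_of_subring R I" "1 \<notin> I" "finite_index R I" "s \<in> R"
      "c * x' * s - 1 \<in> I" unfolding separating_def by blast
    have "\<exists>N. \<exists>t\<in>polys_over R. Polynomial.smult (lead_coeff m ^ N) p = m * t"
      if p: "p \<in> polys_over R" "poly p a = 0" for p
    proof -
      obtain N t r where tr: "t \<in> polys_over R" "r \<in> polys_over R"
        "Polynomial.smult (lead_coeff m ^ N) p = m * t + r" "r = 0 \<or> degree r < degree m"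
        using pdiv[OF m(1,2) p(1)] .
      have "poly r a = 0" using arg_cong[OF tr(3), of "\<lambda>p. poly p a"] p(2) m(3) by simp
      then show ?thesis using min[of r] tr by force
    qed
    moreover have "x' * s \<in> R" "lead_coeff m * (x' * s) - 1 \<in> I" using x'R I RD by (auto simp: c_def mult.assoc)
    ultimately obtain J where J: "ideal_of_subring (adjoin R a) J" "1 \<notin> J" "finite_index (adjoin R a) J"
      "I \<subseteq> J" using ideal_adjoin[OF R I(1-3) m(1) dpos, of "x' * s" a] by blast
    have "poly s0 a * (c * s) \<in> adjoin R a"
      using st(1) c(1) I(4) adjoin_superset[OF R, of a] by (intro RA(4)) (auto simp: adjoin_def)
    moreover have "x * (poly s0 a * (c * s)) = c * x' * s" using sx by (simp add: algebra_simps)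
    then have "x * (poly s0 a * (c * s)) - 1 \<in> J" using subsetD[OF J(4) I(5)] by (simp only:)
    ultimately have "\<exists>s\<in>adjoin R a. x * s - 1 \<in> J" by (intro bexI)
    with J(1-3) show ?thesis by metis
  qed
qed

lemma subring_Ints: "subring_of_ring (\<int> :: 'a::comm_ring_1 set)"
  unfolding subring_of_ring_def by auto

text \<open>
  For a nonzero image \<open>x\<close> of the integer \<open>z\<close> reduce modulo a prime \<open>p\<close> not dividing \<open>z\<close>: any large \<open>p\<close> in
  characteristic \<open>0\<close>, and the characteristic itself otherwise.
\<close>

lemma separating_Ints: "separating (\<int> :: 'k::field set)"
  unfolding separating_def
proof (intro ballI impI)
  fix x :: 'k assume "x \<in> \<int>" and x0: "x \<noteq> 0"
  then obtain z where z: "x = of_int z" by (auto elim: Ints_cases)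
  have "\<exists>p::nat. prime p \<and> \<not> int p dvd z \<and> (\<forall>w. of_int w = (0::'k) \<longrightarrow> int p dvd w)"
  proof (cases "CHAR('k) = 0")
    case True
    have z0: "z \<noteq> 0" using x0 z by auto
    obtain p :: nat where p: "prime p" "p > nat \<bar>z\<bar>" using bigger_prime by blast
    have "\<not> int p dvd z" using p(2) z0 zdvd_not_zless[of "\<bar>z\<bar>" "int p"] by auto
    moreover have "w = 0" if "of_int w = (0::'k)" for w
      using that True by (simp add: of_int_eq_0_iff_char_dvd)
    ultimately show ?thesis using p(1) by (intro exI[of _ p]) (metis dvd_0_right)
  next
    case False
    then have "prime CHAR('k)" by (intro prime_CHAR_semidom) auto
    moreover have "\<not> int CHAR('k) dvd z" using x0 z by (simp add: of_int_eq_0_iff_char_dvd)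
    ultimately show ?thesis by (intro exI[of _ "CHAR('k)"]) (simp add: of_int_eq_0_iff_char_dvd)
  qed
  then obtain p :: nat where "prime p \<and> \<not> int p dvd z \<and> (\<forall>w. of_int w = (0::'k) \<longrightarrow> int p dvd w)" ..
  then have p: "prime p" "\<not> int p dvd z"
    and ker: "\<And>w. of_int w = (0::'k) \<Longrightarrow> int p dvd w" by simp_all
  define I where "I = range (\<lambda>w. of_int (int p * w) :: 'k)"
  have "ideal_of_subring \<int> I"
    unfolding ideal_of_subring_def
  proof (intro conjI ballI)
    show "I \<subseteq> \<int>" "0 \<in> I" by (auto simp: I_def image_iff intro: exI[of _ 0])
    show "x + y \<in> I" if "x \<in> I" "y \<in> I" for x y
    proof -
      from that obtain v w where "x = of_int (int p * v)" "y = of_int (int p * w)" by (auto simp: I_def)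
      then have "x + y = of_int (int p * (v + w))" by (simp add: algebra_simps)
      then show ?thesis unfolding I_def by blast
    qed
    show "r * y \<in> I" if "r \<in> \<int>" "y \<in> I" for r y
    proof -
      from that(1) obtain v where "r = of_int v" by (rule Ints_cases)
      moreover from that(2) obtain w where "y = of_int (int p * w)" unfolding I_def by (rule rangeE)
      ultimately have "r * y = of_int (int p * (v * w))" by (simp add: algebra_simps)
      then show ?thesis unfolding I_def by blast
    qed
  qed
  moreover have "1 \<notin> I"
  proof
    assume "1 \<in> I"
    then obtain w where "1 = (of_int (int p * w) :: 'k)" by (auto simp: I_def)
    then have "of_int (1 - int p * w) = (0::'k)" by simp
    from ker[OF this] have "int p dvd 1" by (simp add: dvd_diff_left_iff)
    then show False using p(1) by (auto simp: prime_nat_iff)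
  qed
  moreover have "finite_index \<int> I"
    unfolding finite_index_def
  proof (intro exI[of _ "of_int ` {0..<int p}"] conjI ballI)
    fix y :: 'k assume "y \<in> \<int>"
    then obtain v where v: "y = of_int v" by (auto elim: Ints_cases)
    have "v mod int p \<in> {0..<int p}" using p(1) prime_gt_0_nat[of p] by simp
    moreover have "v - v mod int p = int p * (v div int p)" by (simp add: minus_mod_eq_mult_div)
    then have "y - of_int (v mod int p) = of_int (int p * (v div int p))" unfolding v by (metis of_int_diff)
    then have "y - of_int (v mod int p) \<in> I" unfolding I_def by blast
    ultimately show "\<exists>t\<in>of_int ` {0..<int p}. y - t \<in> I" by blast
  qed auto
  moreover have "\<exists>s\<in>\<int>. x * s - 1 \<in> I"
  proof -
    have "coprime (int p) z" using p by (intro prime_imp_coprime) auto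
    then obtain u v where uv: "u * int p + v * z = 1" by (metis bezout_int coprime_imp_gcd_eq_1)
    have "x * of_int v - 1 = (of_int (z * v - 1) :: 'k)" unfolding z by simp
    also have "z * v - 1 = int p * (- u)" using uv by (simp add: algebra_simps)
    finally have "x * of_int v - 1 \<in> I" unfolding I_def by blast
    then show ?thesis by auto
  qed
  ultimately show "\<exists>I. ideal_of_subring \<int> I \<and> 1 \<notin> I \<and> finite_index \<int> I \<and> (\<exists>s\<in>\<int>. x * s - 1 \<in> I)"
    by (intro exI[of _ I] conjI)
qed

lemma separating_subring_containing_finite_set:
  fixes S :: "'k::field set"
  assumes "finite S"
  shows "\<exists>R. subring_of_ring R \<and> S \<subseteq> R \<and> separating R"
  using assms
proof (induction S)
  case empty
  show ?case using subring_Ints separating_Ints by (intro exI[of _ \<int>]) simp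
next
  case (insert a S)
  then obtain R where R: "subring_of_ring R" "S \<subseteq> R" "separating R" by (elim exE conjE)
  show ?case
  proof (rule exI[of _ "adjoin R a"], intro conjI)
    show "subring_of_ring (adjoin R a)" by (rule subring_adjoin[OF R(1)])
    show "insert a S \<subseteq> adjoin R a"
      using R(2) adjoin_superset[OF R(1), of a] adjoin_generator[OF R(1), of a] by auto
    show "separating (adjoin R a)" by (rule separating_adjoin[OF R(1,3)])
  qed
qed

section \<open>Representative functions on groups without finite quotients\<close>

lemma finite_image_if_factors:
  assumes "finite (f ` A)" and "\<And>x y. x \<in> A \<Longrightarrow> y \<in> A \<Longrightarrow> f x = f y \<Longrightarrow> h x = h y"
  shows "finite (h ` A)"
proof -
  have "h ` A \<subseteq> (\<lambda>v. h (SOME x. x \<in> A \<and> f x = v)) ` f ` A"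
  proof
    fix z assume "z \<in> h ` A"
    then obtain x where x: "x \<in> A" "z = h x" by auto
    have "(SOME y. y \<in> A \<and> f y = f x) \<in> A \<and> f (SOME y. y \<in> A \<and> f y = f x) = f x"
      using x(1) by (intro someI[of "\<lambda>y. y \<in> A \<and> f y = f x" x]) simp
    then have "z = h (SOME y. y \<in> A \<and> f y = f x)" using assms(2) x by metis
    then show "z \<in> (\<lambda>v. h (SOME x. x \<in> A \<and> f x = v)) ` f ` A" using x(1) by auto
  qed
  then show ?thesis using assms(1) finite_subset by blast
qed

text \<open>
  Malcev's argument. All entries of the representation lie in a finitely generated subring \<open>R\<close>. If
  some entry of \<open>\<rho>(g) - 1\<close> is nonzero, pick an ideal \<open>I\<close> of finite index in \<open>R\<close> not containing it; the elements
  congruent to \<open>1\<close> modulo \<open>I\<close> form a normal subgroup of finite index not containing \<open>g\<close>.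
\<close>

lemma matrix_representation_trivial:
  fixes G (structure) and \<rho> :: "'g \<Rightarrow> 'b \<Rightarrow> 'b \<Rightarrow> 'k::field"
  assumes "group G" and S: "finite S" "S \<subseteq> carrier G" "carrier G = generate G S"
    and no_quot: "no_nontrivial_finite_quotient G" and B: "finite B"
    and rep_one: "\<And>b c. b \<in> B \<Longrightarrow> c \<in> B \<Longrightarrow> \<rho> \<one> b c = of_bool (b = c)"
    and rep_mult: "\<And>x y b c. x \<in> carrier G \<Longrightarrow> y \<in> carrier G \<Longrightarrow> b \<in> B \<Longrightarrow> c \<in> B \<Longrightarrow>
      \<rho> (x \<otimes> y) b c = (\<Sum>d\<in>B. \<rho> x b d * \<rho> y d c)"
    and g: "g \<in> carrier G" "b \<in> B" "c \<in> B"
  shows "\<rho> g b c = of_bool (b = c)"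
proof (rule ccontr)
  assume nontriv: "\<rho> g b c \<noteq> of_bool (b = c)"
  interpret group G by fact
  define entries where "entries = (\<lambda>(x, b, c). \<rho> x b c) ` ((S \<union> m_inv G ` S) \<times> B \<times> B)"
  have "finite entries" unfolding entries_def using S(1) B by auto
  from separating_subring_containing_finite_set[OF this] obtain R where
    R: "subring_of_ring R" "entries \<subseteq> R" "separating R" by (elim exE conjE)
  note RD = subring_of_ringD[OF R(1)]
  have R01: "of_bool P \<in> R" for P using RD by (cases P) auto
  have entry: "\<rho> x b c \<in> R" if "x \<in> S \<union> m_inv G ` S" "b \<in> B" "c \<in> B" for x b c
  proof -
    from that have "(x, b, c) \<in> (S \<union> m_inv G ` S) \<times> B \<times> B" by simp
    from subsetD[OF R(2)[unfolded entries_def] imageI[OF this]] show ?thesis by simp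
  qed
  have in_R: "\<rho> x b c \<in> R" if "x \<in> carrier G" "b \<in> B" "c \<in> B" for x b c
  proof -
    have "x \<in> generate G S" using that(1) S(3) by simp
    then have "\<forall>b\<in>B. \<forall>c\<in>B. \<rho> x b c \<in> R"
    proof (induction x rule: generate.induct)
      case one then show ?case using rep_one R01 by simp
    next
      case (incl h) then show ?case using entry by simp
    next
      case (inv h) then show ?case using entry by simp
    next
      case (eng h1 h2)
      then have "h1 \<in> carrier G" "h2 \<in> carrier G" using S(3) by auto
      then show ?case using eng.IH rep_mult by (auto intro!: RD(4,8))
    qed
    then show ?thesis using that by blast
  qed
  define x where "x = \<rho> g b c - of_bool (b = c)"
  have "x \<in> R" "x \<noteq> 0" unfolding x_def using in_R g RD(3) R01 nontriv by auto
  with R(3) obtain I s where I: "ideal_of_subring R I" "1 \<notin> I" "finite_index R I" "s \<in> R" "x * s - 1 \<in> I"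
    unfolding separating_def by metis
  note ID = ideal_of_subringD[OF R(1) I(1)]
  have "x \<notin> I"
  proof
    assume "x \<in> I"
    from ID(7)[OF ID(5)[OF I(4) this] I(5)] I(2) show False by simp
  qed
  define E where "E = (\<lambda>h k. \<forall>b\<in>B. \<forall>c\<in>B. \<rho> h b c - \<rho> k b c \<in> I)"
  have E_refl: "E h h" for h using ID(2) by (simp add: E_def)
  have E_sym: "E k h" if "E h k" for h k
    using that ID(6) unfolding E_def by (metis minus_diff_eq)
  have E_trans: "E h l" if "E h k" "E k l" for h k l
    unfolding E_def
  proof (intro ballI)
    fix b c assume "b \<in> B" "c \<in> B"
    with that have "\<rho> h b c - \<rho> k b c \<in> I" "\<rho> k b c - \<rho> l b c \<in> I" by (auto simp: E_def)
    from ID(3)[OF this] show "\<rho> h b c - \<rho> l b c \<in> I" by simp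
  qed
  have E_left: "E (y \<otimes> h) (y \<otimes> k)" if "E h k" "y \<in> carrier G" "h \<in> carrier G" "k \<in> carrier G" for y h k
    using that in_R
    by (auto simp: E_def rep_mult simp flip: sum_subtractf right_diff_distrib intro!: ID(4,8))
  have E_right: "E (h \<otimes> y) (k \<otimes> y)" if "E h k" "y \<in> carrier G" "h \<in> carrier G" "k \<in> carrier G" for y h k
    using that in_R
    by (auto simp: E_def rep_mult simp flip: sum_subtractf left_diff_distrib intro!: ID(5,8))
  define N where "N = {h \<in> carrier G. E h \<one>}"
  have N: "subgroup N G"
  proof (rule subgroupI)
    show "N \<subseteq> carrier G" "N \<noteq> {}" using E_refl[of \<one>] by (auto simp: N_def)
    show "inv h \<in> N" if "h \<in> N" for h
      using that E_left[of h \<one> "inv h"] E_sym by (auto simp: N_def)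
    show "h \<otimes> k \<in> N" if "h \<in> N" "k \<in> N" for h k
      using that E_right[of h \<one> k] E_trans[of "h \<otimes> k" k \<one>] by (auto simp: N_def)
  qed
  have "N \<lhd> G"
    unfolding normal_inv_iff
  proof (intro conjI ballI N)
    fix y h assume "y \<in> carrier G" "h \<in> N"
    then show "y \<otimes> h \<otimes> inv y \<in> N"
      using E_right[OF E_left[of h \<one> y], of "inv y"] by (auto simp: N_def)
  qed
  moreover have "finite (carrier (G Mod N))"
  proof -
    obtain T where T: "finite T" "T \<subseteq> R" "\<And>x. x \<in> R \<Longrightarrow> \<exists>t\<in>T. x - t \<in> I"
      using I(3) by (auto simp: finite_index_def)
    obtain \<tau> where \<tau>: "\<And>x. x \<in> R \<Longrightarrow> \<tau> x \<in> T" "\<And>x. x \<in> R \<Longrightarrow> x - \<tau> x \<in> I" using T(3) by metis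
    define F where "F = (\<lambda>h. \<lambda>(b, c)\<in>B \<times> B. \<tau> (\<rho> h b c))"
    have "F ` carrier G \<subseteq> (B \<times> B) \<rightarrow>\<^sub>E T" using \<tau> in_R by (auto simp: F_def split: if_splits)
    moreover have "finite ((B \<times> B) \<rightarrow>\<^sub>E T)" using T(1) B by (intro finite_PiE) auto
    ultimately have "finite (F ` carrier G)" by (rule finite_subset)
    moreover have "N #> h = N #> k" if hk: "h \<in> carrier G" "k \<in> carrier G" "F h = F k" for h k
    proof -
      have "E h k"
        unfolding E_def
      proof (intro ballI)
        fix b c assume bc: "b \<in> B" "c \<in> B"
        then have "\<tau> (\<rho> h b c) = \<tau> (\<rho> k b c)"
          using fun_cong[OF hk(3), of "(b, c)"] by (simp add: F_def)
        then show "\<rho> h b c - \<rho> k b c \<in> I"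
          using ID(7)[OF \<tau>(2)[of "\<rho> h b c"] \<tau>(2)[of "\<rho> k b c"]] in_R bc hk by simp
      qed
      from E_right[OF this, of "inv k"] hk have "h \<otimes> inv k \<in> N" by (simp add: N_def)
      then have "h \<otimes> inv k \<otimes> k \<in> N #> k" unfolding r_coset_def by blast
      then have "h \<in> N #> k" using hk by (simp add: m_assoc)
      from repr_independence[OF this hk(2) N] show ?thesis by simp
    qed
    ultimately have "finite ((\<lambda>h. N #> h) ` carrier G)" by (rule finite_image_if_factors)
    moreover have "carrier (G Mod N) = (\<lambda>h. N #> h) ` carrier G"
      by (auto simp: FactGroup_def RCOSETS_def)
    ultimately show ?thesis by simp
  qed
  ultimately have "N = carrier G" using no_quot unfolding no_nontrivial_finite_quotient_def by simp
  then have "E g \<one>" using g(1) by (auto simp: N_def)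
  then show False using \<open>x \<notin> I\<close> g(2,3) by (auto simp: E_def x_def rep_one)
qed

lemma sum_fun_apply: "(\<Sum>i\<in>A. (h i :: 'a \<Rightarrow> 'b::comm_monoid_add)) x = (\<Sum>i\<in>A. h i x)"
  by (induction A rule: infinite_finite_induct) auto

interpretation fun_vs: vector_space "\<lambda>(c::'k::field) (f::'g \<Rightarrow> 'k) x. c * f x"
  by unfold_locales (auto simp: fun_eq_iff algebra_simps)

text \<open>
  The translates of \<open>f\<close> lie in the span of the finitely many functions \<open>\<alpha>\<^sub>i\<close>, so \<open>G\<close> acts on a
  finite-dimensional space that contains \<open>f\<close>. In coordinates this is a matrix representation of \<open>G\<close>, hence
  trivial; thus \<open>f\<close> equals its translates.
\<close>

lemma representative_function_constant:
  fixes G (structure) and f :: "'g \<Rightarrow> 'k::field"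
  assumes "group G" and S: "finite S" "S \<subseteq> carrier G" "carrier G = generate G S"
    and no_quot: "no_nontrivial_finite_quotient G" and P: "finite P"
    and rep: "\<And>x y. x \<in> carrier G \<Longrightarrow> y \<in> carrier G \<Longrightarrow> f (x \<otimes> y) = (\<Sum>i\<in>P. \<alpha> i x * \<beta> i y)"
    and g: "g \<in> carrier G"
  shows "f g = f \<one>"
proof -
  interpret group G by fact
  let ?scale = "\<lambda>(c::'k) (f::'g \<Rightarrow> 'k) x. c * f x"
  \<comment> \<open>Right translation; functions are made \<open>0\<close> outside the carrier, so that equality of functions is equality on \<open>G\<close>.\<close>
  define T where "T = (\<lambda>g (\<phi> :: 'g \<Rightarrow> 'k) x. if x \<in> carrier G then \<phi> (x \<otimes> g) else 0)"
  have T_mult: "T (x \<otimes> y) \<phi> = T x (T y \<phi>)" if "x \<in> carrier G" "y \<in> carrier G" for x y \<phi>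
    using that by (auto simp: T_def fun_eq_iff m_assoc)
  have T_sum: "T x (\<Sum>b\<in>B. ?scale (r b) b) = (\<Sum>b\<in>B. ?scale (r b) (T x b))" for x r B
    by (rule ext) (auto simp: T_def sum_fun_apply)
  define translates where "translates = (\<lambda>g. T g f) ` carrier G"
  obtain B where B: "B \<subseteq> translates" "fun_vs.independent B" "translates \<subseteq> fun_vs.span B"
    using fun_vs.maximal_independent_subset .
  have "translates \<subseteq> fun_vs.span ((\<lambda>i x. if x \<in> carrier G then \<alpha> i x else 0) ` P)"
  proof
    fix \<phi> assume "\<phi> \<in> translates"
    then obtain y where y: "y \<in> carrier G" "\<phi> = T y f" by (auto simp: translates_def)
    have "\<phi> = (\<Sum>i\<in>P. ?scale (\<beta> i y) (\<lambda>x. if x \<in> carrier G then \<alpha> i x else 0))"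
      using y rep by (auto simp: T_def fun_eq_iff sum_fun_apply mult.commute)
    also have "\<dots> \<in> fun_vs.span ((\<lambda>i x. if x \<in> carrier G then \<alpha> i x else 0) ` P)"
      by (intro fun_vs.span_sum fun_vs.span_scale fun_vs.span_base imageI)
    finally show "\<phi> \<in> fun_vs.span ((\<lambda>i x. if x \<in> carrier G then \<alpha> i x else 0) ` P)" .
  qed
  with B(1) have "finite B"
    using fun_vs.independent_span_bound[of "(\<lambda>i x. if x \<in> carrier G then \<alpha> i x else 0) ` P" B] B(2) P by auto
  have T_B: "T x b \<in> fun_vs.span B" if "x \<in> carrier G" "b \<in> B" for x b
  proof -
    obtain y where "y \<in> carrier G" "b = T y f" using B(1) \<open>b \<in> B\<close> by (auto simp: translates_def)
    then have "T x b \<in> translates" using that by (auto simp: translates_def simp flip: T_mult)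
    then show ?thesis using B(3) by blast
  qed
  have T_one: "T \<one> b = b" if "b \<in> B" for b
    using that B(1) by (auto simp: translates_def T_def fun_eq_iff)
  have expand: "(\<Sum>d\<in>B. ?scale (fun_vs.representation B v d) d) = v" if "v \<in> fun_vs.span B" for v
    using fun_vs.sum_representation_eq[OF B(2) that \<open>finite B\<close>] by simp
  define \<rho> where "\<rho> = (\<lambda>x c b. fun_vs.representation B (T x b) c)"
  have trivial: "\<rho> g c b = of_bool (c = b)" if "c \<in> B" "b \<in> B" for b c
  proof (rule matrix_representation_trivial[where G = G and B = B])
    show "\<rho> \<one> b c = of_bool (b = c)" if "b \<in> B" "c \<in> B" for b c
      using that by (simp add: \<rho>_def T_one fun_vs.representation_basis[OF B(2)])
    fix x y b c assume *: "x \<in> carrier G" "y \<in> carrier G" "b \<in> B" "c \<in> B"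
    have "T (x \<otimes> y) c = T x (\<Sum>d\<in>B. ?scale (\<rho> y d c) d)"
      unfolding \<rho>_def using * by (simp add: expand T_B T_mult)
    also have "\<dots> = (\<Sum>d\<in>B. ?scale (\<rho> y d c) (T x d))" by (rule T_sum)
    finally have "\<rho> (x \<otimes> y) b c = fun_vs.representation B (\<Sum>d\<in>B. ?scale (\<rho> y d c) (T x d)) b"
      by (simp add: \<rho>_def)
    also have "\<dots> = (\<Sum>d\<in>B. \<rho> y d c * \<rho> x b d)"
      using * by (simp add: \<rho>_def T_B fun_vs.span_scale fun_vs.representation_sum[OF B(2)]
          fun_vs.representation_scale[OF B(2)])
    finally show "\<rho> (x \<otimes> y) b c = (\<Sum>d\<in>B. \<rho> x b d * \<rho> y d c)" by (simp add: mult.commute)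
  qed (use assms \<open>finite B\<close> that in auto)
  have T_g: "T g b = b" if "b \<in> B" for b
  proof -
    have "T g b = (\<Sum>d\<in>B. ?scale (\<rho> g d b) d)" unfolding \<rho>_def using T_B[OF g that] by (simp add: expand)
    also have "\<dots> = (\<Sum>d\<in>B. if d = b then b else 0)"
      using that trivial by (intro sum.cong refl) (auto simp: fun_eq_iff)
    finally show ?thesis using \<open>finite B\<close> that by simp
  qed
  define f0 where "f0 = T \<one> f"
  have "f0 \<in> fun_vs.span B" using B(3) by (auto simp: translates_def f0_def)
  from expand[OF this] have "T g f0 = f0" using T_sum[of g "fun_vs.representation B f0" B] T_g by simp
  then have "T g f0 \<one> = f0 \<one>" by simp
  then show ?thesis using g by (simp add: f0_def T_def)
qed

section \<open>Linear maps out of a tensor product\<close>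

abbreviation linear_space :: "('k::field, 'a, 'm) module_scheme \<Rightarrow> bool" where
  "linear_space A \<equiv> Module.module class_ring A"

abbreviation linear_maps ::
    "('k::field, 'a, 'm) module_scheme \<Rightarrow> ('k, 'b, 'l) module_scheme \<Rightarrow> ('a \<Rightarrow> 'b) set" where
  "linear_maps A B \<equiv> LinearCombinations.module_hom class_ring A B"

definition bilinear_maps ::
    "('k::field, 'a, 'm) module_scheme \<Rightarrow> ('k, 'b, 'l) module_scheme \<Rightarrow> ('k, 'c, 'j) module_scheme \<Rightarrow>
     ('a \<Rightarrow> 'b \<Rightarrow> 'c) set" where
  "bilinear_maps A B C = {f. (\<forall>a\<in>carrier A. f a \<in> linear_maps B C) \<and>
     (\<forall>b\<in>carrier B. (\<lambda>a. f a b) \<in> linear_maps A C)}"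

text \<open>
  The linear extension of \<open>f\<close> to formal sums: the value that \<open>tensor_lift\<close> computes on one
  representative of a tensor.
\<close>

definition formal_eval ::
    "('k::field, 'c, 'm) module_scheme \<Rightarrow> ('a \<Rightarrow> 'b \<Rightarrow> 'c) \<Rightarrow> ('a \<times> 'b \<Rightarrow>\<^sub>0 'k) \<Rightarrow> 'c" where
  "formal_eval C f x =
     (\<Oplus>\<^bsub>C\<^esub>p\<in>Poly_Mapping.keys x. Poly_Mapping.lookup x p \<odot>\<^bsub>C\<^esub> f (fst p) (snd p))"

lemma linear_mapsI:
  assumes "\<And>x. x \<in> carrier A \<Longrightarrow> f x \<in> carrier B"
    and "\<And>x y. x \<in> carrier A \<Longrightarrow> y \<in> carrier A \<Longrightarrow> f (x \<oplus>\<^bsub>A\<^esub> y) = f x \<oplus>\<^bsub>B\<^esub> f y"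
    and "\<And>c x. x \<in> carrier A \<Longrightarrow> f (c \<odot>\<^bsub>A\<^esub> x) = c \<odot>\<^bsub>B\<^esub> f x"
  shows "f \<in> linear_maps A B"
  using assms by (auto simp: LinearCombinations.module_hom_def)

lemma linear_mapsD:
  assumes "f \<in> linear_maps A B" "x \<in> carrier A"
  shows "f x \<in> carrier B"
    and "y \<in> carrier A \<Longrightarrow> f (x \<oplus>\<^bsub>A\<^esub> y) = f x \<oplus>\<^bsub>B\<^esub> f y"
    and "f (c \<odot>\<^bsub>A\<^esub> x) = c \<odot>\<^bsub>B\<^esub> f x"
  using assms by (auto simp: LinearCombinations.module_hom_def)

lemma bilinear_mapsD:
  assumes "f \<in> bilinear_maps A B C" "a \<in> carrier A" "b \<in> carrier B"
  shows "f a b \<in> carrier C"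
    and "a' \<in> carrier A \<Longrightarrow> f (a \<oplus>\<^bsub>A\<^esub> a') b = f a b \<oplus>\<^bsub>C\<^esub> f a' b"
    and "f (c \<odot>\<^bsub>A\<^esub> a) b = c \<odot>\<^bsub>C\<^esub> f a b"
    and "b' \<in> carrier B \<Longrightarrow> f a (b \<oplus>\<^bsub>B\<^esub> b') = f a b \<oplus>\<^bsub>C\<^esub> f a b'"
    and "f a (c \<odot>\<^bsub>B\<^esub> b) = c \<odot>\<^bsub>C\<^esub> f a b"
  using assms by (auto simp: bilinear_maps_def LinearCombinations.module_hom_def)

lemma bilinear_mapsI:
  assumes "\<And>a b. a \<in> carrier A \<Longrightarrow> b \<in> carrier B \<Longrightarrow> f a b \<in> carrier C"
    and "\<And>a a' b. a \<in> carrier A \<Longrightarrow> a' \<in> carrier A \<Longrightarrow> b \<in> carrier B \<Longrightarrow>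
      f (a \<oplus>\<^bsub>A\<^esub> a') b = f a b \<oplus>\<^bsub>C\<^esub> f a' b"
    and "\<And>c a b. a \<in> carrier A \<Longrightarrow> b \<in> carrier B \<Longrightarrow> f (c \<odot>\<^bsub>A\<^esub> a) b = c \<odot>\<^bsub>C\<^esub> f a b"
    and "\<And>a b b'. a \<in> carrier A \<Longrightarrow> b \<in> carrier B \<Longrightarrow> b' \<in> carrier B \<Longrightarrow>
      f a (b \<oplus>\<^bsub>B\<^esub> b') = f a b \<oplus>\<^bsub>C\<^esub> f a b'"
    and "\<And>c a b. a \<in> carrier A \<Longrightarrow> b \<in> carrier B \<Longrightarrow> f a (c \<odot>\<^bsub>B\<^esub> b) = c \<odot>\<^bsub>C\<^esub> f a b"
  shows "f \<in> bilinear_maps A B C"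
  using assms by (auto simp: bilinear_maps_def LinearCombinations.module_hom_def)

lemma linear_space_abelian: "linear_space A \<Longrightarrow> abelian_group A"
  by (rule Module.module.axioms(2))

lemma linear_space_scale:
  assumes "linear_space (A :: ('k::field, 'a, 'm) module_scheme)" "x \<in> carrier A"
  shows "c \<odot>\<^bsub>A\<^esub> x \<in> carrier A" "1 \<odot>\<^bsub>A\<^esub> x = x" "0 \<odot>\<^bsub>A\<^esub> x = \<zero>\<^bsub>A\<^esub>" "c \<odot>\<^bsub>A\<^esub> \<zero>\<^bsub>A\<^esub> = \<zero>\<^bsub>A\<^esub>"
    "(c + d) \<odot>\<^bsub>A\<^esub> x = c \<odot>\<^bsub>A\<^esub> x \<oplus>\<^bsub>A\<^esub> d \<odot>\<^bsub>A\<^esub> x"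
    "(c * d) \<odot>\<^bsub>A\<^esub> x = c \<odot>\<^bsub>A\<^esub> (d \<odot>\<^bsub>A\<^esub> x)"
    "y \<in> carrier A \<Longrightarrow> c \<odot>\<^bsub>A\<^esub> (x \<oplus>\<^bsub>A\<^esub> y) = c \<odot>\<^bsub>A\<^esub> x \<oplus>\<^bsub>A\<^esub> c \<odot>\<^bsub>A\<^esub> y"
  using Module.module.smult_closed[OF assms(1), of c x] Module.module.smult_one[OF assms(1), of x]
    Module.module.smult_l_null[OF assms(1), of x] Module.module.smult_r_null[OF assms(1), of c]
    Module.module.smult_l_distr[OF assms(1), of c d x] Module.module.smult_assoc1[OF assms(1), of c d x]
    Module.module.smult_r_distr[OF assms(1), of c x y] assms(2)
  by simp_all

lemma linear_map_zero:
  assumes "linear_space A" "linear_space B" "f \<in> linear_maps A B"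
  shows "f \<zero>\<^bsub>A\<^esub> = \<zero>\<^bsub>B\<^esub>"
proof -
  interpret A: abelian_group A using assms(1) by (rule linear_space_abelian)
  have "f (0 \<odot>\<^bsub>A\<^esub> \<zero>\<^bsub>A\<^esub>) = 0 \<odot>\<^bsub>B\<^esub> f \<zero>\<^bsub>A\<^esub>" using assms(3) by (rule linear_mapsD) simp
  moreover have "f \<zero>\<^bsub>A\<^esub> \<in> carrier B" using assms(3) by (rule linear_mapsD) simp
  ultimately show ?thesis using assms by (simp add: linear_space_scale)
qed

lemma linear_map_finsum:
  assumes "linear_space A" "linear_space B" "f \<in> linear_maps A B" "\<And>i. i \<in> I \<Longrightarrow> h i \<in> carrier A"
    and "finite I"
  shows "f (\<Oplus>\<^bsub>A\<^esub>i\<in>I. h i) = (\<Oplus>\<^bsub>B\<^esub>i\<in>I. f (h i))"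
proof -
  interpret A: abelian_group A using assms(1) by (rule linear_space_abelian)
  interpret B: abelian_group B using assms(2) by (rule linear_space_abelian)
  from \<open>finite I\<close> assms(4) show ?thesis
  proof (induction I)
    case empty
    show ?case using linear_map_zero[OF assms(1-3)] by simp
  next
    case (insert i I)
    then have "h \<in> I \<rightarrow> carrier A" "h i \<in> carrier A" by auto
    moreover from this have "(\<lambda>i. f (h i)) \<in> I \<rightarrow> carrier B" "f (h i) \<in> carrier B"
      using linear_mapsD(1)[OF assms(3)] by auto
    ultimately show ?case using insert by (simp add: linear_mapsD(2)[OF assms(3)])
  qed
qed

lemma lookup_scale_sum: "Poly_Mapping.lookup (scale_sum c x) p = c * Poly_Mapping.lookup x p"
  by (simp add: scale_sum_def Poly_Mapping.map.rep_eq when_def)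

lemma keys_scale_sum: "Poly_Mapping.keys (scale_sum c x) \<subseteq> Poly_Mapping.keys x"
  by (auto simp: in_keys_iff lookup_scale_sum)

lemma scale_sum_simps:
  "scale_sum c (x + y) = scale_sum c x + scale_sum c y"
  "scale_sum (c + d) x = scale_sum c x + scale_sum d x"
  "scale_sum (c * d) x = scale_sum c (scale_sum d x)"
  "scale_sum 1 x = x" "scale_sum (-1) x = - x" "scale_sum c (x - y) = scale_sum c x - scale_sum c y"
  "scale_sum c (Poly_Mapping.single p d) = Poly_Mapping.single p (c * d)"
  by (auto intro!: poly_mapping_eqI simp: lookup_scale_sum lookup_add lookup_minus algebra_simps lookup_single when_def)

lemma formal_sums_closed:
  "0 \<in> formal_sums A B"
  "x \<in> formal_sums A B \<Longrightarrow> y \<in> formal_sums A B \<Longrightarrow> x + y \<in> formal_sums A B"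
  "x \<in> formal_sums A B \<Longrightarrow> y \<in> formal_sums A B \<Longrightarrow> x - y \<in> formal_sums A B"
  "x \<in> formal_sums A B \<Longrightarrow> scale_sum c x \<in> formal_sums A B"
  "a \<in> carrier A \<Longrightarrow> b \<in> carrier B \<Longrightarrow> Poly_Mapping.single (a, b) c \<in> formal_sums A B"
  unfolding formal_sums_def using Poly_Mapping.keys_add[of x y] keys_diff[of x y] keys_scale_sum[of c x]
  by auto

lemma bilinear_formal_sums:
  assumes "f \<in> bilinear_maps A B C" "x \<in> formal_sums A B" "p \<in> Poly_Mapping.keys x"
  shows "f (fst p) (snd p) \<in> carrier C"
  using assms by (intro bilinear_mapsD(1)[OF assms(1)]) (auto simp: formal_sums_def)

lemma formal_eval_superset:
  assumes C: "linear_space C" and f: "\<And>p. p \<in> K \<Longrightarrow> f (fst p) (snd p) \<in> carrier C"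
    and K: "finite K" "Poly_Mapping.keys x \<subseteq> K"
  shows "formal_eval C f x = (\<Oplus>\<^bsub>C\<^esub>p\<in>K. Poly_Mapping.lookup x p \<odot>\<^bsub>C\<^esub> f (fst p) (snd p))"
proof -
  interpret C: abelian_group C using C by (rule linear_space_abelian)
  show ?thesis unfolding formal_eval_def
    using K f linear_space_scale[OF C]
    by (intro C.add.finprod_mono_neutral_cong_left) (auto simp: in_keys_iff)
qed

lemma formal_eval_closed:
  assumes C: "linear_space C" and "f \<in> bilinear_maps A B C" "x \<in> formal_sums A B"
  shows "formal_eval C f x \<in> carrier C"
proof -
  interpret C: abelian_group C using C by (rule linear_space_abelian)
  show ?thesis unfolding formal_eval_def
    by (intro C.finsum_closed Pi_I linear_space_scale(1)[OF C] bilinear_formal_sums[OF assms(2,3)])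
qed

lemma formal_eval_add:
  assumes C: "linear_space C" and f: "f \<in> bilinear_maps A B C"
    and xy: "x \<in> formal_sums A B" "y \<in> formal_sums A B"
  shows "formal_eval C f (x + y) = formal_eval C f x \<oplus>\<^bsub>C\<^esub> formal_eval C f y"
proof -
  interpret C: abelian_group C using C by (rule linear_space_abelian)
  define K where "K = Poly_Mapping.keys x \<union> Poly_Mapping.keys y"
  have K: "finite K" "Poly_Mapping.keys x \<subseteq> K" "Poly_Mapping.keys y \<subseteq> K" "Poly_Mapping.keys (x + y) \<subseteq> K"
    using Poly_Mapping.keys_add[of x y] by (auto simp: K_def)
  have fK: "f (fst p) (snd p) \<in> carrier C" if "p \<in> K" for p
    using that bilinear_formal_sums[OF f] xy by (auto simp: K_def)
  have eval: "formal_eval C f z = (\<Oplus>\<^bsub>C\<^esub>p\<in>K. Poly_Mapping.lookup z p \<odot>\<^bsub>C\<^esub> f (fst p) (snd p))"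
    if "Poly_Mapping.keys z \<subseteq> K" for z
    by (rule formal_eval_superset[of C K f z, OF C fK K(1) that])
  have "formal_eval C f (x + y) = (\<Oplus>\<^bsub>C\<^esub>p\<in>K. Poly_Mapping.lookup x p \<odot>\<^bsub>C\<^esub> f (fst p) (snd p) \<oplus>\<^bsub>C\<^esub>
      Poly_Mapping.lookup y p \<odot>\<^bsub>C\<^esub> f (fst p) (snd p))"
    unfolding eval[OF K(4)] lookup_add
    by (intro C.finsum_cong' Pi_I C.add.m_closed linear_space_scale[OF C] fK refl) auto
  also have "\<dots> = formal_eval C f x \<oplus>\<^bsub>C\<^esub> formal_eval C f y"
    unfolding eval[OF K(2)] eval[OF K(3)]
    by (intro C.finsum_addf Pi_I linear_space_scale(1)[OF C] fK)
  finally show ?thesis .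
qed

lemma formal_eval_scale:
  assumes C: "linear_space C" and f: "f \<in> bilinear_maps A B C" and x: "x \<in> formal_sums A B"
  shows "formal_eval C f (scale_sum c x) = c \<odot>\<^bsub>C\<^esub> formal_eval C f x"
proof -
  interpret C: abelian_group C using C by (rule linear_space_abelian)
  define K where "K = Poly_Mapping.keys x"
  have fK: "f (fst p) (snd p) \<in> carrier C" if "p \<in> K" for p
    using that bilinear_formal_sums[OF f] x by (auto simp: K_def)
  have lin: "(\<lambda>y. c \<odot>\<^bsub>C\<^esub> y) \<in> linear_maps C C"
    using linear_space_scale[OF C] by (intro linear_mapsI) (simp_all flip: linear_space_scale(6)[OF C] add: mult.commute)
  have "c \<odot>\<^bsub>C\<^esub> formal_eval C f x =
      (\<Oplus>\<^bsub>C\<^esub>p\<in>K. c \<odot>\<^bsub>C\<^esub> (Poly_Mapping.lookup x p \<odot>\<^bsub>C\<^esub> f (fst p) (snd p)))"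
    unfolding formal_eval_def K_def[symmetric]
    by (rule linear_map_finsum[OF C C lin]) (auto simp: fK linear_space_scale[OF C] K_def)
  also have "\<dots> = (\<Oplus>\<^bsub>C\<^esub>p\<in>K. Poly_Mapping.lookup (scale_sum c x) p \<odot>\<^bsub>C\<^esub> f (fst p) (snd p))"
    using fK by (intro C.finsum_cong') (auto simp: lookup_scale_sum linear_space_scale[OF C])
  also have "\<dots> = formal_eval C f (scale_sum c x)"
    using keys_scale_sum[of c x] by (intro formal_eval_superset[symmetric] C fK) (auto simp: K_def)
  finally show ?thesis by simp
qed

lemma formal_eval_single:
  assumes C: "linear_space C" and "f a b \<in> carrier C"
  shows "formal_eval C f (Poly_Mapping.single (a, b) c) = c \<odot>\<^bsub>C\<^esub> f a b"
proof -
  interpret C: abelian_group C using C by (rule linear_space_abelian)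
  have "formal_eval C f (Poly_Mapping.single (a, b) c) =
     (\<Oplus>\<^bsub>C\<^esub>p\<in>{(a, b)}. Poly_Mapping.lookup (Poly_Mapping.single (a, b) c) p \<odot>\<^bsub>C\<^esub> f (fst p) (snd p))"
    using assms by (intro formal_eval_superset) auto
  then show ?thesis using assms linear_space_scale[OF C] by simp
qed

lemma formal_eval_diff:
  assumes C: "linear_space C" and f: "f \<in> bilinear_maps A B C"
    and xy: "x \<in> formal_sums A B" "y \<in> formal_sums A B"
  shows "formal_eval C f (x - y) \<oplus>\<^bsub>C\<^esub> formal_eval C f y = formal_eval C f x"
  using formal_eval_add[OF C f formal_sums_closed(3)[OF xy] xy(2)] by simp

lemma tensor_relations_formal_sums:
  assumes A: "linear_space A" and B: "linear_space B" and "x \<in> tensor_relations A B"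
  shows "x \<in> formal_sums A B"
proof -
  interpret A: abelian_group A using A by (rule linear_space_abelian)
  interpret B: abelian_group B using B by (rule linear_space_abelian)
  show ?thesis
    using assms(3)
    by induction (auto intro!: formal_sums_closed linear_space_scale(1)[OF A] linear_space_scale(1)[OF B])
qed

text \<open>
  Evaluation of a bilinear map kills the relations, which is why \<open>tensor_lift\<close> does not depend on the
  representative.
\<close>

lemma formal_eval_tensor_relations:
  assumes A: "linear_space A" and B: "linear_space B" and C: "linear_space C"
    and f: "f \<in> bilinear_maps A B C" and "x \<in> tensor_relations A B"
  shows "formal_eval C f x = \<zero>\<^bsub>C\<^esub>"
proof -
  interpret A: abelian_group A using A by (rule linear_space_abelian)
  interpret B: abelian_group B using B by (rule linear_space_abelian)
  interpret C: abelian_group C using C by (rule linear_space_abelian)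
  note D = bilinear_mapsD[OF f]
  note sA = linear_space_scale(1)[OF A] and sB = linear_space_scale(1)[OF B]
  note sC = linear_space_scale[OF C]
  have eq0: "formal_eval C f (x - y) = \<zero>\<^bsub>C\<^esub>"
    if "x \<in> formal_sums A B" "y \<in> formal_sums A B" "formal_eval C f x = formal_eval C f y" for x y
  proof -
    have "formal_eval C f (x - y) \<oplus>\<^bsub>C\<^esub> formal_eval C f y = formal_eval C f y"
      using formal_eval_diff[OF C f that(1,2)] that(3) by simp
    then show ?thesis using formal_eval_closed[OF C f] that(2) formal_sums_closed(3)[OF that(1,2)] by simp
  qed
  show ?thesis
    using assms(5)
  proof induction
    case zero
    then show ?case by (simp add: formal_eval_def)
  next
    case (add x y)
    then show ?case using formal_eval_add[OF C f] tensor_relations_formal_sums[OF A B] by simp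
  next
    case (scale x c)
    then show ?case using formal_eval_scale[OF C f] tensor_relations_formal_sums[OF A B] sC(4)[OF C.zero_closed] by simp
  next
    case (add_left a a' b)
    have "formal_eval C f (Poly_Mapping.single (a \<oplus>\<^bsub>A\<^esub> a', b) 1
      - (Poly_Mapping.single (a, b) 1 + Poly_Mapping.single (a', b) 1)) = \<zero>\<^bsub>C\<^esub>"
      using add_left by (intro eq0) (simp_all add: formal_sums_closed formal_eval_add[OF C f] formal_eval_single[OF C] D sC)
    then show ?case by (simp add: diff_diff_add)
  next
    case (add_right a b b')
    have "formal_eval C f (Poly_Mapping.single (a, b \<oplus>\<^bsub>B\<^esub> b') 1
      - (Poly_Mapping.single (a, b) 1 + Poly_Mapping.single (a, b') 1)) = \<zero>\<^bsub>C\<^esub>"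
      using add_right by (intro eq0) (simp_all add: formal_sums_closed formal_eval_add[OF C f] formal_eval_single[OF C] D sC)
    then show ?case by (simp add: diff_diff_add)
  next
    case (scale_left a b c)
    then show ?case
      by (intro eq0) (simp_all add: formal_sums_closed formal_eval_single[OF C] D sC sA)
  next
    case (scale_right a b c)
    then show ?case
      by (intro eq0) (simp_all add: formal_sums_closed formal_eval_single[OF C] D sC sB)
  qed
qed

lemma tensor_class_eq: "x - y \<in> tensor_relations A B \<Longrightarrow> tensor_class A B x = tensor_class A B y"
proof -
  assume xy: "x - y \<in> tensor_relations A B"
  from tensor_relations.scale[OF this, of "-1"] have yx: "y - x \<in> tensor_relations A B"
    by (simp add: scale_sum_simps)
  show ?thesis
    using tensor_relations.add[OF _ xy] tensor_relations.add[OF _ yx] by (force simp: tensor_class_def)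
qed

lemma tensor_class_self: "x \<in> tensor_class A B x"
  by (simp add: tensor_class_def tensor_relations.zero)

lemma tensor_class_memD: "y \<in> tensor_class A B x \<Longrightarrow> y - x \<in> tensor_relations A B"
  by (simp add: tensor_class_def)

lemma tensor_product_simps:
  "carrier (tensor_product A B) = tensor_class A B ` formal_sums A B"
  "\<zero>\<^bsub>tensor_product A B\<^esub> = tensor_class A B 0"
  by (simp_all add: tensor_product_def)

lemma tensor_class_add:
  "tensor_class A B x \<oplus>\<^bsub>tensor_product A B\<^esub> tensor_class A B y = tensor_class A B (x + y)"
proof -
  have "tensor_class A B (x' + y') = tensor_class A B (x + y)"
    if "x' \<in> tensor_class A B x" "y' \<in> tensor_class A B y" for x' y'
    using tensor_relations.add[OF that[THEN tensor_class_memD]]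
    by (intro tensor_class_eq) (simp add: algebra_simps)
  then have "(\<Union>x'\<in>tensor_class A B x. \<Union>y'\<in>tensor_class A B y. tensor_class A B (x' + y')) =
      tensor_class A B (x + y)"
    using tensor_class_self[of x A B] tensor_class_self[of y A B] by (intro SUP_eq_const) blast+
  then show ?thesis by (simp only: tensor_product_def ring.simps)
qed

lemma tensor_class_scale:
  "c \<odot>\<^bsub>tensor_product A B\<^esub> tensor_class A B x = tensor_class A B (scale_sum c x)"
proof -
  have "tensor_class A B (scale_sum c x') = tensor_class A B (scale_sum c x)"
    if "x' \<in> tensor_class A B x" for x'
    using tensor_relations.scale[OF that[THEN tensor_class_memD], of c]
    by (intro tensor_class_eq) (simp add: scale_sum_simps)
  then have "(\<Union>x'\<in>tensor_class A B x. tensor_class A B (scale_sum c x')) = tensor_class A B (scale_sum c x)"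
    using tensor_class_self[of x A B] by (intro SUP_eq_const) blast+
  then show ?thesis by (simp only: tensor_product_def module.simps)
qed

lemma tensor_product_cases:
  assumes "X \<in> carrier (tensor_product A B)"
  obtains x where "x \<in> formal_sums A B" "X = tensor_class A B x"
  using assms unfolding tensor_product_simps by (elim imageE)

lemma tensor_class_closed: "x \<in> formal_sums A B \<Longrightarrow> tensor_class A B x \<in> carrier (tensor_product A B)"
  unfolding tensor_product_simps by (rule imageI)

lemma linear_space_tensor_product:
  fixes A :: "('k::field, 'a, 'm) module_scheme" and B :: "('k, 'b, 'l) module_scheme"
  shows "linear_space (tensor_product A B)"
proof (rule moduleI)
  let ?T = "tensor_product A B"
  note cls = tensor_class_closed formal_sums_closed
  show "cring (class_ring :: 'k ring)" by (rule class_cring.is_cring)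
  show "abelian_group ?T"
  proof (rule abelian_groupI)
    show "\<zero>\<^bsub>?T\<^esub> \<in> carrier ?T" unfolding tensor_product_simps(2) by (intro cls)
    fix X assume "X \<in> carrier ?T"
    then obtain x where x: "x \<in> formal_sums A B" "X = tensor_class A B x" by (rule tensor_product_cases)
    show "\<zero>\<^bsub>?T\<^esub> \<oplus>\<^bsub>?T\<^esub> X = X" by (simp only: x tensor_product_simps(2) tensor_class_add add_0_left)
    have "tensor_class A B (scale_sum (-1) x) \<in> carrier ?T" by (intro cls x)
    moreover have "tensor_class A B (scale_sum (-1) x) \<oplus>\<^bsub>?T\<^esub> X = \<zero>\<^bsub>?T\<^esub>"
      by (simp only: x tensor_class_add tensor_product_simps(2) scale_sum_simps(5) left_minus)
    ultimately show "\<exists>Y\<in>carrier ?T. Y \<oplus>\<^bsub>?T\<^esub> X = \<zero>\<^bsub>?T\<^esub>" by (rule bexI[rotated])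
    fix Y assume "Y \<in> carrier ?T"
    then obtain y where y: "y \<in> formal_sums A B" "Y = tensor_class A B y" by (rule tensor_product_cases)
    show "X \<oplus>\<^bsub>?T\<^esub> Y \<in> carrier ?T" unfolding x y tensor_class_add by (intro cls x y)
    show "X \<oplus>\<^bsub>?T\<^esub> Y = Y \<oplus>\<^bsub>?T\<^esub> X" unfolding x y tensor_class_add by (simp only: add.commute)
    fix Z assume "Z \<in> carrier ?T"
    then obtain z where z: "z \<in> formal_sums A B" "Z = tensor_class A B z" by (rule tensor_product_cases)
    show "X \<oplus>\<^bsub>?T\<^esub> Y \<oplus>\<^bsub>?T\<^esub> Z = X \<oplus>\<^bsub>?T\<^esub> (Y \<oplus>\<^bsub>?T\<^esub> Z)" unfolding x y z tensor_class_add by (simp only: add.assoc)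
  qed
  fix a b :: 'k and X assume "X \<in> carrier ?T"
  then obtain x where x: "x \<in> formal_sums A B" "X = tensor_class A B x" by (rule tensor_product_cases)
  show "a \<odot>\<^bsub>?T\<^esub> X \<in> carrier ?T" unfolding x tensor_class_scale by (intro cls x)
  show "(a \<oplus>\<^bsub>class_ring\<^esub> b) \<odot>\<^bsub>?T\<^esub> X = a \<odot>\<^bsub>?T\<^esub> X \<oplus>\<^bsub>?T\<^esub> b \<odot>\<^bsub>?T\<^esub> X"
    "(a \<otimes>\<^bsub>class_ring\<^esub> b) \<odot>\<^bsub>?T\<^esub> X = a \<odot>\<^bsub>?T\<^esub> (b \<odot>\<^bsub>?T\<^esub> X)"
    "\<one>\<^bsub>class_ring\<^esub> \<odot>\<^bsub>?T\<^esub> X = X"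
    by (simp_all add: x tensor_class_scale tensor_class_add scale_sum_simps)
  fix Y assume "Y \<in> carrier ?T"
  then obtain y where y: "y \<in> formal_sums A B" "Y = tensor_class A B y" by (rule tensor_product_cases)
  show "a \<odot>\<^bsub>?T\<^esub> (X \<oplus>\<^bsub>?T\<^esub> Y) = a \<odot>\<^bsub>?T\<^esub> X \<oplus>\<^bsub>?T\<^esub> a \<odot>\<^bsub>?T\<^esub> Y"
    by (simp add: x y tensor_class_scale tensor_class_add scale_sum_simps)
qed

lemma pure_tensor_closed:
  "a \<in> carrier A \<Longrightarrow> b \<in> carrier B \<Longrightarrow> pure_tensor A B a b \<in> carrier (tensor_product A B)"
  unfolding pure_tensor_def tensor_product_simps by (intro imageI formal_sums_closed)

lemma pure_tensor_bilinear: "pure_tensor A B \<in> bilinear_maps A B (tensor_product A B)"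
proof (rule bilinear_mapsI)
  show "pure_tensor A B (a \<oplus>\<^bsub>A\<^esub> a') b = pure_tensor A B a b \<oplus>\<^bsub>tensor_product A B\<^esub> pure_tensor A B a' b"
    if "a \<in> carrier A" "a' \<in> carrier A" "b \<in> carrier B" for a a' b
    unfolding pure_tensor_def tensor_class_add using tensor_relations.add_left[OF that]
    by (intro tensor_class_eq) (simp only: diff_diff_add)
  show "pure_tensor A B a (b \<oplus>\<^bsub>B\<^esub> b') = pure_tensor A B a b \<oplus>\<^bsub>tensor_product A B\<^esub> pure_tensor A B a b'"
    if "a \<in> carrier A" "b \<in> carrier B" "b' \<in> carrier B" for a b b'
    unfolding pure_tensor_def tensor_class_add using tensor_relations.add_right[OF that]
    by (intro tensor_class_eq) (simp only: diff_diff_add)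
  show "pure_tensor A B (c \<odot>\<^bsub>A\<^esub> a) b = c \<odot>\<^bsub>tensor_product A B\<^esub> pure_tensor A B a b"
    if "a \<in> carrier A" "b \<in> carrier B" for c a b
    unfolding pure_tensor_def tensor_class_scale using tensor_relations.scale_left[OF that]
    by (intro tensor_class_eq) (simp only: scale_sum_simps mult_1_right)
  show "pure_tensor A B a (c \<odot>\<^bsub>B\<^esub> b) = c \<odot>\<^bsub>tensor_product A B\<^esub> pure_tensor A B a b"
    if "a \<in> carrier A" "b \<in> carrier B" for c a b
    unfolding pure_tensor_def tensor_class_scale using tensor_relations.scale_right[OF that]
    by (intro tensor_class_eq) (simp only: scale_sum_simps mult_1_right)
qed (rule pure_tensor_closed)

context
  fixes A :: "('k::field, 'a, 'm) module_scheme" and B :: "('k, 'b, 'l) module_scheme"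
    and C :: "('k, 'c, 'j) module_scheme"
  assumes A: "linear_space A" and B: "linear_space B" and C: "linear_space C"
begin

lemma tensor_lift_class:
  assumes f: "f \<in> bilinear_maps A B C" and x: "x \<in> formal_sums A B"
  shows "tensor_lift C f (tensor_class A B x) = formal_eval C f x"
proof -
  interpret C: abelian_group C using C by (rule linear_space_abelian)
  have "formal_eval C f y = formal_eval C f x" if "y \<in> tensor_class A B x" for y
  proof -
    have yx: "y - x \<in> tensor_relations A B" using that by (rule tensor_class_memD)
    have "y - x \<in> formal_sums A B" using tensor_relations_formal_sums[OF A B yx] .
    from formal_eval_add[OF C f this x] formal_eval_tensor_relations[OF A B C f yx]
    show ?thesis using formal_eval_closed[OF C f x] by simp
  qed
  then have "the_elem (formal_eval C f ` tensor_class A B x) = formal_eval C f x"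
    using tensor_class_self[of x A B] by (intro the_elem_image_unique) blast+
  then show ?thesis by (simp only: tensor_lift_def formal_eval_def[abs_def])
qed

lemma tensor_lift_linear:
  assumes f: "f \<in> bilinear_maps A B C"
  shows "tensor_lift C f \<in> linear_maps (tensor_product A B) C"
  by (rule linear_mapsI; elim tensor_product_cases; hypsubst?)
    (simp_all only: tensor_lift_class[OF f] formal_eval_closed[OF C f] tensor_class_add
      formal_sums_closed formal_eval_add[OF C f] tensor_class_scale formal_eval_scale[OF C f])

lemma tensor_lift_pure:
  assumes f: "f \<in> bilinear_maps A B C" and "a \<in> carrier A" "b \<in> carrier B"
  shows "tensor_lift C f (pure_tensor A B a b) = f a b"
  using assms bilinear_mapsD(1)[OF assms] linear_space_scale(2)[OF C]
  by (simp add: pure_tensor_def tensor_lift_class formal_sums_closed formal_eval_single[OF C])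

lemma tensor_lift_cong:
  assumes f: "f \<in> bilinear_maps A B C" and g: "g \<in> bilinear_maps A B C"
    and fg: "\<And>a b. a \<in> carrier A \<Longrightarrow> b \<in> carrier B \<Longrightarrow> f a b = g a b"
    and t: "t \<in> carrier (tensor_product A B)"
  shows "tensor_lift C f t = tensor_lift C g t"
proof -
  interpret C: abelian_group C using C by (rule linear_space_abelian)
  obtain x where x: "x \<in> formal_sums A B" "t = tensor_class A B x" using t by (auto simp: tensor_product_simps)
  have "formal_eval C f x = formal_eval C g x"
    unfolding formal_eval_def
  proof (rule C.finsum_cong')
    show "(\<lambda>p. Poly_Mapping.lookup x p \<odot>\<^bsub>C\<^esub> g (fst p) (snd p)) \<in> Poly_Mapping.keys x \<rightarrow> carrier C"
      by (intro Pi_I linear_space_scale(1)[OF C] bilinear_formal_sums[OF g x(1)])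
    fix p assume "p \<in> Poly_Mapping.keys x"
    then have "fst p \<in> carrier A" "snd p \<in> carrier B" using x(1) by (auto simp: formal_sums_def)
    then show "Poly_Mapping.lookup x p \<odot>\<^bsub>C\<^esub> f (fst p) (snd p) = Poly_Mapping.lookup x p \<odot>\<^bsub>C\<^esub> g (fst p) (snd p)"
      by (simp add: fg)
  qed simp
  then show ?thesis using x by (simp add: tensor_lift_class f g)
qed

lemma tensor_lift_add:
  assumes f: "f \<in> bilinear_maps A B C" and g: "g \<in> bilinear_maps A B C"
    and h: "h \<in> bilinear_maps A B C"
    and fg: "\<And>a b. a \<in> carrier A \<Longrightarrow> b \<in> carrier B \<Longrightarrow> h a b = f a b \<oplus>\<^bsub>C\<^esub> g a b"
    and t: "t \<in> carrier (tensor_product A B)"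
  shows "tensor_lift C h t = tensor_lift C f t \<oplus>\<^bsub>C\<^esub> tensor_lift C g t"
proof -
  interpret C: abelian_group C using C by (rule linear_space_abelian)
  obtain x where x: "x \<in> formal_sums A B" "t = tensor_class A B x" using t by (rule tensor_product_cases)
  have "formal_eval C h x = (\<Oplus>\<^bsub>C\<^esub>p\<in>Poly_Mapping.keys x. Poly_Mapping.lookup x p \<odot>\<^bsub>C\<^esub> f (fst p) (snd p)
      \<oplus>\<^bsub>C\<^esub> Poly_Mapping.lookup x p \<odot>\<^bsub>C\<^esub> g (fst p) (snd p))"
    unfolding formal_eval_def
  proof (rule C.finsum_cong')
    show "(\<lambda>p. Poly_Mapping.lookup x p \<odot>\<^bsub>C\<^esub> f (fst p) (snd p) \<oplus>\<^bsub>C\<^esub>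
        Poly_Mapping.lookup x p \<odot>\<^bsub>C\<^esub> g (fst p) (snd p)) \<in> Poly_Mapping.keys x \<rightarrow> carrier C"
      by (intro Pi_I C.add.m_closed linear_space_scale(1)[OF C] bilinear_formal_sums[OF _ x(1)] f g)
    fix p assume p: "p \<in> Poly_Mapping.keys x"
    then have "fst p \<in> carrier A" "snd p \<in> carrier B" using x(1) by (auto simp: formal_sums_def)
    then show "Poly_Mapping.lookup x p \<odot>\<^bsub>C\<^esub> h (fst p) (snd p) = Poly_Mapping.lookup x p \<odot>\<^bsub>C\<^esub> f (fst p) (snd p)
        \<oplus>\<^bsub>C\<^esub> Poly_Mapping.lookup x p \<odot>\<^bsub>C\<^esub> g (fst p) (snd p)"
      using linear_space_scale(7)[OF C bilinear_formal_sums[OF f x(1) p] bilinear_formal_sums[OF g x(1) p]]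
      by (simp add: fg)
  qed simp
  also have "\<dots> = formal_eval C f x \<oplus>\<^bsub>C\<^esub> formal_eval C g x"
    unfolding formal_eval_def
    by (intro C.finsum_addf Pi_I linear_space_scale(1)[OF C] bilinear_formal_sums[OF _ x(1)] f g)
  finally show ?thesis by (simp only: x(2) tensor_lift_class[OF f x(1)] tensor_lift_class[OF g x(1)] tensor_lift_class[OF h x(1)])
qed

end

lemma bilinear_linear_map:
  assumes "f \<in> bilinear_maps A B C" "L \<in> linear_maps C D"
  shows "(\<lambda>a b. L (f a b)) \<in> bilinear_maps A B D"
  by (rule bilinear_mapsI)
    (simp_all add: bilinear_mapsD[OF assms(1)] linear_mapsD[OF assms(2)])

text \<open>
  Together with \<open>tensor_lift_pure\<close> this evaluates every composite of maps between iterated tensor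
  products, without choosing representatives.
\<close>

lemma linear_map_tensor_lift:
  assumes A: "linear_space A" and B: "linear_space B" and C: "linear_space C" and D: "linear_space D"
    and f: "f \<in> bilinear_maps A B C" and L: "L \<in> linear_maps C D"
    and t: "t \<in> carrier (tensor_product A B)"
  shows "L (tensor_lift C f t) = tensor_lift D (\<lambda>a b. L (f a b)) t"
proof -
  interpret D: abelian_group D using D by (rule linear_space_abelian)
  obtain x where x: "x \<in> formal_sums A B" "t = tensor_class A B x" using t by (rule tensor_product_cases)
  note Lf = bilinear_linear_map[OF f L]
  have "L (formal_eval C f x) = (\<Oplus>\<^bsub>D\<^esub>p\<in>Poly_Mapping.keys x. L (Poly_Mapping.lookup x p \<odot>\<^bsub>C\<^esub> f (fst p) (snd p)))"
    unfolding formal_eval_def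
    by (intro linear_map_finsum[OF C D L] linear_space_scale(1)[OF C] bilinear_formal_sums[OF f x(1)]) simp_all
  also have "\<dots> = formal_eval D (\<lambda>a b. L (f a b)) x"
    unfolding formal_eval_def
    by (intro D.finsum_cong' Pi_I linear_space_scale(1)[OF D] bilinear_formal_sums[OF Lf x(1)]
        linear_mapsD(3)[OF L] bilinear_formal_sums[OF f x(1)]) auto
  finally show ?thesis
    by (simp only: x(2) tensor_lift_class[OF A B C f x(1)] tensor_lift_class[OF A B D Lf x(1)])
qed

lemma linear_map_comp:
  "f \<in> linear_maps A B \<Longrightarrow> g \<in> linear_maps B C \<Longrightarrow> (\<lambda>x. g (f x)) \<in> linear_maps A C"
  by (rule linear_mapsI) (simp_all add: linear_mapsD)

lemma base_algebra_simps:
  "carrier base_algebra = UNIV" "\<zero>\<^bsub>base_algebra\<^esub> = 0" "x \<oplus>\<^bsub>base_algebra\<^esub> y = x + y"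
  "c \<odot>\<^bsub>base_algebra\<^esub> x = c * x"
  by (simp_all add: base_algebra_def)

lemma linear_space_base_algebra: "linear_space (base_algebra :: ('k::field, 'k) module)"
proof (rule moduleI)
  show "cring (class_ring :: 'k ring)" by (rule class_cring.is_cring)
  show "abelian_group (base_algebra :: ('k, 'k) module)"
    by (rule abelian_groupI) (auto simp: base_algebra_simps intro: exI[of _ "- x" for x])
qed (auto simp: base_algebra_simps algebra_simps)

lemma finsum_base_algebra: "finite I \<Longrightarrow> (\<Oplus>\<^bsub>base_algebra\<^esub>i\<in>I. h i) = (\<Sum>i\<in>I. h i)"
proof (induction I rule: finite_induct)
  interpret abelian_group base_algebra by (rule linear_space_abelian[OF linear_space_base_algebra])
  case empty show ?case by (simp add: base_algebra_simps)
  case (insert i I) then show ?case by (subst finsum_insert) (auto simp: base_algebra_simps)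
qed

lemma functional_product_bilinear:
  assumes "l \<in> linear_maps A base_algebra" "m \<in> linear_maps B base_algebra"
  shows "(\<lambda>x y. l x * m y) \<in> bilinear_maps A B base_algebra"
  by (rule bilinear_mapsI)
    (simp_all add: base_algebra_simps linear_mapsD(2,3)[OF assms(1), unfolded base_algebra_simps]
      linear_mapsD(2,3)[OF assms(2), unfolded base_algebra_simps] algebra_simps)

section \<open>The convolution monoid of a Hopf algebra\<close>

text \<open>
  The product on the dual space of a coalgebra: \<open>(l * m)(h) = l(h\<^sub>1) m(h\<^sub>2)\<close>.
\<close>

definition convolution ::
    "('k::field, 'h) hopf \<Rightarrow> ('h \<Rightarrow> 'k) \<Rightarrow> ('h \<Rightarrow> 'k) \<Rightarrow> 'h \<Rightarrow> 'k" where
  "convolution H l m = (\<lambda>h\<in>carrier H. tensor_lift base_algebra (\<lambda>x y. l x * m y) (comult H h))"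

definition convolution_monoid :: "('k::field, 'h) hopf \<Rightarrow> ('h \<Rightarrow> 'k) monoid" where
  "convolution_monoid H =
     \<lparr>carrier = linear_maps H base_algebra \<inter> extensional (carrier H),
      monoid.mult = convolution H, one = restrict (counit H) (carrier H)\<rparr>"

lemma linear_map_restrict:
  assumes "linear_space A" "f \<in> linear_maps A B"
  shows "restrict f (carrier A) \<in> linear_maps A B"
proof -
  interpret A: abelian_group A using assms(1) by (rule linear_space_abelian)
  show ?thesis
    by (rule linear_mapsI) (simp_all add: linear_mapsD[OF assms(2)] linear_space_scale(1)[OF assms(1)])
qed

context
  fixes H :: "('k::field, 'h) hopf"
  assumes hopf: "hopf_algebra H"
begin

lemma hopf_linear:
  shows "linear_space H" "comult H \<in> linear_maps H (tensor_product H H)"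
    "counit H \<in> linear_maps H base_algebra"
  using hopf by (auto simp: hopf_algebra_def unital_algebra_def alg_hom_def)

lemma comult_closed: "h \<in> carrier H \<Longrightarrow> comult H h \<in> carrier (tensor_product H H)"
  using linear_mapsD(1)[OF hopf_linear(2)] .

lemma convolution_linear:
  assumes l: "l \<in> linear_maps H base_algebra" and m: "m \<in> linear_maps H base_algebra"
  shows "convolution H l m \<in> linear_maps H base_algebra"
  unfolding convolution_def
  by (intro linear_map_restrict hopf_linear(1) linear_map_comp[OF hopf_linear(2)]
      tensor_lift_linear hopf_linear(1) linear_space_base_algebra functional_product_bilinear l m)

lemma convolution_counit:
  assumes l: "l \<in> linear_maps H base_algebra" and h: "h \<in> carrier H"
  shows "convolution H l (restrict (counit H) (carrier H)) h = l h"
    "convolution H (restrict (counit H) (carrier H)) l h = l h"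
proof -
  note lin = hopf_linear linear_space_base_algebra
  note T = comult_closed[OF h]
  let ?e = "restrict (counit H) (carrier H)"
  have e: "?e \<in> linear_maps H base_algebra" using lin(1,3) by (rule linear_map_restrict)
  have b1: "(\<lambda>x y. counit H y \<odot>\<^bsub>H\<^esub> x) \<in> bilinear_maps H H H"
    and b2: "(\<lambda>x y. counit H x \<odot>\<^bsub>H\<^esub> y) \<in> bilinear_maps H H H"
    by (rule bilinear_mapsI; simp add: linear_space_scale[OF lin(1)] base_algebra_simps
      linear_mapsD(2,3)[OF lin(3), unfolded base_algebra_simps] mult.commute flip: linear_space_scale(6)[OF lin(1)])+
  have conv: "convolution H f g h = tensor_lift base_algebra (\<lambda>x y. f x * g y) (comult H h)" for f g
    using h by (simp add: convolution_def)
  have "convolution H l ?e h = tensor_lift base_algebra (\<lambda>x y. l (counit H y \<odot>\<^bsub>H\<^esub> x)) (comult H h)"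
    unfolding conv
    by (rule tensor_lift_cong[OF lin(1) lin(1) lin(4) functional_product_bilinear[OF l e] bilinear_linear_map[OF b1 l] _ T])
      (simp add: linear_mapsD(3)[OF l] base_algebra_simps mult.commute)
  also have "\<dots> = l (tensor_lift H (\<lambda>x y. counit H y \<odot>\<^bsub>H\<^esub> x) (comult H h))"
    by (rule linear_map_tensor_lift[symmetric, OF lin(1) lin(1) lin(1) lin(4) b1 l T])
  also have "\<dots> = l h" using hopf h by (simp add: hopf_algebra_def)
  finally show "convolution H l ?e h = l h" .
  have "convolution H ?e l h = tensor_lift base_algebra (\<lambda>x y. l (counit H x \<odot>\<^bsub>H\<^esub> y)) (comult H h)"
    unfolding conv
    by (rule tensor_lift_cong[OF lin(1) lin(1) lin(4) functional_product_bilinear[OF e l] bilinear_linear_map[OF b2 l] _ T])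
      (simp add: linear_mapsD(3)[OF l] base_algebra_simps)
  also have "\<dots> = l (tensor_lift H (\<lambda>x y. counit H x \<odot>\<^bsub>H\<^esub> y) (comult H h))"
    by (rule linear_map_tensor_lift[symmetric, OF lin(1) lin(1) lin(1) lin(4) b2 l T])
  also have "\<dots> = l h" using hopf h by (simp add: hopf_algebra_def)
  finally show "convolution H ?e l h = l h" .
qed

text \<open>
  Both sides arise from the functional \<open>L = l \<otimes> m \<otimes> n\<close> on the triple tensor product: \<open>left\<close> and \<open>right\<close>
  evaluate \<open>L\<close> on the two sides of the coassociativity equation.
\<close>

lemma convolution_assoc:
  assumes l: "l \<in> linear_maps H base_algebra" and m: "m \<in> linear_maps H base_algebra"
    and n: "n \<in> linear_maps H base_algebra" and h: "h \<in> carrier H"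
  shows "convolution H (convolution H l m) n h = convolution H l (convolution H m n) h"
proof -
  note H = hopf_linear(1) and k = linear_space_base_algebra[where 'k = 'k]
  define T2 where "T2 = tensor_product H H"
  define T3 where "T3 = tensor_product T2 H"
  define T3' where "T3' = tensor_product H T2"
  have T2: "linear_space T2" and T3: "linear_space T3" and T3': "linear_space T3'"
    unfolding T2_def T3_def T3'_def by (rule linear_space_tensor_product)+
  have \<Delta>: "comult H \<in> linear_maps H T2" unfolding T2_def by (rule hopf_linear(2))
  have t: "comult H h \<in> carrier T2" using \<Delta> h by (rule linear_mapsD)
  have p2: "pure_tensor H H \<in> bilinear_maps H H T2" unfolding T2_def by (rule pure_tensor_bilinear)
  have p3: "pure_tensor T2 H \<in> bilinear_maps T2 H T3" unfolding T3_def by (rule pure_tensor_bilinear)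
  have p3': "pure_tensor H T2 \<in> bilinear_maps H T2 T3'" unfolding T3'_def by (rule pure_tensor_bilinear)
  have lift2: "tensor_lift C f \<in> linear_maps T2 C" if "linear_space C" "f \<in> bilinear_maps H H C"
    for C :: "('k, 'c) module" and f
    unfolding T2_def by (rule tensor_lift_linear[OF H H that])
  define L12 where "L12 = tensor_lift base_algebra (\<lambda>x y. l x * m y)"
  have L12: "L12 \<in> linear_maps T2 base_algebra"
    unfolding L12_def by (intro lift2 k functional_product_bilinear l m)
  have L12_pure: "L12 (pure_tensor H H a b) = l a * m b" if "a \<in> carrier H" "b \<in> carrier H" for a b
    unfolding L12_def by (intro tensor_lift_pure H k functional_product_bilinear l m that)
  define L23 where "L23 = tensor_lift base_algebra (\<lambda>x y. m x * n y)"
  have L23: "L23 \<in> linear_maps T2 base_algebra"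
    unfolding L23_def by (intro lift2 k functional_product_bilinear n m)
  define L where "L = tensor_lift base_algebra (\<lambda>X z. L12 X * n z)"
  have L: "L \<in> linear_maps T3 base_algebra"
    unfolding L_def T3_def by (intro tensor_lift_linear T2 H k functional_product_bilinear L12 n)
  have L_pure: "L (pure_tensor T2 H X z) = L12 X * n z" if "X \<in> carrier T2" "z \<in> carrier H" for X z
    unfolding L_def by (intro tensor_lift_pure T2 H k functional_product_bilinear L12 n that)
  have conv: "convolution H f g x = tensor_lift base_algebra (\<lambda>x y. f x * g y) (comult H x)"
    if "x \<in> carrier H" for f g x using that by (simp add: convolution_def)
  have bil1: "(\<lambda>a b. pure_tensor T2 H (comult H a) b) \<in> bilinear_maps H H T3"
    by (rule bilinear_mapsI) (simp_all add: bilinear_mapsD[OF p3] linear_mapsD[OF \<Delta>])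
  have left: "convolution H (convolution H l m) n h = L (tensor_map T2 H (comult H) (\<lambda>x. x) (comult H h))"
  proof -
    have "L (tensor_map T2 H (comult H) (\<lambda>x. x) (comult H h)) =
        tensor_lift base_algebra (\<lambda>a b. L (pure_tensor T2 H (comult H a) b)) (comult H h)"
      unfolding tensor_map_def T3_def[symmetric]
      by (rule linear_map_tensor_lift[OF H H T3 k bil1 L t[unfolded T2_def]])
    also have "\<dots> = tensor_lift base_algebra (\<lambda>a b. convolution H l m a * n b) (comult H h)"
      by (intro tensor_lift_cong[OF H H k] bilinear_linear_map[OF bil1 L] t[unfolded T2_def]
          functional_product_bilinear convolution_linear l m n)
        (simp add: L_pure linear_mapsD[OF \<Delta>] L12_def conv)
    finally show ?thesis using h by (simp add: conv)
  qed
  \<comment> \<open>The associator is the lift of \<open>\<alpha>\<close>, so it is linear once \<open>\<alpha>\<close> is known to be bilinear.\<close>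
  define \<alpha> where "\<alpha> = (\<lambda>a. tensor_lift T3 (\<lambda>b c. pure_tensor T2 H (pure_tensor H H a b) c))"
  have bil2: "(\<lambda>b c. pure_tensor T2 H (pure_tensor H H a b) c) \<in> bilinear_maps H H T3" if "a \<in> carrier H" for a
    by (rule bilinear_mapsI) (simp_all add: that bilinear_mapsD[OF p3] bilinear_mapsD[OF p2])
  have \<alpha>_lin: "\<alpha> a \<in> linear_maps T2 T3" if "a \<in> carrier H" for a
    unfolding \<alpha>_def by (intro lift2 T3 bil2 that)
  interpret H: abelian_group H using H by (rule linear_space_abelian)
  have scale3: "(\<lambda>y. c \<odot>\<^bsub>T3\<^esub> y) \<in> linear_maps T3 T3" for c
    using linear_space_scale[OF T3]
    by (intro linear_mapsI) (simp_all flip: linear_space_scale(6)[OF T3] add: mult.commute)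
  have \<alpha>: "\<alpha> \<in> bilinear_maps H T2 T3"
  proof (rule bilinear_mapsI)
    fix a X assume a: "a \<in> carrier H" and X: "X \<in> carrier T2"
    note X' = X[unfolded T2_def]
    show "\<alpha> a X \<in> carrier T3" using \<alpha>_lin[OF a] X by (rule linear_mapsD)
    show "\<alpha> a (X \<oplus>\<^bsub>T2\<^esub> Y) = \<alpha> a X \<oplus>\<^bsub>T3\<^esub> \<alpha> a Y" if "Y \<in> carrier T2" for Y
      using \<alpha>_lin[OF a] X that by (rule linear_mapsD)
    show "\<alpha> a (c \<odot>\<^bsub>T2\<^esub> X) = c \<odot>\<^bsub>T3\<^esub> \<alpha> a X" for c using \<alpha>_lin[OF a] X by (rule linear_mapsD)
    show "\<alpha> (a \<oplus>\<^bsub>H\<^esub> a') X = \<alpha> a X \<oplus>\<^bsub>T3\<^esub> \<alpha> a' X" if "a' \<in> carrier H" for a'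
      unfolding \<alpha>_def using that a
      by (intro tensor_lift_add[OF H H T3] bil2 X' H.add.m_closed)
        (simp_all add: bilinear_mapsD(2)[OF p2 a _ that]
          bilinear_mapsD(2)[OF p3 bilinear_mapsD(1)[OF p2 a] _ bilinear_mapsD(1)[OF p2 that]])
    show "\<alpha> (c \<odot>\<^bsub>H\<^esub> a) X = c \<odot>\<^bsub>T3\<^esub> \<alpha> a X" for c
    proof -
      have "c \<odot>\<^bsub>T3\<^esub> \<alpha> a X = tensor_lift T3 (\<lambda>b d. c \<odot>\<^bsub>T3\<^esub> pure_tensor T2 H (pure_tensor H H a b) d) X"
        unfolding \<alpha>_def by (rule linear_map_tensor_lift[OF H H T3 T3 bil2[OF a] scale3 X'])
      also have "\<dots> = \<alpha> (c \<odot>\<^bsub>H\<^esub> a) X"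
        unfolding \<alpha>_def
        by (intro tensor_lift_cong[OF H H T3] bilinear_linear_map[OF bil2[OF a] scale3] bil2 X'
            linear_space_scale(1)[OF H] a)
          (simp add: a bilinear_mapsD[OF p3] bilinear_mapsD[OF p2])
      finally show ?thesis by simp
    qed
  qed
  have assoc: "tensor_assoc H H H = tensor_lift T3 \<alpha>"
    unfolding tensor_assoc_def Let_def T2_def[symmetric] T3_def[symmetric] \<alpha>_def ..
  have assoc_lin: "tensor_assoc H H H \<in> linear_maps T3' T3"
    unfolding assoc T3'_def by (rule tensor_lift_linear[OF H T2 T3 \<alpha>])
  note LA = linear_map_comp[OF assoc_lin L]
  have LA_pure: "L (tensor_assoc H H H (pure_tensor H T2 a X)) = l a * L23 X"
    if a: "a \<in> carrier H" and X: "X \<in> carrier T2" for a X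
  proof -
    note X' = X[unfolded T2_def]
    have la: "(\<lambda>y. l a * y) \<in> linear_maps base_algebra base_algebra"
      by (rule linear_mapsI) (simp_all add: base_algebra_simps algebra_simps)
    note mn = functional_product_bilinear[OF m n]
    have "L (tensor_assoc H H H (pure_tensor H T2 a X)) = L (\<alpha> a X)"
      unfolding assoc by (simp add: tensor_lift_pure[OF H T2 T3 \<alpha> a X])
    also have "\<dots> = tensor_lift base_algebra (\<lambda>b c. L (pure_tensor T2 H (pure_tensor H H a b) c)) X"
      unfolding \<alpha>_def by (rule linear_map_tensor_lift[OF H H T3 k bil2[OF a] L X'])
    also have "\<dots> = tensor_lift base_algebra (\<lambda>b c. l a * (m b * n c)) X"
      by (intro tensor_lift_cong[OF H H k] bilinear_linear_map[OF bil2[OF a] L] bilinear_linear_map[OF mn la] X')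
        (simp add: L_pure L12_pure a bilinear_mapsD[OF p2])
    also have "\<dots> = l a * L23 X"
      unfolding L23_def by (rule linear_map_tensor_lift[OF H H k k mn la X', symmetric])
    finally show ?thesis .
  qed
  have bil3: "(\<lambda>a b. pure_tensor H T2 a (comult H b)) \<in> bilinear_maps H H T3'"
    by (rule bilinear_mapsI) (simp_all add: bilinear_mapsD[OF p3'] linear_mapsD[OF \<Delta>])
  have "L (tensor_assoc H H H (tensor_map H T2 (\<lambda>x. x) (comult H) (comult H h))) =
      tensor_lift base_algebra (\<lambda>a b. L (tensor_assoc H H H (pure_tensor H T2 a (comult H b)))) (comult H h)"
    unfolding tensor_map_def T3'_def[symmetric]
    by (rule linear_map_tensor_lift[OF H H T3' k bil3 LA t[unfolded T2_def]])
  also have "\<dots> = tensor_lift base_algebra (\<lambda>a b. l a * convolution H m n b) (comult H h)"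
    by (intro tensor_lift_cong[OF H H k] bilinear_linear_map[OF bil3 LA] t[unfolded T2_def]
        functional_product_bilinear convolution_linear l m n)
      (simp add: LA_pure linear_mapsD[OF \<Delta>] L23_def conv)
  also have "\<dots> = convolution H l (convolution H m n) h" using h by (simp add: conv)
  finally have right: "L (tensor_assoc H H H (tensor_map H T2 (\<lambda>x. x) (comult H) (comult H h))) =
    convolution H l (convolution H m n) h" .
  have "tensor_map T2 H (comult H) (\<lambda>x. x) (comult H h) =
      tensor_assoc H H H (tensor_map H T2 (\<lambda>x. x) (comult H) (comult H h))"
    using hopf h by (simp add: hopf_algebra_def T2_def)
  then show ?thesis using left right by simp
qed

lemma monoid_convolution: "monoid (convolution_monoid H)"
proof (rule monoidI)
  let ?M = "convolution_monoid H"
  have ext: "convolution H l m \<in> extensional (carrier H)" for l m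
    unfolding convolution_def by simp
  show "\<one>\<^bsub>?M\<^esub> \<in> carrier ?M"
    using linear_map_restrict[OF hopf_linear(1,3)] by (simp add: convolution_monoid_def)
  fix l assume l: "l \<in> carrier ?M"
  show "\<one>\<^bsub>?M\<^esub> \<otimes>\<^bsub>?M\<^esub> l = l" "l \<otimes>\<^bsub>?M\<^esub> \<one>\<^bsub>?M\<^esub> = l"
    using l ext by (auto simp: convolution_monoid_def convolution_counit intro!: extensionalityI[of _ "carrier H"])
  fix m assume m: "m \<in> carrier ?M"
  show "l \<otimes>\<^bsub>?M\<^esub> m \<in> carrier ?M"
    using l m ext by (auto simp: convolution_monoid_def convolution_linear)
  fix n assume n: "n \<in> carrier ?M"
  show "l \<otimes>\<^bsub>?M\<^esub> m \<otimes>\<^bsub>?M\<^esub> n = l \<otimes>\<^bsub>?M\<^esub> (m \<otimes>\<^bsub>?M\<^esub> n)"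
    using l m n ext by (auto simp: convolution_monoid_def convolution_assoc intro!: extensionalityI[of _ "carrier H"])
qed

text \<open>
  A representative of \<open>\<Delta>(h)\<close> writes the convolution product at \<open>h\<close> as a finite sum that is the same for all pairs of
  functionals.
\<close>

lemma convolution_expansion:
  assumes h: "h \<in> carrier H"
  shows "\<exists>P. finite P \<and> (\<forall>l m. l \<in> linear_maps H base_algebra \<longrightarrow> m \<in> linear_maps H base_algebra \<longrightarrow>
    convolution H l m h = (\<Sum>(c, x, y)\<in>P. c * l x * m y))"
proof -
  obtain x where x: "x \<in> formal_sums H H" "comult H h = tensor_class H H x"
    using comult_closed[OF h] by (rule tensor_product_cases)
  define P where "P = (\<lambda>p. (Poly_Mapping.lookup x p, p)) ` Poly_Mapping.keys x"
  have inj: "inj_on (\<lambda>p. (Poly_Mapping.lookup x p, p)) (Poly_Mapping.keys x)"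
    by (rule inj_onI) (simp only: prod.inject)
  have "convolution H l m h = (\<Sum>(c, x, y)\<in>P. c * l x * m y)"
    if "l \<in> linear_maps H base_algebra" "m \<in> linear_maps H base_algebra" for l m
  proof -
    have "convolution H l m h = formal_eval base_algebra (\<lambda>x y. l x * m y) x"
      using h tensor_lift_class[OF hopf_linear(1) hopf_linear(1) linear_space_base_algebra
          functional_product_bilinear[OF that] x(1)] by (simp add: convolution_def x(2))
    also have "\<dots> = (\<Sum>p\<in>Poly_Mapping.keys x. Poly_Mapping.lookup x p * (l (fst p) * m (snd p)))"
      by (simp add: formal_eval_def finsum_base_algebra base_algebra_simps)
    also have "\<dots> = (\<Sum>p\<in>Poly_Mapping.keys x. (\<lambda>(c, a, b). c * l a * m b) (Poly_Mapping.lookup x p, p))"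
      by (simp only: split_beta fst_conv snd_conv mult.assoc)
    also have "\<dots> = (\<Sum>(c, a, b)\<in>P. c * l a * m b)"
      by (simp only: P_def sum.reindex[OF inj] o_def)
    finally show ?thesis .
  qed
  then have "\<forall>l m. l \<in> linear_maps H base_algebra \<longrightarrow> m \<in> linear_maps H base_algebra \<longrightarrow>
      convolution H l m h = (\<Sum>(c, x, y)\<in>P. c * l x * m y)" by simp
  moreover have "finite P" by (simp add: P_def)
  ultimately show ?thesis by (rule exI[of _ P, OF conjI, rotated])
qed

end

section \<open>Homomorphisms out of the universal group of a grading\<close>

lemma unital_algebraD:
  assumes "unital_algebra A"
  shows "linear_space A" "ring A"
  using assms by (simp_all add: unital_algebra_def)

lemma grading_suppD:
  assumes "g \<in> grading_supp A G \<Gamma>"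
  shows "g \<in> carrier G" "\<Gamma> g \<noteq> {\<zero>\<^bsub>A\<^esub>}"
  using assms by (auto simp: grading_supp_def)

locale graded_algebra =
  fixes A :: "('k::field, 'a, 'm) module_scheme" (structure)
    and G :: "('g, 'l) monoid_scheme" and \<Gamma> :: "'g \<Rightarrow> 'a set"
  assumes algebra: "unital_algebra A" and grading: "grading A G \<Gamma>"
begin

abbreviation supp :: "'g set" where "supp \<equiv> grading_supp A G \<Gamma>"

definition decomposition :: "'a \<Rightarrow> ('g \<Rightarrow> 'a) \<Rightarrow> bool" where
  "decomposition a d \<longleftrightarrow> (\<forall>g\<in>carrier G. d g \<in> \<Gamma> g) \<and> (\<forall>g. g \<notin> carrier G \<longrightarrow> d g = \<zero>) \<and>
     finite {g. d g \<noteq> \<zero>} \<and> a = (\<Oplus>g\<in>{g. d g \<noteq> \<zero>}. d g)"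

lemma linear: "linear_space A" and ring: "ring A"
  using unital_algebraD[OF algebra] .

sublocale A: ring A by (rule ring)

lemma group: "group G" using grading by (simp add: grading_def)

lemma submodule: "g \<in> carrier G \<Longrightarrow> Module.submodule (\<Gamma> g) class_ring A"
  using grading by (simp add: grading_def)

lemma component_closed:
  assumes "g \<in> carrier G"
  shows "a \<in> \<Gamma> g \<Longrightarrow> a \<in> carrier A" "\<zero> \<in> \<Gamma> g"
    "a \<in> \<Gamma> g \<Longrightarrow> c \<odot> a \<in> \<Gamma> g"
proof -
  interpret M: Module.module class_ring A by (rule linear)
  note S = M.submoduleE[OF submodule[OF assms]]
  show "a \<in> \<Gamma> g \<Longrightarrow> a \<in> carrier A" "a \<in> \<Gamma> g \<Longrightarrow> c \<odot> a \<in> \<Gamma> g"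
    using S(1) S(4)[of c a] by auto
  obtain b where "b \<in> \<Gamma> g" using S(2) by auto
  with S(4)[of 0 b] S(1) show "\<zero> \<in> \<Gamma> g"
    using linear_space_scale(3)[OF linear, of b] by auto
qed

lemma component_mult:
  "g \<in> carrier G \<Longrightarrow> h \<in> carrier G \<Longrightarrow> a \<in> \<Gamma> g \<Longrightarrow> b \<in> \<Gamma> h \<Longrightarrow> a \<otimes> b \<in> \<Gamma> (g \<otimes>\<^bsub>G\<^esub> h)"
  using grading by (simp add: grading_def)

lemma decomposition_exists: "a \<in> carrier A \<Longrightarrow> \<exists>!d. decomposition a d"
  unfolding decomposition_def using grading by (simp add: grading_def)

lemma suppI: "g \<in> carrier G \<Longrightarrow> a \<in> \<Gamma> g \<Longrightarrow> a \<noteq> \<zero> \<Longrightarrow> g \<in> supp"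
  by (auto simp: grading_supp_def)

lemma supp_carrier: "g \<in> supp \<Longrightarrow> g \<in> carrier G"
  by (rule grading_suppD)

lemma suppE:
  assumes "g \<in> supp" obtains a where "a \<in> \<Gamma> g" "a \<noteq> \<zero>"
  using grading_suppD[OF assms] component_closed(2) by blast

text \<open>
  A nonzero element common to two components would have two decompositions.
\<close>

lemma component_disjoint:
  assumes "g \<in> carrier G" "h \<in> carrier G" "a \<in> \<Gamma> g" "a \<in> \<Gamma> h" "a \<noteq> \<zero>"
  shows "g = h"
proof -
  have dec: "decomposition a (\<lambda>x. if x = y then a else \<zero>)" if "y \<in> carrier G" "a \<in> \<Gamma> y" for y
  proof -
    have "{x. (if x = y then a else \<zero>) \<noteq> \<zero>} = {y}" using assms(5) by auto
    then show ?thesis using that component_closed by (auto simp: decomposition_def)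
  qed
  have "(\<lambda>x. if x = g then a else \<zero>) = (\<lambda>x. if x = h then a else \<zero>)"
    using decomposition_exists[OF component_closed(1)[OF assms(1,3)]] dec assms(1-4) by blast
  from fun_cong[OF this, of g] show ?thesis using assms(5) by (auto split: if_splits)
qed

lemma component_inj: "inj_on \<Gamma> supp"
proof (rule inj_onI)
  fix g h assume "g \<in> supp" "h \<in> supp" "\<Gamma> g = \<Gamma> h"
  with suppE[of g] component_disjoint[of g h] grading_suppD show "g = h" by metis
qed

text \<open>
  The realization induced by an injection \<open>\<tau>\<close> of the support into another group: the same nonzero
  components, with new labels.
\<close>

definition relabel :: "('g \<Rightarrow> 'h) \<Rightarrow> 'h \<Rightarrow> 'a set" where
  "relabel \<tau> x = (if x \<in> \<tau> ` supp then \<Gamma> (the_inv_into supp \<tau> x) else {\<zero>})"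

context
  fixes G' :: "('h, 'j) monoid_scheme" and \<tau> :: "'g \<Rightarrow> 'h"
  assumes G': "group G'" and \<tau>: "\<tau> \<in> supp \<rightarrow> carrier G'" "inj_on \<tau> supp"
    and \<tau>_mult: "\<And>g h a b. g \<in> supp \<Longrightarrow> h \<in> supp \<Longrightarrow> a \<in> \<Gamma> g \<Longrightarrow> b \<in> \<Gamma> h \<Longrightarrow> a \<otimes> b \<noteq> \<zero> \<Longrightarrow>
      \<tau> (g \<otimes>\<^bsub>G\<^esub> h) = \<tau> g \<otimes>\<^bsub>G'\<^esub> \<tau> h"
begin

lemma relabel_image: "g \<in> supp \<Longrightarrow> relabel \<tau> (\<tau> g) = \<Gamma> g"
  using the_inv_into_f_f[OF \<tau>(2)] by (simp add: relabel_def)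

lemma relabel_cases:
  assumes "a \<in> relabel \<tau> x" "a \<noteq> \<zero>"
  obtains g where "g \<in> supp" "x = \<tau> g" "a \<in> \<Gamma> g"
proof (cases "x \<in> \<tau> ` supp")
  case True
  then obtain g where "g \<in> supp" "x = \<tau> g" by auto
  then show ?thesis using assms that relabel_image by auto
next
  case False
  then show ?thesis using assms by (simp add: relabel_def)
qed

lemma relabel_supp: "grading_supp A G' (relabel \<tau>) = \<tau> ` supp"
proof (rule Set.set_eqI, rule iffI)
  fix x assume "x \<in> grading_supp A G' (relabel \<tau>)"
  then show "x \<in> \<tau> ` supp" by (auto simp: grading_supp_def relabel_def split: if_splits)
next
  fix x assume "x \<in> \<tau> ` supp"
  then obtain g where g: "g \<in> supp" "x = \<tau> g" by auto
  then have "\<tau> g \<in> carrier G'" using \<tau>(1) by auto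
  then show "x \<in> grading_supp A G' (relabel \<tau>)"
    using grading_suppD(2)[OF g(1)] relabel_image[OF g(1)] by (simp add: grading_supp_def g(2))
qed

text \<open>
  Renaming preserves the direct sum decomposition, and a product of components that is nonzero has
  the right degree by the hypothesis on \<open>\<tau>\<close>.
\<close>

lemma relabel_grading: "grading A G' (relabel \<tau>)"
  unfolding grading_def
proof (intro conjI ballI)
  show "group G'" by (rule G')
next
  fix x assume x: "x \<in> carrier G'"
  interpret M: Module.module class_ring A by (rule linear)
  show "Module.submodule (relabel \<tau> x) class_ring A"
  proof (cases "x \<in> \<tau> ` supp")
    case True
    then obtain g where g: "g \<in> supp" "x = \<tau> g" by auto
    show ?thesis unfolding g(2) relabel_image[OF g(1)] by (rule submodule[OF grading_suppD(1)[OF g(1)]])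
  next
    case False
    have "Module.submodule {\<zero>} class_ring A"
      by (rule M.submoduleI) (simp_all add: linear_space_scale(4)[OF linear A.zero_closed])
    then show ?thesis using False by (simp add: relabel_def)
  qed
next
  fix x y a b assume xy: "x \<in> carrier G'" "y \<in> carrier G'" and a: "a \<in> relabel \<tau> x" and b: "b \<in> relabel \<tau> y"
  have zero: "\<zero> \<in> relabel \<tau> z" for z
  proof (cases "z \<in> \<tau> ` supp")
    case True
    then obtain g where g: "g \<in> supp" "z = \<tau> g" by auto
    show ?thesis unfolding g(2) relabel_image[OF g(1)] by (rule component_closed(2)[OF supp_carrier[OF g(1)]])
  qed (simp add: relabel_def)
  have closed: "c \<in> carrier A" if c: "c \<in> relabel \<tau> z" for c z
  proof (cases "c = \<zero>")
    case False
    obtain g where "g \<in> supp" "z = \<tau> g" "c \<in> \<Gamma> g" using relabel_cases[OF c False] .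
    then show ?thesis by (intro component_closed(1)[OF supp_carrier])
  qed simp
  show "a \<otimes> b \<in> relabel \<tau> (x \<otimes>\<^bsub>G'\<^esub> y)"
  proof (cases "a \<otimes> b = \<zero>")
    case True then show ?thesis using zero by simp
  next
    case False
    have "a \<noteq> \<zero>" "b \<noteq> \<zero>" using False closed[OF a] closed[OF b] by auto
    obtain g where g: "g \<in> supp" "x = \<tau> g" "a \<in> \<Gamma> g" using relabel_cases[OF a \<open>a \<noteq> \<zero>\<close>] .
    obtain h where h: "h \<in> supp" "y = \<tau> h" "b \<in> \<Gamma> h" using relabel_cases[OF b \<open>b \<noteq> \<zero>\<close>] .
    note c = grading_suppD(1)[OF g(1)] grading_suppD(1)[OF h(1)]
    have ab: "a \<otimes> b \<in> \<Gamma> (g \<otimes>\<^bsub>G\<^esub> h)" using component_mult[OF c g(3) h(3)] .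
    have gh: "g \<otimes>\<^bsub>G\<^esub> h \<in> supp"
      by (rule suppI[OF monoid.m_closed[OF group.is_monoid[OF group] c] ab False])
    have "x \<otimes>\<^bsub>G'\<^esub> y = \<tau> (g \<otimes>\<^bsub>G\<^esub> h)"
      unfolding g(2) h(2) by (rule \<tau>_mult[OF g(1) h(1) g(3) h(3) False, symmetric])
    then show ?thesis using ab by (simp only: relabel_image[OF gh])
  qed
next
  fix a assume a: "a \<in> carrier A"
  define dec' where "dec' = (\<lambda>d. (\<forall>x\<in>carrier G'. d x \<in> relabel \<tau> x) \<and> (\<forall>x. x \<notin> carrier G' \<longrightarrow> d x = \<zero>) \<and>
     finite {x. d x \<noteq> \<zero>} \<and> a = (\<Oplus>x\<in>{x. d x \<noteq> \<zero>}. d x))"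
  \<comment> \<open>\<open>push\<close> and \<open>pull\<close> translate between decompositions for the old and the new labels.\<close>
  define push where "push = (\<lambda>(d :: 'g \<Rightarrow> 'a) x. if x \<in> \<tau> ` supp then d (the_inv_into supp \<tau> x) else \<zero>)"
  define pull where "pull = (\<lambda>(e :: 'h \<Rightarrow> 'a) g. if g \<in> supp then e (\<tau> g) else \<zero>)"
  have push_image: "push d (\<tau> g) = d g" if "g \<in> supp" for d g
    using that the_inv_into_f_f[OF \<tau>(2)] by (simp add: push_def)
  have push_out: "push d x = \<zero>" if "x \<notin> \<tau> ` supp" for d x using that by (simp add: push_def)
  have push_dec: "dec' (push d)" if d: "decomposition a d" for d
  proof -
    have d_comp: "d g \<in> \<Gamma> g" if "g \<in> carrier G" for g using d that by (simp add: decomposition_def)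
    have d_out: "d g = \<zero>" if "g \<notin> carrier G" for g using d that by (simp add: decomposition_def)
    have dsupp: "g \<in> supp" if "d g \<noteq> \<zero>" for g
      using suppI[of g "d g"] d_comp d_out that by auto
    have carr: "d g \<in> carrier A" for g
    proof (cases "g \<in> carrier G")
      case True from component_closed(1)[OF this d_comp[OF this]] show ?thesis .
    qed (simp add: d_out)
    have set: "{x. push d x \<noteq> \<zero>} = \<tau> ` {g. d g \<noteq> \<zero>}"
    proof (rule Set.set_eqI, rule iffI)
      fix x assume x: "x \<in> {x. push d x \<noteq> \<zero>}"
      then have "x \<in> \<tau> ` supp" using push_out by auto
      then obtain g where "g \<in> supp" "x = \<tau> g" by auto
      then show "x \<in> \<tau> ` {g. d g \<noteq> \<zero>}" using x push_image by auto
    next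
      fix x assume "x \<in> \<tau> ` {g. d g \<noteq> \<zero>}"
      then obtain g where "d g \<noteq> \<zero>" "x = \<tau> g" by auto
      then show "x \<in> {x. push d x \<noteq> \<zero>}" using push_image[OF dsupp] by simp
    qed
    have img: "push d (\<tau> g) = d g" if "g \<in> {g. d g \<noteq> \<zero>}" for g using push_image[OF dsupp] that by simp
    have "(\<Oplus>x\<in>\<tau> ` {g. d g \<noteq> \<zero>}. push d x) = (\<Oplus>g\<in>{g. d g \<noteq> \<zero>}. push d (\<tau> g))"
    proof (rule A.add.finprod_reindex)
      show "push d \<in> \<tau> ` {g. d g \<noteq> \<zero>} \<rightarrow> carrier A" using carr img by auto
      show "inj_on \<tau> {g. d g \<noteq> \<zero>}" by (rule inj_on_subset[OF \<tau>(2)]) (use dsupp in auto)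
    qed
    also have "\<dots> = (\<Oplus>g\<in>{g. d g \<noteq> \<zero>}. d g)"
      using carr img by (intro A.finsum_cong') auto
    also have "\<dots> = a" using d by (simp add: decomposition_def)
    finally have "a = (\<Oplus>x\<in>{x. push d x \<noteq> \<zero>}. push d x)" unfolding set by simp
    moreover have "finite {x. push d x \<noteq> \<zero>}" unfolding set using d by (simp add: decomposition_def)
    moreover have "push d x \<in> relabel \<tau> x" for x
    proof (cases "x \<in> \<tau> ` supp")
      case True
      then obtain g where "g \<in> supp" "x = \<tau> g" by auto
      then show ?thesis using push_image relabel_image d_comp supp_carrier by simp
    qed (simp add: push_def relabel_def)
    moreover have "push d x = \<zero>" if "x \<notin> carrier G'" for x
    proof (rule push_out)
      show "x \<notin> \<tau> ` supp" using that \<tau>(1) by auto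
    qed
    ultimately show ?thesis unfolding dec'_def by simp
  qed
  have pull_dec: "decomposition a (pull e) \<and> push (pull e) = e" if e: "dec' e" for e
  proof -
    have e_comp: "e x \<in> relabel \<tau> x" if "x \<in> carrier G'" for x using e that by (simp add: dec'_def)
    have e_out: "e x = \<zero>" if "x \<notin> carrier G'" for x using e that by (simp add: dec'_def)
    have esupp: "x \<in> \<tau> ` supp" if "e x \<noteq> \<zero>" for x
    proof -
      have "e x \<in> relabel \<tau> x" using that e_comp e_out by metis
      from relabel_cases[OF this that] show ?thesis by auto
    qed
    have pull_image: "pull e g = e (\<tau> g)" if "g \<in> supp" for g using that by (simp add: pull_def)
    have pull_out: "pull e g = \<zero>" if "g \<notin> supp" for g using that by (simp add: pull_def)
    have sub: "{g. pull e g \<noteq> \<zero>} \<subseteq> supp" using pull_out by auto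
    have set: "{x. e x \<noteq> \<zero>} = \<tau> ` {g. pull e g \<noteq> \<zero>}"
    proof (rule Set.set_eqI, rule iffI)
      fix x assume x: "x \<in> {x. e x \<noteq> \<zero>}"
      then obtain g where "g \<in> supp" "x = \<tau> g" using esupp by auto
      then show "x \<in> \<tau> ` {g. pull e g \<noteq> \<zero>}" using x pull_image by auto
    next
      fix x assume "x \<in> \<tau> ` {g. pull e g \<noteq> \<zero>}"
      then obtain g where g: "pull e g \<noteq> \<zero>" "x = \<tau> g" by auto
      then have "g \<in> supp" using pull_out by auto
      then show "x \<in> {x. e x \<noteq> \<zero>}" using g pull_image by simp
    qed
    have comp: "pull e g \<in> \<Gamma> g" if "g \<in> carrier G" for g
    proof (cases "g \<in> supp")
      case True
      then have "\<tau> g \<in> carrier G'" using \<tau>(1) by auto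
      from e_comp[OF this] True show ?thesis by (simp add: pull_image relabel_image)
    qed (simp add: pull_out component_closed(2)[OF that])
    have out: "pull e g = \<zero>" if "g \<notin> carrier G" for g
    proof (rule pull_out)
      show "g \<notin> supp" using that supp_carrier by auto
    qed
    have carr: "pull e g \<in> carrier A" for g
    proof (cases "g \<in> carrier G")
      case True from component_closed(1)[OF this comp[OF this]] show ?thesis .
    qed (simp add: out)
    have "finite (\<tau> ` {g. pull e g \<noteq> \<zero>})" using e unfolding dec'_def set by simp
    then have fin: "finite {g. pull e g \<noteq> \<zero>}"
      using inj_on_subset[OF \<tau>(2) sub] by (rule finite_imageD)
    have img: "e (\<tau> g) = pull e g" if "g \<in> {g. pull e g \<noteq> \<zero>}" for g
      using that sub pull_image by auto
    have "a = (\<Oplus>x\<in>\<tau> ` {g. pull e g \<noteq> \<zero>}. e x)" using e unfolding dec'_def set by simp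
    also have "\<dots> = (\<Oplus>g\<in>{g. pull e g \<noteq> \<zero>}. e (\<tau> g))"
    proof (rule A.add.finprod_reindex)
      show "e \<in> \<tau> ` {g. pull e g \<noteq> \<zero>} \<rightarrow> carrier A" using carr img by auto
    qed (rule inj_on_subset[OF \<tau>(2) sub])
    also have "\<dots> = (\<Oplus>g\<in>{g. pull e g \<noteq> \<zero>}. pull e g)"
      using carr img by (intro A.finsum_cong') auto
    finally have "decomposition a (pull e)" using fin comp out unfolding decomposition_def by simp
    moreover have "push (pull e) x = e x" for x
    proof (cases "x \<in> \<tau> ` supp")
      case True
      then obtain g where "g \<in> supp" "x = \<tau> g" by auto
      then show ?thesis by (simp add: push_image pull_image)
    next
      case False then show ?thesis using esupp[of x] push_out by auto
    qed
    ultimately show ?thesis by auto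
  qed
  have "\<exists>!d. dec' d"
  proof -
    from decomposition_exists[OF a] obtain d where
      "decomposition a d \<and> (\<forall>d'. decomposition a d' \<longrightarrow> d' = d)" unfolding Ex1_def by (elim exE)
    then have d: "decomposition a d" and uniq: "\<And>d'. decomposition a d' \<Longrightarrow> d' = d" by simp_all
    show ?thesis
    proof (rule ex1I)
      show "dec' (push d)" using push_dec[OF d] .
      show "e = push d" if "dec' e" for e using pull_dec[OF that] uniq[of "pull e"] by simp
    qed
  qed
  then show "\<exists>!d. (\<forall>x\<in>carrier G'. d x \<in> relabel \<tau> x) \<and> (\<forall>x. x \<notin> carrier G' \<longrightarrow> d x = \<zero>) \<and>
     finite {x. d x \<noteq> \<zero>} \<and> a = (\<Oplus>x\<in>{x. d x \<noteq> \<zero>}. d x)"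
    unfolding dec'_def .
qed

end

end

lemma realization_mapD:
  assumes A: "unital_algebra A" and real: "grading_realization A G\<^sub>0 \<Gamma>\<^sub>0 G \<Gamma>"
    and g: "g\<^sub>0 \<in> grading_supp A G\<^sub>0 \<Gamma>\<^sub>0"
  shows "realization_map \<Gamma>\<^sub>0 G \<Gamma> g\<^sub>0 \<in> grading_supp A G \<Gamma>"
    and "\<Gamma> (realization_map \<Gamma>\<^sub>0 G \<Gamma> g\<^sub>0) = \<Gamma>\<^sub>0 g\<^sub>0"
    and "g \<in> carrier G \<Longrightarrow> \<Gamma> g = \<Gamma>\<^sub>0 g\<^sub>0 \<Longrightarrow> realization_map \<Gamma>\<^sub>0 G \<Gamma> g\<^sub>0 = g"
proof -
  interpret graded_algebra A G \<Gamma>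
    using A real by unfold_locales (simp_all add: grading_realization_def)
  have "\<Gamma>\<^sub>0 g\<^sub>0 \<in> \<Gamma> ` supp" using real g by (auto simp: grading_realization_def)
  then obtain g1 where g1: "g1 \<in> supp" "\<Gamma> g1 = \<Gamma>\<^sub>0 g\<^sub>0" by auto
  have uniq: "h = g1" if "h \<in> carrier G" "\<Gamma> h = \<Gamma>\<^sub>0 g\<^sub>0" for h
  proof -
    have "h \<in> supp" using that g1 grading_suppD(2)[OF g1(1)] by (simp add: grading_supp_def)
    from inj_onD[OF component_inj _ this g1(1)] show ?thesis using that g1 by simp
  qed
  have "realization_map \<Gamma>\<^sub>0 G \<Gamma> g\<^sub>0 = g1"
    unfolding realization_map_def
  proof (rule the_equality)
    show "g1 \<in> carrier G \<and> \<Gamma> g1 = \<Gamma>\<^sub>0 g\<^sub>0" using g1 supp_carrier by simp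
  qed (use uniq in auto)
  then show "realization_map \<Gamma>\<^sub>0 G \<Gamma> g\<^sub>0 \<in> supp" "\<Gamma> (realization_map \<Gamma>\<^sub>0 G \<Gamma> g\<^sub>0) = \<Gamma>\<^sub>0 g\<^sub>0"
    and "g \<in> carrier G \<Longrightarrow> \<Gamma> g = \<Gamma>\<^sub>0 g\<^sub>0 \<Longrightarrow> realization_map \<Gamma>\<^sub>0 G \<Gamma> g\<^sub>0 = g"
    using g1 uniq by simp_all
qed

locale universally_graded_algebra = graded_algebra A G \<Gamma>
  for A :: "('k::field, 'a, 'm) module_scheme" (structure)
    and G :: "'g monoid" and \<Gamma> :: "'g \<Rightarrow> 'a set" +
  fixes G\<^sub>0 :: "('g0, 'l0) monoid_scheme" and \<Gamma>\<^sub>0 :: "'g0 \<Rightarrow> 'a set"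
  assumes universal: "universal_group A G\<^sub>0 \<Gamma>\<^sub>0 G \<Gamma>"
begin

lemma realization: "grading_realization A G\<^sub>0 \<Gamma>\<^sub>0 G \<Gamma>"
  using universal by (simp add: universal_group_def)

text \<open>
  The universal property in terms of maps on the support of \<open>\<Gamma>\<close>: such a \<open>\<tau>\<close> is the injection that belongs
  to the realization \<open>relabel \<tau>\<close>.
\<close>

lemma universal_hom_injective:
  fixes G' :: "'g monoid"
  assumes G': "group G'" and \<tau>: "\<tau> \<in> supp \<rightarrow> carrier G'" "inj_on \<tau> supp"
    and \<tau>_mult: "\<And>g h a b. g \<in> supp \<Longrightarrow> h \<in> supp \<Longrightarrow> a \<in> \<Gamma> g \<Longrightarrow> b \<in> \<Gamma> h \<Longrightarrow> a \<otimes> b \<noteq> \<zero> \<Longrightarrow>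
      \<tau> (g \<otimes>\<^bsub>G\<^esub> h) = \<tau> g \<otimes>\<^bsub>G'\<^esub> \<tau> h"
  shows "\<exists>!\<phi>. \<phi> \<in> extensional (carrier G) \<and> \<phi> \<in> hom G G' \<and> (\<forall>g\<in>supp. \<phi> g = \<tau> g)"
proof -
  have rel1: "relabel \<tau> (\<tau> g) = \<Gamma> g" if "g \<in> supp" for g
    by (rule relabel_image[OF G' \<tau> _ that]) (rule \<tau>_mult)
  have rel2: "grading_supp A G' (relabel \<tau>) = \<tau> ` supp"
    by (rule relabel_supp[OF G' \<tau>]) (rule \<tau>_mult)
  have rel3: "grading A G' (relabel \<tau>)"
    by (rule relabel_grading[OF G' \<tau>]) (rule \<tau>_mult)
  have "relabel \<tau> ` grading_supp A G' (relabel \<tau>) = \<Gamma> ` supp"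
    unfolding rel2 image_image by (rule image_cong[OF refl rel1])
  then have real': "grading_realization A G\<^sub>0 \<Gamma>\<^sub>0 G' (relabel \<tau>)"
    using realization rel3 by (simp add: grading_realization_def)
  let ?r = "realization_map \<Gamma>\<^sub>0 G \<Gamma>" and ?r' = "realization_map \<Gamma>\<^sub>0 G' (relabel \<tau>)"
  note r = realization_mapD[OF algebra realization]
  have r': "?r' g\<^sub>0 = \<tau> (?r g\<^sub>0)" if g: "g\<^sub>0 \<in> grading_supp A G\<^sub>0 \<Gamma>\<^sub>0" for g\<^sub>0
  proof (rule realization_mapD(3)[OF algebra real' g])
    show "\<tau> (?r g\<^sub>0) \<in> carrier G'" using \<tau>(1) r(1)[OF g] by auto
    show "relabel \<tau> (\<tau> (?r g\<^sub>0)) = \<Gamma>\<^sub>0 g\<^sub>0" using rel1[OF r(1)[OF g]] r(2)[OF g] by simp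
  qed
  have surj: "?r ` grading_supp A G\<^sub>0 \<Gamma>\<^sub>0 = supp"
  proof (rule equalityI)
    show "?r ` grading_supp A G\<^sub>0 \<Gamma>\<^sub>0 \<subseteq> supp" using r(1) by auto
    show "supp \<subseteq> ?r ` grading_supp A G\<^sub>0 \<Gamma>\<^sub>0"
    proof
      fix g assume g: "g \<in> supp"
      then have "\<Gamma> g \<in> \<Gamma>\<^sub>0 ` grading_supp A G\<^sub>0 \<Gamma>\<^sub>0"
        using realization by (auto simp: grading_realization_def)
      then obtain g\<^sub>0 where g0: "g\<^sub>0 \<in> grading_supp A G\<^sub>0 \<Gamma>\<^sub>0" "\<Gamma> g = \<Gamma>\<^sub>0 g\<^sub>0" by auto
      from r(3)[OF g0(1) supp_carrier[OF g] g0(2)] g0(1) show "g \<in> ?r ` grading_supp A G\<^sub>0 \<Gamma>\<^sub>0" by force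
    qed
  qed
  have eq: "(\<forall>g\<in>grading_supp A G\<^sub>0 \<Gamma>\<^sub>0. \<phi> (?r g) = ?r' g) \<longleftrightarrow> (\<forall>g\<in>supp. \<phi> g = \<tau> g)" for \<phi> :: "'g \<Rightarrow> 'g"
    unfolding surj[symmetric] using r' by simp
  have "\<exists>!\<phi>. \<phi> \<in> extensional (carrier G) \<and> \<phi> \<in> hom G G' \<and> (\<forall>g\<in>grading_supp A G\<^sub>0 \<Gamma>\<^sub>0. \<phi> (?r g) = ?r' g)"
    using universal real' unfolding universal_group_def by simp
  then show ?thesis unfolding eq .
qed

text \<open>
  The subgroup generated by the support also realizes the grading. Composing the resulting
  homomorphism with the inclusion gives an endomorphism of \<open>G\<close> that fixes the support, which by uniqueness is the identity.
\<close>

lemma generated_by_supp: "carrier G = generate G supp"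
proof -
  interpret G: group G by (rule group)
  have sub: "supp \<subseteq> carrier G" using supp_carrier by auto
  define K where "K = G\<lparr>carrier := generate G supp\<rparr>"
  have "subgroup (generate G supp) G" by (rule G.generate_is_subgroup[OF sub])
  then have K: "group K" unfolding K_def by (rule G.subgroup_imp_group)
  have "\<exists>!\<phi>. \<phi> \<in> extensional (carrier G) \<and> \<phi> \<in> hom G K \<and> (\<forall>g\<in>supp. \<phi> g = g)"
    by (rule universal_hom_injective[OF K]) (auto simp: K_def intro: generate.incl)
  then obtain \<phi> where \<phi>: "\<phi> \<in> extensional (carrier G) \<and> \<phi> \<in> hom G K \<and> (\<forall>g\<in>supp. \<phi> g = g)" by (elim ex1E)
  have gen: "\<phi> x \<in> generate G supp" if "x \<in> carrier G" for x
    using \<phi> that by (auto simp: hom_def K_def)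
  have uniq: "\<exists>!\<phi>. \<phi> \<in> extensional (carrier G) \<and> \<phi> \<in> hom G G \<and> (\<forall>g\<in>supp. \<phi> g = g)"
    by (rule universal_hom_injective[OF group]) (auto intro: supp_carrier)
  have 1: "\<phi> \<in> extensional (carrier G) \<and> \<phi> \<in> hom G G \<and> (\<forall>g\<in>supp. \<phi> g = g)"
    using \<phi> gen G.generate_in_carrier[OF sub] by (auto simp: hom_def K_def)
  have 2: "restrict (\<lambda>x. x) (carrier G) \<in> extensional (carrier G) \<and> restrict (\<lambda>x. x) (carrier G) \<in> hom G G \<and>
      (\<forall>g\<in>supp. restrict (\<lambda>x. x) (carrier G) g = g)"
    using sub by (auto simp: hom_def)
  from uniq obtain \<psi> where "\<forall>\<phi>. \<phi> \<in> extensional (carrier G) \<and> \<phi> \<in> hom G G \<and> (\<forall>g\<in>supp. \<phi> g = g) \<longrightarrow> \<phi> = \<psi>"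
    unfolding Ex1_def by (elim exE conjE)
  with 1 2 have "\<phi> = restrict (\<lambda>x. x) (carrier G)" by metis
  then have "x \<in> generate G supp" if "x \<in> carrier G" for x using gen[OF that] that by simp
  then show ?thesis using G.generate_in_carrier[OF sub] by auto
qed

end

text \<open>
  Its elements are values of words in the elements of \<open>S\<close> and their inverses.
\<close>

lemma (in group) countable_generate:
  assumes S: "countable S" "S \<subseteq> carrier G"
  shows "countable (generate G S)"
proof -
  define W where "W = S \<union> m_inv G ` S"
  define ev where "ev = (\<lambda>xs. foldr (\<otimes>) xs \<one>)"
  have W: "W \<subseteq> carrier G" using S(2) by (auto simp: W_def)
  have closed: "ev xs \<in> carrier G" if "xs \<in> lists W" for xs
    using that W by (induction xs) (auto simp: ev_def)
  have append: "ev (xs @ ys) = ev xs \<otimes> ev ys" if "xs \<in> lists W" "ys \<in> lists W" for xs ys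
    using that(1)
  proof (induction xs)
    case Nil
    then show ?case using closed[OF that(2)] by (simp add: ev_def)
  next
    case (Cons x xs)
    then have "x \<in> carrier G" "xs \<in> lists W" using W by auto
    moreover have "ev ((x # xs) @ ys) = x \<otimes> ev (xs @ ys)" "ev (x # xs) = x \<otimes> ev xs" by (simp_all add: ev_def)
    ultimately show ?case using Cons.IH closed that(2) by (simp add: m_assoc)
  qed
  have single: "h \<in> ev ` lists W" if "h \<in> W" for h
  proof (rule image_eqI)
    show "h = ev [h]" using that W by (auto simp: ev_def)
    show "[h] \<in> lists W" using that by simp
  qed
  have "generate G S \<subseteq> ev ` lists W"
  proof
    fix x assume "x \<in> generate G S"
    then show "x \<in> ev ` lists W"
    proof (induction x rule: generate.induct)
      case one
      show ?case by (rule image_eqI[of _ _ "[]"]) (simp_all add: ev_def)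
    next
      case (incl h) then show ?case by (intro single) (simp add: W_def)
    next
      case (inv h) then show ?case by (intro single) (simp add: W_def)
    next
      case (eng h1 h2)
      then obtain xs ys where "xs \<in> lists W" "ys \<in> lists W" "h1 = ev xs" "h2 = ev ys" by auto
      then show ?case using append[of xs ys] by (intro image_eqI[of _ _ "xs @ ys"]) auto
    qed
  qed
  moreover have "countable (lists W)" using S(1) by (simp add: W_def)
  ultimately show ?thesis by (meson countable_image countable_subset)
qed

context universally_graded_algebra
begin

text \<open>
  The map \<open>l\<close> may identify elements of the support and then comes from no realization. Its graph
  \<open>g \<mapsto> (g, l g)\<close> is injective and realizes the grading by a subgroup of \<open>G \<times> Q\<close>; the second projection of
  the homomorphism obtained from it extends \<open>l\<close>. The subgroup generated by the graph is countable, so an injective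
  image of it serves as a group on the element type of \<open>G\<close>, over which the universal property is stated.
\<close>

lemma universal_hom:
  fixes Q :: "('q, 'n) monoid_scheme"
  assumes Q: "group Q" and inf: "infinite (carrier G)" and fin: "finite supp"
    and l: "l \<in> supp \<rightarrow> carrier Q"
    and l_mult: "\<And>g h a b. g \<in> supp \<Longrightarrow> h \<in> supp \<Longrightarrow> a \<in> \<Gamma> g \<Longrightarrow> b \<in> \<Gamma> h \<Longrightarrow> a \<otimes> b \<noteq> \<zero> \<Longrightarrow>
      l (g \<otimes>\<^bsub>G\<^esub> h) = l g \<otimes>\<^bsub>Q\<^esub> l h"
  shows "\<exists>\<Phi>. \<Phi> \<in> hom G Q \<and> (\<forall>g\<in>supp. \<Phi> g = l g)"
proof -
  interpret G: group G by (rule group)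
  define P where "P = G \<times>\<times> Q"
  interpret P: group P unfolding P_def by (rule DirProd_group[OF group Q])
  define S where "S = (\<lambda>g. (g, l g)) ` supp"
  have S: "S \<subseteq> carrier P" using l supp_carrier by (auto simp: S_def P_def)
  define K where "K = P\<lparr>carrier := generate P S\<rparr>"
  have K_sub: "subgroup (generate P S) P" by (rule P.generate_is_subgroup[OF S])
  then interpret K: group K unfolding K_def by (rule P.subgroup_imp_group)
  have countable: "countable (carrier K)"
    unfolding K_def using P.countable_generate[OF _ S] fin by (simp add: S_def countable_finite)
  obtain e :: "nat \<Rightarrow> 'g" where e: "inj e" "range e \<subseteq> carrier G"
    using infinite_countable_subset[OF inf] by (elim exE conjE)
  define f where "f = e \<circ> to_nat_on (carrier K)"
  have f: "inj_on f (carrier K)"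
    unfolding f_def using inj_on_to_nat_on[OF countable] e(1) by (auto simp: inj_on_def)
  define G' where "G' = image_group f K"
  have G': "group G'" unfolding G'_def by (rule K.inj_imp_image_group_is_group[OF f])
  define k where "k = inv_into (carrier K) f"
  have k_f: "k (f x) = x" if "x \<in> carrier K" for x unfolding k_def by (rule inv_into_f_f[OF f that])
  have mult': "f x \<otimes>\<^bsub>G'\<^esub> f y = f (x \<otimes>\<^bsub>P\<^esub> y)" if "x \<in> carrier K" "y \<in> carrier K" for x y
    using that k_f by (simp add: G'_def image_group_def k_def K_def)
  have k_hom: "k (x \<otimes>\<^bsub>G'\<^esub> y) = k x \<otimes>\<^bsub>P\<^esub> k y \<and> k x \<in> carrier P" if xy: "x \<in> carrier G'" "y \<in> carrier G'" for x y
  proof -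
    from xy obtain x' y' where *: "x' \<in> carrier K" "y' \<in> carrier K" "x = f x'" "y = f y'"
      by (auto simp: G'_def image_group_carrier)
    have "x' \<otimes>\<^bsub>P\<^esub> y' \<in> carrier K" using K.m_closed[OF *(1,2)] by (simp add: K_def)
    moreover have "x' \<in> carrier P" using *(1) subgroup.subset[OF K_sub] by (auto simp: K_def)
    ultimately show ?thesis using * by (simp add: mult' k_f)
  qed
  define \<tau> where "\<tau> = (\<lambda>g. f (g, l g))"
  have pair: "(g, l g) \<in> carrier K" if "g \<in> supp" for g
    using that by (auto simp: K_def S_def intro: generate.incl)
  have "\<exists>!\<phi>. \<phi> \<in> extensional (carrier G) \<and> \<phi> \<in> hom G G' \<and> (\<forall>g\<in>supp. \<phi> g = \<tau> g)"
  proof (rule universal_hom_injective[OF G'])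
    show "\<tau> \<in> supp \<rightarrow> carrier G'" using pair by (auto simp: \<tau>_def G'_def image_group_carrier)
    show "inj_on \<tau> supp"
    proof (rule inj_onI)
      fix g h assume gh: "g \<in> supp" "h \<in> supp" "\<tau> g = \<tau> h"
      have "(g, l g) = (h, l h)"
        by (rule inj_onD[OF f gh(3)[unfolded \<tau>_def] pair[OF gh(1)] pair[OF gh(2)]])
      then show "g = h" by simp
    qed
    fix g h a b assume gh: "g \<in> supp" "h \<in> supp" "a \<in> \<Gamma> g" "b \<in> \<Gamma> h" "a \<otimes> b \<noteq> \<zero>"
    show "\<tau> (g \<otimes>\<^bsub>G\<^esub> h) = \<tau> g \<otimes>\<^bsub>G'\<^esub> \<tau> h"
      using l_mult[OF gh] by (simp add: \<tau>_def mult'[OF pair[OF gh(1)] pair[OF gh(2)]] P_def)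
  qed
  then obtain \<phi> where \<phi>: "\<phi> \<in> hom G G'" "\<forall>g\<in>supp. \<phi> g = \<tau> g" by (elim ex1E conjE)
  show ?thesis
  proof (rule exI[of _ "\<lambda>x. snd (k (\<phi> x))"], intro conjI ballI)
    show "(\<lambda>x. snd (k (\<phi> x))) \<in> hom G Q"
    proof (rule homI)
      fix x y assume xy: "x \<in> carrier G" "y \<in> carrier G"
      have c: "\<phi> x \<in> carrier G'" "\<phi> y \<in> carrier G'" using \<phi>(1) xy by (auto simp: hom_def)
      from k_hom[OF c(1,1)] show "snd (k (\<phi> x)) \<in> carrier Q" by (auto simp: P_def)
      have "\<phi> (x \<otimes>\<^bsub>G\<^esub> y) = \<phi> x \<otimes>\<^bsub>G'\<^esub> \<phi> y" using \<phi>(1) xy by (simp add: hom_def)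
      then show "snd (k (\<phi> (x \<otimes>\<^bsub>G\<^esub> y))) = snd (k (\<phi> x)) \<otimes>\<^bsub>Q\<^esub> snd (k (\<phi> y))"
        using k_hom[OF c] by (simp add: P_def DirProd_def split_beta)
    qed
    show "snd (k (\<phi> g)) = l g" if "g \<in> supp" for g
      using \<phi>(2) that k_f[OF pair[OF that]] by (simp add: \<tau>_def)
  qed
qed

end

section \<open>Diagonal actions on elementarily graded matrix algebras\<close>

lemma unital_matrix_algebra: "unital_algebra (matrix_algebra n :: ('k::field, 'k mat) module)"
  unfolding unital_algebra_def
proof (intro conjI allI ballI)
  let ?A = "matrix_algebra n :: ('k, 'k mat) module"
  show "linear_space ?A" using matrix_vs[where 'a = 'k, of n n] by (simp add: vectorspace_def)
  show "ring ?A"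
  proof (rule ringI)
    show "abelian_group ?A" by (rule abelian_group_mat)
    show "Group.monoid ?A"
      by (rule monoidI) (simp_all add: module_mat_simps)
    fix x y z assume "x \<in> carrier ?A" "y \<in> carrier ?A" "z \<in> carrier ?A"
    then have "x \<in> carrier_mat n n" "y \<in> carrier_mat n n" "z \<in> carrier_mat n n"
      by (simp_all add: module_mat_simps)
    note c = this
    show "(x \<oplus>\<^bsub>?A\<^esub> y) \<otimes>\<^bsub>?A\<^esub> z = x \<otimes>\<^bsub>?A\<^esub> z \<oplus>\<^bsub>?A\<^esub> y \<otimes>\<^bsub>?A\<^esub> z"
      "z \<otimes>\<^bsub>?A\<^esub> (x \<oplus>\<^bsub>?A\<^esub> y) = z \<otimes>\<^bsub>?A\<^esub> x \<oplus>\<^bsub>?A\<^esub> z \<otimes>\<^bsub>?A\<^esub> y"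
      unfolding module_mat_simps
      by (rule add_mult_distrib_mat[OF c(1,2,3)], rule mult_add_distrib_mat[OF c(3,1,2)])
  qed
  fix c and x y assume "x \<in> carrier ?A" "y \<in> carrier ?A"
  then have xy: "x \<in> carrier_mat n n" "y \<in> carrier_mat n n" by (simp_all add: module_mat_simps)
  show "(c \<odot>\<^bsub>?A\<^esub> x) \<otimes>\<^bsub>?A\<^esub> y = c \<odot>\<^bsub>?A\<^esub> (x \<otimes>\<^bsub>?A\<^esub> y)"
    "x \<otimes>\<^bsub>?A\<^esub> (c \<odot>\<^bsub>?A\<^esub> y) = c \<odot>\<^bsub>?A\<^esub> (x \<otimes>\<^bsub>?A\<^esub> y)"
    unfolding module_mat_simps by (rule mult_smult_assoc_mat[OF xy], rule mult_smult_distrib[OF xy])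
qed

lemma smult_mat_index:
  "a \<in> carrier_mat n n \<Longrightarrow> i < n \<Longrightarrow> j < n \<Longrightarrow> (c \<cdot>\<^sub>m a) $$ (i, j) = c * a $$ (i, j)"
  by simp

lemma index_mult_square_mat:
  assumes "a \<in> carrier_mat n n" "b \<in> carrier_mat n n" "i < n" "j < n"
  shows "(a * b) $$ (i, j) = (\<Sum>k<n. a $$ (i, k) * b $$ (k, j))"
  using assms by (simp add: scalar_prod_def atLeast0LessThan)

lemma matrix_unit_carrier: "matrix_unit n i j \<in> carrier_mat n n"
  by (simp add: matrix_unit_def)

lemma matrix_unit_index:
  "k < n \<Longrightarrow> l < n \<Longrightarrow> matrix_unit n i j $$ (k, l) = (if k = i \<and> l = j then 1 else 0)"
  by (simp add: matrix_unit_def)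

lemma matrix_unit_nonzero:
  assumes "i < n" "j < n"
  shows "matrix_unit n i j \<noteq> (0\<^sub>m n n :: 'k::field mat)"
proof
  assume "matrix_unit n i j = (0\<^sub>m n n :: 'k mat)"
  then have "matrix_unit n i j $$ (i, j) = (0\<^sub>m n n :: 'k mat) $$ (i, j)" by simp
  then show False using assms by (simp add: matrix_unit_index)
qed

lemma matrix_unit_mult_left:
  assumes a: "a \<in> carrier_mat n n" and ij: "i < n" "j < n" "k < n" "l < n"
  shows "(matrix_unit n i j * a) $$ (k, l) = (if k = i then a $$ (j, l) else 0)"
  using ij by (simp add: index_mult_square_mat[OF matrix_unit_carrier a] matrix_unit_index if_distrib[of "\<lambda>x. x * _"] cong: if_cong)

lemma matrix_unit_mult_right:
  assumes a: "a \<in> carrier_mat n n" and ij: "i < n" "j < n" "k < n" "l < n"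
  shows "(a * matrix_unit n i j) $$ (k, l) = (if l = j then a $$ (k, i) else 0)"
  using ij by (simp add: index_mult_square_mat[OF a matrix_unit_carrier] matrix_unit_index if_distrib[of "\<lambda>x. _ * x"] cong: if_cong)

lemma matrix_unit_mult:
  assumes "i < n" "j < n" "l < n"
  shows "matrix_unit n i j * matrix_unit n j l = (matrix_unit n i l :: 'k::field mat)"
  using assms
  by (intro eq_matI) (auto simp: matrix_unit_mult_left[OF matrix_unit_carrier] matrix_unit_index
      carrier_matD[OF matrix_unit_carrier] simp del: index_mult_mat(1))

text \<open>
  Cutting a matrix down by diagonal matrix units isolates one entry; as these have degree \<open>1\<close>, all
  matrix units that occur in a homogeneous matrix have its degree.
\<close>

lemma matrix_unit_corner:
  assumes a: "a \<in> carrier_mat n n" and ij: "i < n" "j < n"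
  shows "matrix_unit n i i * a * matrix_unit n j j = a $$ (i, j) \<cdot>\<^sub>m (matrix_unit n i j :: 'k::field mat)"
proof (rule eq_matI)
  have ca: "matrix_unit n i i * a \<in> carrier_mat n n" using a matrix_unit_carrier by (rule mult_carrier_mat[rotated])
  show "dim_row (matrix_unit n i i * a * matrix_unit n j j) = dim_row (a $$ (i, j) \<cdot>\<^sub>m matrix_unit n i j)"
    "dim_col (matrix_unit n i i * a * matrix_unit n j j) = dim_col (a $$ (i, j) \<cdot>\<^sub>m matrix_unit n i j)"
    using carrier_matD[OF ca] by (simp_all add: matrix_unit_def)
  fix k l assume "k < dim_row (a $$ (i, j) \<cdot>\<^sub>m (matrix_unit n i j :: 'k mat))"
    "l < dim_col (a $$ (i, j) \<cdot>\<^sub>m (matrix_unit n i j :: 'k mat))"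
  then have kl: "k < n" "l < n" by (simp_all add: matrix_unit_def)
  have "(a $$ (i, j) \<cdot>\<^sub>m matrix_unit n i j) $$ (k, l) = a $$ (i, j) * (matrix_unit n i j :: 'k mat) $$ (k, l)"
    using kl by (simp add: carrier_matD[OF matrix_unit_carrier])
  then show "(matrix_unit n i i * a * matrix_unit n j j) $$ (k, l) = (a $$ (i, j) \<cdot>\<^sub>m matrix_unit n i j) $$ (k, l)"
    using ij kl by (simp add: matrix_unit_mult_right[OF ca] matrix_unit_mult_left[OF a] matrix_unit_index
      del: index_mult_mat(1))
qed

lemma nonzero_entry:
  assumes "a \<in> carrier_mat n n" "a \<noteq> 0\<^sub>m n n"
  obtains i j where "i < n" "j < n" "a $$ (i, j) \<noteq> 0"
proof (rule ccontr)
  assume *: "\<not> thesis"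
  have "a = 0\<^sub>m n n"
  proof (rule eq_matI)
    show "a $$ (i, j) = 0\<^sub>m n n $$ (i, j)" if "i < dim_row (0\<^sub>m n n :: 'a mat)" "j < dim_col (0\<^sub>m n n :: 'a mat)" for i j
    proof -
      have ij: "i < n" "j < n" using that by simp_all
      with \<open>\<not> thesis\<close> \<open>\<And>i j. i < n \<Longrightarrow> j < n \<Longrightarrow> a $$ (i, j) \<noteq> 0 \<Longrightarrow> thesis\<close> have "a $$ (i, j) = 0" by metis
      then show ?thesis using ij by simp
    qed
  qed (use assms(1) in auto)
  with assms(2) show False by simp
qed

locale graded_matrix_algebra = universally_graded_algebra "matrix_algebra n :: ('k::field, 'k mat) module" G \<Gamma> G\<^sub>0 \<Gamma>\<^sub>0
  for n :: nat and G :: "'g monoid" and \<Gamma> :: "'g \<Rightarrow> 'k::field mat set"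
    and G\<^sub>0 :: "('g0, 'l0) monoid_scheme" and \<Gamma>\<^sub>0 :: "'g0 \<Rightarrow> 'k::field mat set" +
  assumes elementary: "elementary_grading n G\<^sub>0 \<Gamma>\<^sub>0"
begin

abbreviation A :: "('k, 'k mat) module" where "A \<equiv> matrix_algebra n"
abbreviation e :: "nat \<Rightarrow> nat \<Rightarrow> 'k mat" where "e \<equiv> matrix_unit n"

lemmas A_simps = module_mat_simps

sublocale G: group G by (rule group)

lemma matrix_unit_homogeneous:
  assumes "i < n" "j < n"
  obtains g where "g \<in> supp" "e i j \<in> \<Gamma> g"
proof -
  from elementary obtain \<gamma> where \<gamma>: "\<gamma> \<in> {..<n} \<rightarrow> carrier G\<^sub>0"
    "\<forall>i<n. \<forall>j<n. matrix_unit n i j \<in> \<Gamma>\<^sub>0 (\<gamma> i \<otimes>\<^bsub>G\<^sub>0\<^esub> inv\<^bsub>G\<^sub>0\<^esub> \<gamma> j)"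
    unfolding elementary_grading_def by (elim conjE bexE)
  interpret G0: group G\<^sub>0 using elementary by (simp add: elementary_grading_def grading_def)
  define g0 where "g0 = \<gamma> i \<otimes>\<^bsub>G\<^sub>0\<^esub> inv\<^bsub>G\<^sub>0\<^esub> \<gamma> j"
  have "g0 \<in> carrier G\<^sub>0" unfolding g0_def using \<gamma>(1) assms by auto
  moreover have "e i j \<in> \<Gamma>\<^sub>0 g0" unfolding g0_def using \<gamma>(2) assms by simp
  ultimately have g0: "g0 \<in> grading_supp A G\<^sub>0 \<Gamma>\<^sub>0"
    using matrix_unit_nonzero[OF assms, where 'k = 'k] by (auto simp: grading_supp_def A_simps)
  show thesis
  proof (rule that)
    show "realization_map \<Gamma>\<^sub>0 G \<Gamma> g0 \<in> supp" by (rule realization_mapD(1)[OF algebra realization g0])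
    show "e i j \<in> \<Gamma> (realization_map \<Gamma>\<^sub>0 G \<Gamma> g0)"
      unfolding realization_mapD(2)[OF algebra realization g0] by fact
  qed
qed

lemma component_carrier: "g \<in> carrier G \<Longrightarrow> a \<in> \<Gamma> g \<Longrightarrow> a \<in> carrier_mat n n"
  using component_closed(1) by (simp add: A_simps)

text \<open>
  The matrix unit is idempotent, so its degree is an idempotent of \<open>G\<close>.
\<close>

lemma diagonal_unit_degree_one:
  assumes "i < n"
  shows "e i i \<in> \<Gamma> \<one>\<^bsub>G\<^esub>"
proof -
  obtain g where g: "g \<in> supp" "e i i \<in> \<Gamma> g" using matrix_unit_homogeneous[OF assms assms] .
  note gc = supp_carrier[OF g(1)]
  have "e i i * e i i \<in> \<Gamma> (g \<otimes>\<^bsub>G\<^esub> g)"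
    using component_mult[OF gc gc g(2) g(2)] by (simp add: A_simps)
  then have "e i i \<in> \<Gamma> (g \<otimes>\<^bsub>G\<^esub> g)" by (simp only: matrix_unit_mult[OF assms assms assms])
  moreover have "e i i \<noteq> \<zero>\<^bsub>A\<^esub>" using matrix_unit_nonzero[OF assms assms] by (simp add: A_simps)
  ultimately have "g \<otimes>\<^bsub>G\<^esub> g = g" using component_disjoint[OF _ gc _ g(2)] gc by simp
  then have "g = \<one>\<^bsub>G\<^esub>" using gc by (simp add: G.r_cancel_one)
  then show ?thesis using g by simp
qed

lemma matrix_unit_in_component:
  assumes g: "g \<in> carrier G" and a: "a \<in> \<Gamma> g" and ij: "i < n" "j < n" and nz: "a $$ (i, j) \<noteq> 0"
  shows "e i j \<in> \<Gamma> g"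
proof -
  note ac = component_carrier[OF g a]
  have "e i i * a * e j j \<in> \<Gamma> (\<one>\<^bsub>G\<^esub> \<otimes>\<^bsub>G\<^esub> g \<otimes>\<^bsub>G\<^esub> \<one>\<^bsub>G\<^esub>)"
    using component_mult[OF _ G.one_closed component_mult[OF G.one_closed g diagonal_unit_degree_one[OF ij(1)] a]
        diagonal_unit_degree_one[OF ij(2)]] g by (simp add: A_simps)
  then have "a $$ (i, j) \<cdot>\<^sub>m e i j \<in> \<Gamma> g" using g by (simp add: matrix_unit_corner[OF ac ij])
  from component_closed(3)[OF g this, of "inverse (a $$ (i, j))"]
  have "inverse (a $$ (i, j)) \<cdot>\<^sub>m (a $$ (i, j) \<cdot>\<^sub>m e i j) \<in> \<Gamma> g" by (simp add: A_simps)
  also have "inverse (a $$ (i, j)) \<cdot>\<^sub>m (a $$ (i, j) \<cdot>\<^sub>m e i j) = e i j"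
    using nz by (intro eq_matI) simp_all
  finally show ?thesis .
qed

lemma supp_matrix_unit:
  assumes "g \<in> supp"
  obtains i j where "i < n" "j < n" "e i j \<in> \<Gamma> g"
proof -
  obtain a where a: "a \<in> \<Gamma> g" "a \<noteq> \<zero>\<^bsub>A\<^esub>" using suppE[OF assms] .
  note g = supp_carrier[OF assms]
  obtain i j where "i < n" "j < n" "a $$ (i, j) \<noteq> 0"
    using nonzero_entry[OF component_carrier[OF g a(1)]] a(2) by (auto simp: A_simps)
  then show thesis using that matrix_unit_in_component[OF g a(1)] by simp
qed

definition index_of :: "'g \<Rightarrow> nat \<times> nat" where
  "index_of g = (SOME p. fst p < n \<and> snd p < n \<and> e (fst p) (snd p) \<in> \<Gamma> g)"

lemma index_of:
  assumes "g \<in> supp"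
  shows "fst (index_of g) < n" "snd (index_of g) < n" "e (fst (index_of g)) (snd (index_of g)) \<in> \<Gamma> g"
proof -
  obtain i j where "i < n" "j < n" "e i j \<in> \<Gamma> g" using supp_matrix_unit[OF assms] .
  then have "fst (index_of g) < n \<and> snd (index_of g) < n \<and> e (fst (index_of g)) (snd (index_of g)) \<in> \<Gamma> g"
    unfolding index_of_def
    by (intro someI[of "\<lambda>p. fst p < n \<and> snd p < n \<and> e (fst p) (snd p) \<in> \<Gamma> g" "(i, j)"]) simp
  then show "fst (index_of g) < n" "snd (index_of g) < n" "e (fst (index_of g)) (snd (index_of g)) \<in> \<Gamma> g"
    by simp_all
qed

lemma finite_supp: "finite supp"
proof -
  have "inj_on index_of supp"
  proof (rule inj_onI)
    fix g h assume gh: "g \<in> supp" "h \<in> supp" "index_of g = index_of h"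
    show "g = h"
    proof (rule component_disjoint[OF supp_carrier[OF gh(1)] supp_carrier[OF gh(2)]])
      show "e (fst (index_of g)) (snd (index_of g)) \<in> \<Gamma> g" using index_of[OF gh(1)] by simp
      show "e (fst (index_of g)) (snd (index_of g)) \<in> \<Gamma> h" using index_of[OF gh(2)] gh(3) by simp
      show "e (fst (index_of g)) (snd (index_of g)) \<noteq> \<zero>\<^bsub>A\<^esub>"
        using index_of[OF gh(1)] matrix_unit_nonzero[where 'k = 'k] by (simp add: A_simps)
    qed
  qed
  moreover have "index_of ` supp \<subseteq> {..<n} \<times> {..<n}"
  proof
    fix p assume "p \<in> index_of ` supp"
    then obtain g where "g \<in> supp" "p = index_of g" by auto
    then show "p \<in> {..<n} \<times> {..<n}" using index_of[of g] by (simp add: mem_Times_iff)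
  qed
  ultimately show ?thesis by (meson finite_SigmaI finite_imageD finite_lessThan finite_subset)
qed

lemma one_degree_one: "\<one>\<^bsub>A\<^esub> \<in> \<Gamma> \<one>\<^bsub>G\<^esub>"
proof -
  interpret M: Module.module class_ring A by (rule linear)
  note S = M.submoduleE[OF submodule[OF G.one_closed]]
  \<comment> \<open>\<open>D m\<close> is the sum of the first \<open>m\<close> diagonal matrix units.\<close>
  define D where "D = (\<lambda>m. mat n n (\<lambda>(i, j). if i = j \<and> i < m then 1 else 0) :: 'k mat)"
  have "D m \<in> \<Gamma> \<one>\<^bsub>G\<^esub>" if "m \<le> n" for m
    using that
  proof (induction m)
    case 0
    have "D 0 = \<zero>\<^bsub>A\<^esub>" by (auto simp: D_def A_simps intro!: eq_matI)
    then show ?case using component_closed(2)[OF G.one_closed] by simp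
  next
    case (Suc m)
    have "D (Suc m) = D m \<oplus>\<^bsub>A\<^esub> e m m"
      by (auto simp: D_def A_simps matrix_unit_def intro!: eq_matI)
    then show ?case using S(5)[OF _ diagonal_unit_degree_one[of m]] Suc by simp
  qed
  moreover have "D n = \<one>\<^bsub>A\<^esub>" by (auto simp: D_def A_simps intro!: eq_matI)
  ultimately show ?thesis by (metis order_refl)
qed

context
  fixes U :: "('k, 'u) hopf" and \<psi> :: "('k, 'u, 'k mat) tensor \<Rightarrow> 'k mat"
  assumes hopf: "hopf_algebra U" and action: "hopf_action U A \<psi>"
    and diagonal: "\<And>u. u \<in> carrier U \<Longrightarrow>
      \<exists>l :: 'g \<Rightarrow> 'k. \<forall>g\<in>carrier G. \<forall>a\<in>\<Gamma> g. \<psi> (pure_tensor U A u a) = l g \<odot>\<^bsub>A\<^esub> a"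
begin

abbreviation act :: "'u \<Rightarrow> 'k mat \<Rightarrow> 'k mat" where "act u a \<equiv> \<psi> (pure_tensor U A u a)"

lemma act_bilinear: "act \<in> bilinear_maps U A A"
  by (rule bilinear_linear_map[OF pure_tensor_bilinear]) (use action in \<open>simp add: hopf_action_def\<close>)

lemma entry_linear:
  assumes "i < n" "j < n"
  shows "(\<lambda>a. a $$ (i, j)) \<in> linear_maps A base_algebra"
  by (rule linear_mapsI) (use assms in \<open>auto simp: A_simps base_algebra_simps\<close>)

text \<open>
  The scalar by which \<open>u\<close> acts on \<open>\<Gamma> g\<close>, read off from an entry of the image of a matrix unit of degree
  \<open>g\<close>; in this form it is visibly linear in \<open>u\<close>.
\<close>

definition weight :: "'g \<Rightarrow> 'u \<Rightarrow> 'k" where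
  "weight g = (\<lambda>u\<in>carrier U. act u (e (fst (index_of g)) (snd (index_of g))) $$ index_of g)"

lemma act_weight:
  assumes g: "g \<in> supp" and u: "u \<in> carrier U" and a: "a \<in> \<Gamma> g"
  shows "act u a = weight g u \<odot>\<^bsub>A\<^esub> a"
proof -
  from diagonal[OF u] obtain l :: "'g \<Rightarrow> 'k" where
    l: "\<forall>g\<in>carrier G. \<forall>a\<in>\<Gamma> g. act u a = l g \<odot>\<^bsub>A\<^esub> a" by (elim exE)
  define i j where "i = fst (index_of g)" and "j = snd (index_of g)"
  have ij: "index_of g = (i, j)" by (simp add: i_def j_def)
  note idx = index_of[OF g, folded i_def j_def]
  have "act u (e i j) = l g \<odot>\<^bsub>A\<^esub> e i j" using l supp_carrier[OF g] idx(3) by simp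
  then have "weight g u = (l g \<cdot>\<^sub>m e i j) $$ (i, j)"
    using u by (simp add: weight_def ij A_simps)
  also have "\<dots> = l g" using idx by (simp add: carrier_matD[OF matrix_unit_carrier] matrix_unit_index)
  finally show ?thesis using l supp_carrier[OF g] a by simp
qed

lemma weight_linear:
  assumes g: "g \<in> supp"
  shows "weight g \<in> linear_maps U base_algebra" "weight g \<in> extensional (carrier U)"
proof -
  note idx = index_of[OF g]
  have "e (fst (index_of g)) (snd (index_of g)) \<in> carrier A" by (simp add: A_simps matrix_unit_carrier)
  then have "(\<lambda>u. act u (e (fst (index_of g)) (snd (index_of g)))) \<in> linear_maps U A"
    using act_bilinear by (simp add: bilinear_maps_def)
  from linear_map_comp[OF this entry_linear[OF idx(1,2)]]
  show "weight g \<in> linear_maps U base_algebra"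
    unfolding weight_def by (intro linear_map_restrict[OF hopf_linear(1)[OF hopf]]) simp
  show "weight g \<in> extensional (carrier U)" by (simp add: weight_def)
qed

text \<open>
  Both sides are the scalar by which \<open>u\<close> acts on \<open>a b\<close>, computed directly and through
  \<open>u(ab) = (u\<^sub>1 a)(u\<^sub>2 b)\<close>; they are compared at a nonzero entry of \<open>a b\<close>.
\<close>

lemma weight_mult:
  assumes g: "g \<in> supp" and h: "h \<in> supp" and a: "a \<in> \<Gamma> g" and b: "b \<in> \<Gamma> h" and nz: "a \<otimes>\<^bsub>A\<^esub> b \<noteq> \<zero>\<^bsub>A\<^esub>"
  shows "g \<otimes>\<^bsub>G\<^esub> h \<in> supp" "weight (g \<otimes>\<^bsub>G\<^esub> h) = convolution U (weight g) (weight h)"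
proof -
  note gc = supp_carrier[OF g] and hc = supp_carrier[OF h]
  have ab: "a \<otimes>\<^bsub>A\<^esub> b \<in> \<Gamma> (g \<otimes>\<^bsub>G\<^esub> h)" by (rule component_mult[OF gc hc a b])
  show gh: "g \<otimes>\<^bsub>G\<^esub> h \<in> supp" by (rule suppI[OF G.m_closed[OF gc hc] ab nz])
  have ac: "a \<in> carrier A" and bc: "b \<in> carrier A" using component_closed(1) gc hc a b by simp_all
  have abc: "a * b \<in> carrier_mat n n" using ac bc by (simp add: A_simps)
  obtain i j where ij: "i < n" "j < n" "(a * b) $$ (i, j) \<noteq> 0"
    using nonzero_entry[OF abc] nz by (auto simp: A_simps)
  let ?c = "(a * b) $$ (i, j)"
  note lin = hopf_linear(1)[OF hopf] linear linear_space_base_algebra[where 'k = 'k]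
  note entry = entry_linear[OF ij(1,2)]
  note D = bilinear_mapsD[OF act_bilinear]
  have bil: "(\<lambda>x y. act x a \<otimes>\<^bsub>A\<^esub> act y b) \<in> bilinear_maps U U A"
  proof (rule bilinear_mapsI)
    fix x y assume x: "x \<in> carrier U" and y: "y \<in> carrier U"
    have xa: "act x a \<in> carrier A" and yb: "act y b \<in> carrier A" using D(1) x y ac bc by simp_all
    show "act x a \<otimes>\<^bsub>A\<^esub> act y b \<in> carrier A" using xa yb by (rule A.m_closed)
    show "act (x \<oplus>\<^bsub>U\<^esub> x') a \<otimes>\<^bsub>A\<^esub> act y b = act x a \<otimes>\<^bsub>A\<^esub> act y b \<oplus>\<^bsub>A\<^esub> act x' a \<otimes>\<^bsub>A\<^esub> act y b"
      if "x' \<in> carrier U" for x'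
      unfolding D(2)[OF x ac that] by (rule A.l_distr[OF xa D(1)[OF that ac] yb])
    show "act x a \<otimes>\<^bsub>A\<^esub> act (y \<oplus>\<^bsub>U\<^esub> y') b = act x a \<otimes>\<^bsub>A\<^esub> act y b \<oplus>\<^bsub>A\<^esub> act x a \<otimes>\<^bsub>A\<^esub> act y' b"
      if "y' \<in> carrier U" for y'
      unfolding D(2)[OF y bc that] by (rule A.r_distr[OF yb D(1)[OF that bc] xa])
    show "act (c \<odot>\<^bsub>U\<^esub> x) a \<otimes>\<^bsub>A\<^esub> act y b = c \<odot>\<^bsub>A\<^esub> (act x a \<otimes>\<^bsub>A\<^esub> act y b)"
      "act x a \<otimes>\<^bsub>A\<^esub> act (c \<odot>\<^bsub>U\<^esub> y) b = c \<odot>\<^bsub>A\<^esub> (act x a \<otimes>\<^bsub>A\<^esub> act y b)" for c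
      unfolding D(3)[OF x ac] D(3)[OF y bc] using algebra xa yb by (simp_all add: unital_algebra_def)
  qed
  have mult_c: "(\<lambda>y. y * ?c) \<in> linear_maps base_algebra base_algebra"
    by (rule linear_mapsI) (simp_all add: base_algebra_simps algebra_simps)
  note prod = functional_product_bilinear[OF weight_linear(1)[OF g] weight_linear(1)[OF h]]
  show "weight (g \<otimes>\<^bsub>G\<^esub> h) = convolution U (weight g) (weight h)"
  proof (rule extensionalityI[OF weight_linear(2)[OF gh]])
    show "convolution U (weight g) (weight h) \<in> extensional (carrier U)" by (simp add: convolution_def)
    fix u assume u: "u \<in> carrier U"
    note T = comult_closed[OF hopf u]
    have "weight (g \<otimes>\<^bsub>G\<^esub> h) u * ?c = act u (a \<otimes>\<^bsub>A\<^esub> b) $$ (i, j)"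
      unfolding act_weight[OF gh u ab] by (simp only: A_simps smult_mat_index[OF abc ij(1,2)])
    also have "act u (a \<otimes>\<^bsub>A\<^esub> b) = tensor_lift A (\<lambda>x y. act x a \<otimes>\<^bsub>A\<^esub> act y b) (comult U u)"
      using action u ac bc by (simp add: hopf_action_def)
    also have "\<dots> $$ (i, j) = tensor_lift base_algebra (\<lambda>x y. (act x a \<otimes>\<^bsub>A\<^esub> act y b) $$ (i, j)) (comult U u)"
      by (rule linear_map_tensor_lift[OF lin(1) lin(1) lin(2) lin(3) bil entry T])
    also have "\<dots> = tensor_lift base_algebra (\<lambda>x y. weight g x * weight h y * ?c) (comult U u)"
    proof (rule tensor_lift_cong[OF lin(1) lin(1) lin(3) bilinear_linear_map[OF bil entry]
          bilinear_linear_map[OF prod mult_c] _ T])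
      fix x y assume x: "x \<in> carrier U" and y: "y \<in> carrier U"
      have "act x a \<otimes>\<^bsub>A\<^esub> act y b = weight h y \<odot>\<^bsub>A\<^esub> (weight g x \<odot>\<^bsub>A\<^esub> (a \<otimes>\<^bsub>A\<^esub> b))"
        unfolding act_weight[OF g x a] act_weight[OF h y b]
        using algebra ac bc linear_space_scale(1)[OF linear] by (simp add: unital_algebra_def)
      then show "(act x a \<otimes>\<^bsub>A\<^esub> act y b) $$ (i, j) = weight g x * weight h y * ?c"
        using smult_carrier_mat[OF abc]
        by (simp only: A_simps smult_mat_index[OF _ ij(1,2)] abc mult.assoc mult.commute mult.left_commute)
    qed
    also have "\<dots> = tensor_lift base_algebra (\<lambda>x y. weight g x * weight h y) (comult U u) * ?c"
      by (rule linear_map_tensor_lift[OF lin(1) lin(1) lin(3) lin(3) prod mult_c T, symmetric])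
    also have "\<dots> = convolution U (weight g) (weight h) u * ?c" using u by (simp add: convolution_def)
    finally show "weight (g \<otimes>\<^bsub>G\<^esub> h) u = convolution U (weight g) (weight h) u" using ij(3) by simp
  qed
qed

lemma weight_one:
  assumes "n > 0"
  shows "\<one>\<^bsub>G\<^esub> \<in> supp" "weight \<one>\<^bsub>G\<^esub> = restrict (counit U) (carrier U)"
proof -
  have nz: "\<one>\<^bsub>A\<^esub> \<noteq> \<zero>\<^bsub>A\<^esub>"
  proof
    assume "\<one>\<^bsub>A\<^esub> = \<zero>\<^bsub>A\<^esub>"
    then have "(1\<^sub>m n :: 'k mat) $$ (0, 0) = (0\<^sub>m n n :: 'k mat) $$ (0, 0)" by (simp add: A_simps)
    then show False using assms by simp
  qed
  show one: "\<one>\<^bsub>G\<^esub> \<in> supp" by (rule suppI[OF G.one_closed one_degree_one nz])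
  show "weight \<one>\<^bsub>G\<^esub> = restrict (counit U) (carrier U)"
  proof (rule extensionalityI[OF weight_linear(2)[OF one]])
    fix u assume u: "u \<in> carrier U"
    have "weight \<one>\<^bsub>G\<^esub> u \<odot>\<^bsub>A\<^esub> \<one>\<^bsub>A\<^esub> = counit U u \<odot>\<^bsub>A\<^esub> \<one>\<^bsub>A\<^esub>"
      using act_weight[OF one u one_degree_one] action u by (simp add: hopf_action_def)
    then have "(weight \<one>\<^bsub>G\<^esub> u \<cdot>\<^sub>m 1\<^sub>m n) $$ (0, 0) = (counit U u \<cdot>\<^sub>m 1\<^sub>m n) $$ (0, 0)" by (simp add: A_simps)
    then show "weight \<one>\<^bsub>G\<^esub> u = restrict (counit U) (carrier U) u" using assms u by simp
  qed simp
qed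

text \<open>
  If \<open>e\<^sub>i\<^sub>j\<close> has degree \<open>g\<close>, the degree \<open>h\<close> of \<open>e\<^sub>j\<^sub>i\<close> is inverse to \<open>g\<close>, and the products \<open>e\<^sub>i\<^sub>i\<close> and \<open>e\<^sub>j\<^sub>j\<close>
  make the weights of \<open>g\<close> and \<open>h\<close> inverse to each other.
\<close>

lemma weight_unit:
  assumes g: "g \<in> supp"
  shows "weight g \<in> carrier (units_of (convolution_monoid U))"
proof -
  interpret M: Group.monoid "convolution_monoid U" by (rule monoid_convolution[OF hopf])
  have M_simps: "carrier (convolution_monoid U) = linear_maps U base_algebra \<inter> extensional (carrier U)"
    "x \<otimes>\<^bsub>convolution_monoid U\<^esub> y = convolution U x y"
    "\<one>\<^bsub>convolution_monoid U\<^esub> = restrict (counit U) (carrier U)" for x y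
    by (simp_all add: convolution_monoid_def)
  obtain i j where ij: "i < n" "j < n" "e i j \<in> \<Gamma> g" using supp_matrix_unit[OF g] .
  obtain h where h: "h \<in> supp" "e j i \<in> \<Gamma> h" using matrix_unit_homogeneous[OF ij(2,1)] .
  note gc = supp_carrier[OF g] and hc = supp_carrier[OF h(1)]
  have prod: "e i j \<otimes>\<^bsub>A\<^esub> e j i = e i i" "e j i \<otimes>\<^bsub>A\<^esub> e i j = e j j"
    using matrix_unit_mult[OF ij(1,2,1)] matrix_unit_mult[OF ij(2,1,2)] by (simp_all add: A_simps)
  have nz: "e i i \<noteq> \<zero>\<^bsub>A\<^esub>" "e j j \<noteq> \<zero>\<^bsub>A\<^esub>"
    using matrix_unit_nonzero[OF ij(1,1)] matrix_unit_nonzero[OF ij(2,2)] by (simp_all add: A_simps)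
  have "g \<otimes>\<^bsub>G\<^esub> h = \<one>\<^bsub>G\<^esub>"
    by (rule component_disjoint[OF G.m_closed[OF gc hc] G.one_closed
          component_mult[OF gc hc ij(3) h(2), unfolded prod] diagonal_unit_degree_one[OF ij(1)] nz(1)])
  moreover have "h \<otimes>\<^bsub>G\<^esub> g = \<one>\<^bsub>G\<^esub>"
    by (rule component_disjoint[OF G.m_closed[OF hc gc] G.one_closed
          component_mult[OF hc gc h(2) ij(3), unfolded prod] diagonal_unit_degree_one[OF ij(2)] nz(2)])
  moreover have "n > 0" using ij by simp
  ultimately have "convolution U (weight g) (weight h) = restrict (counit U) (carrier U)"
    "convolution U (weight h) (weight g) = restrict (counit U) (carrier U)"
    using weight_mult(2)[OF g h(1) ij(3) h(2)] weight_mult(2)[OF h(1) g h(2) ij(3)] nz weight_one(2)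
    by (simp_all add: prod)
  moreover have "weight g \<in> carrier (convolution_monoid U)" "weight h \<in> carrier (convolution_monoid U)"
    using weight_linear[OF g] weight_linear[OF h(1)] by (simp_all add: M_simps)
  ultimately show ?thesis
    by (auto simp: units_of_carrier Units_def M_simps)
qed

text \<open>
  Extend the weights to \<open>\<Phi>\<close> on \<open>G\<close>. The function \<open>x \<mapsto> \<Phi>(x)(u)\<close> is representative, hence constant with value
  \<open>\<Phi>(1)(u) = \<epsilon>(u)\<close>; so \<open>u\<close> acts by \<open>\<epsilon>(u)\<close> on every homogeneous component.
\<close>

theorem diagonal_action_trivial:
  assumes inf: "infinite (carrier G)" and no_quot: "no_nontrivial_finite_quotient G"
    and u: "u \<in> carrier U" and a: "a \<in> carrier A"
  shows "act u a = counit U u \<odot>\<^bsub>A\<^esub> a"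
proof -
  let ?Q = "units_of (convolution_monoid U)"
  interpret M: Group.monoid "convolution_monoid U" by (rule monoid_convolution[OF hopf])
  have Q: "group ?Q" by (rule M.units_group)
  have "\<exists>\<Phi>. \<Phi> \<in> hom G ?Q \<and> (\<forall>g\<in>supp. \<Phi> g = weight g)"
  proof (rule universal_hom[OF Q inf finite_supp])
    show "weight \<in> supp \<rightarrow> carrier ?Q" using weight_unit by simp
    show "weight (g \<otimes>\<^bsub>G\<^esub> h) = weight g \<otimes>\<^bsub>?Q\<^esub> weight h"
      if "g \<in> supp" "h \<in> supp" "a \<in> \<Gamma> g" "b \<in> \<Gamma> h" "a \<otimes>\<^bsub>A\<^esub> b \<noteq> \<zero>\<^bsub>A\<^esub>" for g h a b
      using weight_mult(2)[OF that] by (simp add: units_of_mult convolution_monoid_def)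
  qed
  then obtain \<Phi> where "\<Phi> \<in> hom G ?Q \<and> (\<forall>g\<in>supp. \<Phi> g = weight g)" by (elim exE)
  then have \<Phi>: "\<Phi> \<in> hom G ?Q" "\<And>g. g \<in> supp \<Longrightarrow> \<Phi> g = weight g" by simp_all
  have \<Phi>_linear: "\<Phi> x \<in> linear_maps U base_algebra" if "x \<in> carrier G" for x
  proof -
    have "\<Phi> x \<in> carrier ?Q" using \<Phi>(1) that by (auto simp: hom_def)
    then have "\<Phi> x \<in> carrier (convolution_monoid U)" by (simp add: units_of_carrier M.Units_closed)
    then show ?thesis by (simp add: convolution_monoid_def)
  qed
  have \<Phi>_mult: "\<Phi> (x \<otimes>\<^bsub>G\<^esub> y) = convolution U (\<Phi> x) (\<Phi> y)" if "x \<in> carrier G" "y \<in> carrier G" for x y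
    using \<Phi>(1) that by (simp add: hom_def units_of_mult convolution_monoid_def)
  have \<Phi>_one: "\<Phi> \<one>\<^bsub>G\<^esub> = restrict (counit U) (carrier U)"
    using hom_one[OF \<Phi>(1) group Q] by (simp add: units_of_one convolution_monoid_def)
  from convolution_expansion[OF hopf u] obtain P where "finite P \<and> (\<forall>l m. l \<in> linear_maps U base_algebra \<longrightarrow>
      m \<in> linear_maps U base_algebra \<longrightarrow> convolution U l m u = (\<Sum>(c, x, y)\<in>P. c * l x * m y))"
    by (elim exE)
  then have P: "finite P" "\<And>l m. l \<in> linear_maps U base_algebra \<Longrightarrow> m \<in> linear_maps U base_algebra \<Longrightarrow>
      convolution U l m u = (\<Sum>(c, x, y)\<in>P. c * l x * m y)" by simp_all
  have const: "\<Phi> g u = \<Phi> \<one>\<^bsub>G\<^esub> u" if "g \<in> carrier G" for g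
  proof (rule representative_function_constant[where f = "\<lambda>g. \<Phi> g u", OF group finite_supp _ generated_by_supp no_quot P(1) _ that])
    show "supp \<subseteq> carrier G" using supp_carrier by auto
    fix x y assume xy: "x \<in> carrier G" "y \<in> carrier G"
    show "\<Phi> (x \<otimes>\<^bsub>G\<^esub> y) u = (\<Sum>p\<in>P. (fst p * \<Phi> x (fst (snd p))) * \<Phi> y (snd (snd p)))"
      unfolding \<Phi>_mult[OF xy] P(2)[OF \<Phi>_linear[OF xy(1)] \<Phi>_linear[OF xy(2)]]
      by (simp add: split_beta)
  qed
  have weight_eq: "weight g u = counit U u" if "g \<in> supp" for g
    using const[OF supp_carrier[OF that]] \<Phi>(2)[OF that] \<Phi>_one u by simp
  from decomposition_exists[OF a] obtain d where d: "decomposition a d"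
    unfolding Ex1_def by (elim exE conjE)
  have ds: "g \<in> supp \<and> d g \<in> \<Gamma> g \<and> d g \<in> carrier A" if "d g \<noteq> \<zero>\<^bsub>A\<^esub>" for g
  proof -
    have g: "g \<in> carrier G" "d g \<in> \<Gamma> g" using d that unfolding decomposition_def by metis+
    then show ?thesis using suppI[OF g that] component_closed(1)[OF g] by simp
  qed
  let ?I = "{g. d g \<noteq> \<zero>\<^bsub>A\<^esub>}"
  have fin: "finite ?I" and a_sum: "a = (\<Oplus>\<^bsub>A\<^esub>g\<in>?I. d g)" using d by (simp_all add: decomposition_def)
  have act_lin: "act u \<in> linear_maps A A" using act_bilinear u by (simp add: bilinear_maps_def)
  have scale_lin: "(\<lambda>x. counit U u \<odot>\<^bsub>A\<^esub> x) \<in> linear_maps A A"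
    using linear_space_scale[OF linear]
    by (intro linear_mapsI) (simp_all flip: linear_space_scale(6)[OF linear] add: mult.commute)
  have "act u a = (\<Oplus>\<^bsub>A\<^esub>g\<in>?I. act u (d g))"
    unfolding a_sum using ds by (intro linear_map_finsum[OF linear linear act_lin] fin) simp
  also have "\<dots> = (\<Oplus>\<^bsub>A\<^esub>g\<in>?I. counit U u \<odot>\<^bsub>A\<^esub> d g)"
  proof (rule A.finsum_cong'[OF refl])
    show "(\<lambda>g. counit U u \<odot>\<^bsub>A\<^esub> d g) \<in> ?I \<rightarrow> carrier A" using ds linear_space_scale(1)[OF linear] by simp
    fix g assume "g \<in> ?I"
    then show "act u (d g) = counit U u \<odot>\<^bsub>A\<^esub> d g" using ds[of g] act_weight[of g u "d g"] u weight_eq[of g] by simp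
  qed
  also have "\<dots> = counit U u \<odot>\<^bsub>A\<^esub> a"
    using linear_map_finsum[OF linear linear scale_lin _ fin, of d] ds a_sum by simp
  finally show ?thesis .
qed

end

text \<open>
  The support generates an infinite group, so it is not contained in the trivial subgroup.
\<close>

lemma nontrivial_supp:
  assumes "infinite (carrier G)"
  obtains g where "g \<in> supp" "g \<noteq> \<one>\<^bsub>G\<^esub>"
proof -
  have "\<not> supp \<subseteq> {\<one>\<^bsub>G\<^esub>}"
  proof
    assume "supp \<subseteq> {\<one>\<^bsub>G\<^esub>}"
    then have "generate G supp \<subseteq> generate G {\<one>\<^bsub>G\<^esub>}" by (rule G.mono_generate)
    also have "generate G {\<one>\<^bsub>G\<^esub>} = {\<one>\<^bsub>G\<^esub>}" by (rule G.generate_one)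
    finally have "finite (carrier G)" using generated_by_supp finite_subset by auto
    then show False using assms by simp
  qed
  then show thesis using that by auto
qed

end

section \<open>Cosupports\<close>

lemma group_hopf_algebra_simps:
  "carrier (group_hopf_algebra G) = {x. Poly_Mapping.keys x \<subseteq> carrier G}"
  "\<zero>\<^bsub>group_hopf_algebra G\<^esub> = 0" "x \<oplus>\<^bsub>group_hopf_algebra G\<^esub> y = x + y"
  "c \<odot>\<^bsub>group_hopf_algebra G\<^esub> x = scale_sum c x" "\<one>\<^bsub>group_hopf_algebra G\<^esub> = Poly_Mapping.single \<one>\<^bsub>G\<^esub> 1"
  by (simp_all add: group_hopf_algebra_def group_algebra_def module.defs hopf.defs)

lemma linear_space_group_hopf_algebra:
  "linear_space (group_hopf_algebra G :: ('k::field, 'g \<Rightarrow>\<^sub>0 'k) hopf)"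
proof (rule moduleI)
  let ?H = "group_hopf_algebra G :: ('k, 'g \<Rightarrow>\<^sub>0 'k) hopf"
  note simps = group_hopf_algebra_simps
  have add: "Poly_Mapping.keys (x + y) \<subseteq> carrier G"
    if "Poly_Mapping.keys x \<subseteq> carrier G" "Poly_Mapping.keys y \<subseteq> carrier G" for x y :: "'g \<Rightarrow>\<^sub>0 'k"
    using that Poly_Mapping.keys_add[of x y] by auto
  show "cring (class_ring :: 'k ring)" by (rule class_cring.is_cring)
  show "abelian_group ?H"
  proof (rule abelian_groupI)
    fix x y assume "x \<in> carrier ?H" "y \<in> carrier ?H"
    then show "x \<oplus>\<^bsub>?H\<^esub> y \<in> carrier ?H" using add by (simp add: simps)
  next
    fix x assume "x \<in> carrier ?H"
    then have "- x \<in> carrier ?H" "- x \<oplus>\<^bsub>?H\<^esub> x = \<zero>\<^bsub>?H\<^esub>" by (simp_all add: simps)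
    then show "\<exists>y\<in>carrier ?H. y \<oplus>\<^bsub>?H\<^esub> x = \<zero>\<^bsub>?H\<^esub>" by (rule bexI[rotated])
  qed (simp_all add: simps add.assoc add.commute)
  fix c :: 'k and x assume "x \<in> carrier ?H"
  then show "c \<odot>\<^bsub>?H\<^esub> x \<in> carrier ?H" using keys_scale_sum[of c x] by (auto simp: simps)
qed (simp_all add: group_hopf_algebra_simps scale_sum_simps)

theorem theorem7p5:
  fixes n :: nat
    and G\<^sub>0 :: "'g0 monoid" and \<Gamma>\<^sub>0 :: "'g0 \<Rightarrow> 'k::field mat set"
    and G :: "'g monoid" and \<Gamma> :: "'g \<Rightarrow> 'k mat set"
    and \<rho> :: "'k mat \<Rightarrow> ('k, 'k mat, 'g \<Rightarrow>\<^sub>0 'k) tensor"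
    and V :: "('k mat \<Rightarrow> 'k mat) set"
    and U :: "('k, 'u) hopf" and \<psi> :: "('k, 'u, 'k mat) tensor \<Rightarrow> 'k mat"
  assumes "group G" and "infinite (carrier G)" and "finitely_presented G"
    and "no_nontrivial_finite_quotient G"
    and "elementary_grading n G\<^sub>0 \<Gamma>\<^sub>0"
    and "universal_group (matrix_algebra n) G\<^sub>0 \<Gamma>\<^sub>0 G \<Gamma>"
    and "hopf_coaction (group_hopf_algebra G) (matrix_algebra n) \<rho>"
    and "\<And>g a. g \<in> carrier G \<Longrightarrow> a \<in> \<Gamma> g \<Longrightarrow>
           \<rho> a = pure_tensor (matrix_algebra n) (group_hopf_algebra G) a (Poly_Mapping.single g 1)"
    and "V = cosupp_coaction (group_hopf_algebra G) (matrix_algebra n) \<rho>"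
    and "universal_acting_hopf_algebra TYPE('h) (matrix_algebra n) V U \<psi>"
  shows "cosupp_action U (matrix_algebra n) \<psi> = scalar_maps (matrix_algebra n) \<and>
         scalar_maps (matrix_algebra n) \<subset> V"
proof -
  interpret graded_matrix_algebra n G \<Gamma> G\<^sub>0 \<Gamma>\<^sub>0
    using assms(5,6) unital_matrix_algebra
    by unfold_locales (simp_all add: universal_group_def grading_realization_def)
  let ?kG = "group_hopf_algebra G :: ('k, 'g \<Rightarrow>\<^sub>0 'k) hopf"
  have hopf: "hopf_algebra U" and action: "hopf_action U A \<psi>" and sub: "cosupp_action U A \<psi> \<subseteq> V"
    using assms(10) by (simp_all add: universal_acting_hopf_algebra_def)
  have functional: "tensor_lift A (\<lambda>x t. l t \<odot>\<^bsub>A\<^esub> x) (\<rho> a) = l (Poly_Mapping.single g 1) \<odot>\<^bsub>A\<^esub> a"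
    if l: "l \<in> linear_maps ?kG base_algebra" and g: "g \<in> carrier G" and a: "a \<in> \<Gamma> g" for l g a
  proof -
    note L = linear_mapsD[OF l, unfolded base_algebra_simps]
    have "(\<lambda>x t. l t \<odot>\<^bsub>A\<^esub> x) \<in> bilinear_maps A ?kG A"
      by (rule bilinear_mapsI)
        (simp_all add: L(2,3) linear_space_scale[OF linear] flip: linear_space_scale(6)[OF linear], simp_all add: mult.commute)
    from tensor_lift_pure[OF linear linear_space_group_hopf_algebra linear this component_closed(1)[OF g a]]
    show ?thesis using g by (simp add: assms(8)[OF g a] group_hopf_algebra_simps)
  qed
  have V_diagonal: "\<exists>l :: 'g \<Rightarrow> 'k. \<forall>g\<in>carrier G. \<forall>a\<in>\<Gamma> g. v a = l g \<odot>\<^bsub>A\<^esub> a" if "v \<in> V" for v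
  proof -
    from that obtain l where l: "l \<in> linear_maps ?kG base_algebra"
      "v = (\<lambda>a\<in>carrier A. tensor_lift A (\<lambda>x t. l t \<odot>\<^bsub>A\<^esub> x) (\<rho> a))"
      by (auto simp: assms(9) cosupp_coaction_def)
    show ?thesis
    proof (intro exI[of _ "\<lambda>g. l (Poly_Mapping.single g 1)"] ballI)
      fix g a assume ga: "g \<in> carrier G" "a \<in> \<Gamma> g"
      show "v a = l (Poly_Mapping.single g 1) \<odot>\<^bsub>A\<^esub> a"
        using functional[OF l(1) ga] component_closed(1)[OF ga] by (simp add: l(2))
    qed
  qed
  have diagonal: "\<exists>l :: 'g \<Rightarrow> 'k. \<forall>g\<in>carrier G. \<forall>a\<in>\<Gamma> g. \<psi> (pure_tensor U A u a) = l g \<odot>\<^bsub>A\<^esub> a"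
    if u: "u \<in> carrier U" for u
  proof -
    have "(\<lambda>a\<in>carrier A. \<psi> (pure_tensor U A u a)) \<in> V" using sub u by (auto simp: cosupp_action_def)
    from V_diagonal[OF this] obtain l :: "'g \<Rightarrow> 'k" where
      l: "\<forall>g\<in>carrier G. \<forall>a\<in>\<Gamma> g. (\<lambda>a\<in>carrier A. \<psi> (pure_tensor U A u a)) a = l g \<odot>\<^bsub>A\<^esub> a" by (elim exE)
    show ?thesis
    proof (intro exI[of _ l] ballI)
      fix g a assume ga: "g \<in> carrier G" "a \<in> \<Gamma> g"
      show "\<psi> (pure_tensor U A u a) = l g \<odot>\<^bsub>A\<^esub> a"
        using bspec[OF bspec[OF l ga(1)] ga(2)] component_closed(1)[OF ga] by simp
    qed
  qed
  note trivial = diagonal_action_trivial[OF hopf action diagonal assms(2,4)]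
  have eq: "cosupp_action U A \<psi> = scalar_maps A"
  proof (rule equalityI; rule subsetI)
    fix v assume "v \<in> cosupp_action U A \<psi>"
    then obtain u where u: "u \<in> carrier U" "v = (\<lambda>a\<in>carrier A. \<psi> (pure_tensor U A u a))"
      by (auto simp: cosupp_action_def)
    then have "v = (\<lambda>a\<in>carrier A. counit U u \<odot>\<^bsub>A\<^esub> a)" using trivial[OF _ u(1)] by (simp cong: restrict_cong)
    then show "v \<in> scalar_maps A" unfolding scalar_maps_def by auto
  next
    fix v assume "v \<in> scalar_maps A"
    then obtain c where v: "v = (\<lambda>a\<in>carrier A. c \<odot>\<^bsub>A\<^esub> a)" by (auto simp: scalar_maps_def)
    interpret U: ring U using hopf by (simp add: hopf_algebra_def unital_algebra_def)
    have "c \<odot>\<^bsub>U\<^esub> \<one>\<^bsub>U\<^esub> \<in> carrier U" by (rule linear_space_scale(1)[OF hopf_linear(1)[OF hopf] U.one_closed])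
    moreover have "\<psi> (pure_tensor U A (c \<odot>\<^bsub>U\<^esub> \<one>\<^bsub>U\<^esub>) a) = c \<odot>\<^bsub>A\<^esub> a" if "a \<in> carrier A" for a
      using bilinear_mapsD(3)[OF act_bilinear[OF hopf action diagonal] U.one_closed that, of c] action that
      by (simp add: hopf_action_def)
    then have "v = (\<lambda>a\<in>carrier A. \<psi> (pure_tensor U A (c \<odot>\<^bsub>U\<^esub> \<one>\<^bsub>U\<^esub>) a))"
      unfolding v by (simp cong: restrict_cong)
    ultimately show "v \<in> cosupp_action U A \<psi>" unfolding cosupp_action_def by auto
  qed
  obtain g where g: "g \<in> supp" "g \<noteq> \<one>\<^bsub>G\<^esub>" using nontrivial_supp[OF assms(2)] .
  note gc = supp_carrier[OF g(1)]
  obtain i j where ij: "i < n" "j < n" "e i j \<in> \<Gamma> g" using supp_matrix_unit[OF g(1)] .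
  \<comment> \<open>The coefficient functional at \<open>g\<close>; the corresponding element of \<open>V\<close> is the projection onto \<open>\<Gamma> g\<close>.\<close>
  define l where "l = (\<lambda>t :: 'g \<Rightarrow>\<^sub>0 'k. Poly_Mapping.lookup t g)"
  have l: "l \<in> linear_maps ?kG base_algebra"
    by (rule linear_mapsI) (simp_all add: l_def group_hopf_algebra_simps base_algebra_simps lookup_add lookup_scale_sum)
  define v where "v = (\<lambda>a\<in>carrier A. tensor_lift A (\<lambda>x t. l t \<odot>\<^bsub>A\<^esub> x) (\<rho> a))"
  have "v \<in> V" unfolding assms(9) cosupp_coaction_def v_def using l by auto
  moreover have "v \<notin> scalar_maps A"
  proof
    assume "v \<in> scalar_maps A"
    then obtain c where c: "v = (\<lambda>a\<in>carrier A. c \<odot>\<^bsub>A\<^esub> a)" by (auto simp: scalar_maps_def)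
    have scalar: "l (Poly_Mapping.single h 1) \<cdot>\<^sub>m a = c \<cdot>\<^sub>m a" if h: "h \<in> carrier G" "a \<in> \<Gamma> h" for h a
      using fun_cong[OF c, of a] functional[OF l h] component_closed(1)[OF h] by (simp add: v_def A_simps)
    have "(1 \<cdot>\<^sub>m e i j) $$ (i, j) = (c \<cdot>\<^sub>m e i j) $$ (i, j)" using scalar[OF gc ij(3)] by (simp add: l_def)
    then have "c = 1" using ij by (simp add: carrier_matD[OF matrix_unit_carrier] matrix_unit_index)
    have "(0 \<cdot>\<^sub>m e i i) $$ (i, i) = (c \<cdot>\<^sub>m e i i) $$ (i, i)"
      using scalar[OF G.one_closed diagonal_unit_degree_one[OF ij(1)]] g(2) by (simp add: l_def lookup_single)
    then have "c = 0" using ij by (simp add: carrier_matD[OF matrix_unit_carrier] matrix_unit_index)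
    with \<open>c = 1\<close> show False by simp
  qed
  ultimately show ?thesis using eq sub by auto
qed

end
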